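(* Let $n\ge1$ be an integer, $\alpha\in(0,2)$ and $\nu>0$. For a positive integer $N$, the following formula is valid: $$q_{\alpha,\nu,n}(r)=S_{\alpha,\nu,n;N}(r)+R_{\alpha,\nu,n;N}(r),$$ where $$\begin{aligned}S_{\alpha,\nu,n;N}(r)=\frac{1}{2^n\pi^{\frac n2}\Gamma(\nu)}\Biggl\{&\sum_{\substack{0\le l\le N-1\\ l\ne\frac{n+2j}{\alpha}-\nu\ \text{for any } j\in\hat{\mathbb{N}}}}\frac{(-1)^l}{l!}\Gamma(\nu+l)\frac{\Gamma\left(\frac{n-\alpha(\nu+l)}{2}\right)}{\Gamma\left(\frac{\alpha(\nu+l)}{2}\right)}\left(\frac r2\right)^{\alpha\nu-n+\alpha l}\\ &+\frac2\alpha\sum_{\substack{0\le j\le\left[\frac{\alpha(\nu+N-\frac12)-n}{2}\right]\\ j\ne\frac{\alpha(\nu+l)-n}{2}\ \text{for any } l\in\hat{\mathbb{N}}}}\frac{(-1)^j}{j!}\frac{\Gamma\left(\frac{n+2j}{\alpha}\right)}{\Gamma\left(\frac{n+2j}{2}\right)}\Gamma\left(\frac{\alpha\nu-n-2j}{\alpha}\right)\left(\frac r2\right)^{2j}\\ &-\sum_{\substack{0\le l\le N-1\\ l=\frac{n+2j}{\alpha}-\nu\ \text{for some } j\in\hat{\mathbb{N}}}}\frac{(-1)^{l+\frac{\alpha(\nu+l)-n}{2}}}{l!\left(\frac{\alpha(\nu+l)-n}{2}\right)!}\frac{\Gamma(\nu+l)}{\Gamma\left(\frac{\alpha(\nu+l)}{2}\right)}\Bigl\{\tfrac2\alpha\psi(\nu+l)-\tfrac2\alpha\psi(l+1)-\psi\left(\tfrac{\alpha(\nu+l)}{2}\right)\\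 &\qquad-\psi\left(\tfrac{\alpha(\nu+l)-n}{2}+1\right)+\log\left(\tfrac r2\right)^2\Bigr\}\left(\frac r2\right)^{\alpha\nu-n+\alpha l}\Biggr\}\end{aligned}$$ and $$R_{\alpha,\nu,n;N}(r)=O\left(r^{\alpha\nu-n+\alpha\left(N-\frac34\right)}\right)\qquad\text{as } r\to0.$$ Note that the third summation in the formula for $S_{\alpha,\nu,n;N}(r)$ is zero if and only if $(\alpha,\nu)\notin\Lambda_n$.
   Context: $\Vert\cdot\Vert$ is the Euclidean norm on $\mathbb{R}^n$. For an integer $n\ge1$, $\alpha\in(0,2]$, $\nu>0$, $p_{\alpha,\nu,n}$ denotes the probability density function on $\mathbb{R}^n$ whose characteristic function is $\int_{\mathbb{R}^n}e^{i\mathbf{x}\cdot\boldsymbol{t}}p_{\alpha,\nu,n}(\mathbf{x})\,d^n\mathbf{x}=(1+\Vert\boldsymbol{t}\Vert^\alpha)^{-\nu}$ for all $\boldsymbol{t}\in\mathbb{R}^n$. It is a radial function; one takes the version which is continuous on $\mathbb{R}^n\setminus\{\mathbf{0}\}$, and $q_{\alpha,\nu,n}(r)$, $r>0$, denotes the value of $p_{\alpha,\nu,n}(\mathbf{x})$ at points with $\Vert\mathbf{x}\Vert=r$. $\hat{\mathbb{N}}=\{0,1,2,\ldots\}$; $\psi=\Gamma'/\Gamma$ is the digamma function; $[x]$ is the integer part of $x$; empty sums are zero. $\Lambda_n=\{(\alpha,\nu)\in(0,2)\times\mathbb{R}_+ : n+2j=\alpha(\nu+l)\text{ for some }(j,l)\in\hat{\mathbb{N}}\times\hat{\mathbb{N}}\}$,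 with $\mathbb{R}_+=(0,\infty)$.
   Formalization: The closing note is proved with N ranging over all positive integers: the third summation vanishes for every N and every r>0 iff (α,ν)∉Λ_n; for one fixed N it fails (n=1, α=1, ν=2, N=1). *)

theory Defs
  imports "HOL-Probability.Probability" "HOL-Library.Landau_Symbols"
begin

text \<open>The version of the density that is continuous off the origin; it is unique there, and its value
  at the origin plays no role (the density may be unbounded near \<open>0\<close>).\<close>

definition linnik_density :: "real \<Rightarrow> real \<Rightarrow> ('a::euclidean_space \<Rightarrow> real) \<Rightarrow> bool" where
  "linnik_density \<alpha> \<nu> p \<longleftrightarrow>
     p \<in> borel_measurable borel \<and> (\<forall>x. 0 \<le> p x) \<and>
     prob_space (density lborel (\<lambda>x. ennreal (p x))) \<and>
     (\<forall>t. (CLINT x|lborel. iexp (x \<bullet> t) * complex_of_real (p x))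
          = complex_of_real ((1 + norm t powr \<alpha>) powr (- \<nu>))) \<and>
     continuous_on (- {0}) p"

definition Lambda_set :: "nat \<Rightarrow> (real \<times> real) set" where
  "Lambda_set n = {(\<alpha>, \<nu>). \<alpha> \<in> {0<..<2} \<and> \<nu> \<in> {0<..} \<and>
     (\<exists>j l :: nat. real n + 2 * real j = \<alpha> * (\<nu> + real l))}"

definition S_sum1 :: "real \<Rightarrow> real \<Rightarrow> nat \<Rightarrow> nat \<Rightarrow> real \<Rightarrow> real" where
  "S_sum1 \<alpha> \<nu> n N r =
     (\<Sum>l | l \<le> N - 1 \<and> (\<forall>j::nat. real l \<noteq> (real n + 2 * real j) / \<alpha> - \<nu>).
        (-1) ^ l / fact l * Gamma (\<nu> + real l)
        * (Gamma ((real n - \<alpha> * (\<nu> + real l)) / 2) / Gamma (\<alpha> * (\<nu> + real l) / 2))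
        * (r / 2) powr (\<alpha> * \<nu> - real n + \<alpha> * real l))"

text \<open>The integer part is read as the floor, so the sum is empty when the upper limit is negative.\<close>

definition S_sum2 :: "real \<Rightarrow> real \<Rightarrow> nat \<Rightarrow> nat \<Rightarrow> real \<Rightarrow> real" where
  "S_sum2 \<alpha> \<nu> n N r =
     (\<Sum>j | int j \<le> \<lfloor>(\<alpha> * (\<nu> + real N - 1/2) - real n) / 2\<rfloor> \<and>
            (\<forall>l::nat. real j \<noteq> (\<alpha> * (\<nu> + real l) - real n) / 2).
        (-1) ^ j / fact j * (Gamma ((real n + 2 * real j) / \<alpha>) / Gamma ((real n + 2 * real j) / 2))
        * Gamma ((\<alpha> * \<nu> - real n - 2 * real j) / \<alpha>)
        * (r / 2) ^ (2 * j))"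

text \<open>For the indices \<open>l\<close> of this sum, \<open>(\<alpha> (\<nu> + l) - n) / 2\<close> is a natural number \<open>j\<close>; the
  composition \<open>nat \<lfloor>_\<rfloor>\<close> only changes its type, without rounding.\<close>

definition S_sum3 :: "real \<Rightarrow> real \<Rightarrow> nat \<Rightarrow> nat \<Rightarrow> real \<Rightarrow> real" where
  "S_sum3 \<alpha> \<nu> n N r =
     (\<Sum>l | l \<le> N - 1 \<and> (\<exists>j::nat. real l = (real n + 2 * real j) / \<alpha> - \<nu>).
        let j = nat \<lfloor>(\<alpha> * (\<nu> + real l) - real n) / 2\<rfloor> in
        (-1) ^ (l + j) / (fact l * fact j)
        * (Gamma (\<nu> + real l) / Gamma (\<alpha> * (\<nu> + real l) / 2))
        * (2 / \<alpha> * Digamma (\<nu> + real l) - 2 / \<alpha> * Digamma (real l + 1)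
           - Digamma (\<alpha> * (\<nu> + real l) / 2)
           - Digamma ((\<alpha> * (\<nu> + real l) - real n) / 2 + 1)
           + ln ((r / 2)\<^sup>2))
        * (r / 2) powr (\<alpha> * \<nu> - real n + \<alpha> * real l))"

definition S_expansion :: "real \<Rightarrow> real \<Rightarrow> nat \<Rightarrow> nat \<Rightarrow> real \<Rightarrow> real" where
  "S_expansion \<alpha> \<nu> n N r =
     1 / (2 ^ n * pi powr (real n / 2) * Gamma \<nu>)
     * (S_sum1 \<alpha> \<nu> n N r + 2 / \<alpha> * S_sum2 \<alpha> \<nu> n N r - S_sum3 \<alpha> \<nu> n N r)"

end

theory Submission
  imports Defs "HOL-Complex_Analysis.Complex_Analysis"
begin

text \<open>
  Averaging the characteristic function against Gaussians gives the Laplace transform of the law of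
  \<open>\<parallel>X\<parallel>\<^sup>2\<close>, and integrating that against powers gives the Mellin transform of the radial density \<open>q\<close>
  on a vertical line: up to elementary factors it is
  \<open>G z = Gamma z * Gamma (\<nu> - z) * Gamma ((n - \<alpha> z) / 2) / Gamma (\<alpha> z / 2)\<close>.
  Since \<open>q\<close> is nonnegative, this Mellin transform is the characteristic function of a probability law
  on the line, and Levy's inversion formula represents \<open>q r\<close> as a contour integral of
  \<open>G z * (r / 2) powr (\<alpha> z - n)\<close>. The kernel \<open>G\<close> decays faster than any power on vertical lines, because
  \<open>Gamma\<close> does so and \<open>Gamma ((n - \<alpha> z) / 2) / Gamma (\<alpha> z / 2)\<close> grows polynomially. Shifting the contour to
  the right of \<open>Re z = \<nu> + N - 1/2\<close> therefore leaves a remainder of the claimed order, and the residues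
  picked up on the way are the three sums: the simple poles \<open>\<nu> + l\<close>, the simple poles \<open>(n + 2 j) / \<alpha>\<close>, and
  the double poles where the two families meet.
\<close>

subsection \<open>Gamma integrals in a logarithmic variable\<close>

text \<open>Pairing with a Gaussian is a plain Fubini argument, and Gaussians are radial and closed
  under the Fourier transform, with the variance inverted. This yields one Laplace identity between
  the unknown radial profile and the explicit \<open>(1 + r powr \<alpha>) powr (- \<nu>)\<close>.
  Convergence of the Mellin integral of \<open>q\<close> is a consequence of that identity: Tonelli
  carries finiteness over from a Beta integral, on the strip 0 < Re z < min(\<nu>, n / \<alpha>).
  Continuity of the density off the origin then makes the one-dimensional inversion valid at every r
  > 0 and not just almost everywhere. A pole (n + 2 j) / \<alpha> may lie exactly on Re z = \<nu> +
  N - 1/2, so the new line is put strictly to the right of that abscissa and short of the next pole.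
  The exponent with N - 3/4 in the remainder leaves room for this.\<close>

lemma Gamma_integral_exp:
  assumes "Re w > 0"
  shows "integrable lborel (\<lambda>u. exp (w * of_real u) * of_real (exp (- exp u)))"
    and "(\<integral>u. exp (w * of_real u) * of_real (exp (- exp u)) \<partial>lborel) = Gamma w"
proof -
  let ?f = "\<lambda>t::real. complex_of_real t powr (w - 1) / of_real (exp t)"
  have img: "range (exp :: real \<Rightarrow> real) = {0<..}"
    by (auto simp: image_iff) (metis exp_ln)
  have "?f absolutely_integrable_on {0<..} \<and> integral {0<..} ?f = Gamma w"
    using absolutely_integrable_Gamma_integral'[OF assms] Gamma_integral_complex'[OF assms]
    by (simp add: integral_unique)
  \<comment> \<open>The substitution is t = exp x; its Jacobian turns the exponent
    \<open>w - 1\<close> into \<open>w\<close>. It is carried out for absolutely integrable gauge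
    integrals and transferred to \<open>lborel\<close> afterwards.\<close>
  then have "(\<lambda>x. \<bar>exp x\<bar> *\<^sub>R ?f (exp x)) absolutely_integrable_on UNIV
      \<and> integral UNIV (\<lambda>x. \<bar>exp x\<bar> *\<^sub>R ?f (exp x)) = Gamma w"
    by (subst has_absolute_integral_change_of_variables_real)
       (auto intro!: derivative_eq_intros inj_onI simp: img)
  moreover have "\<bar>exp x\<bar> *\<^sub>R ?f (exp x) = exp (w * of_real x) * of_real (exp (- exp x))" for x :: real
    by (simp add: powr_def scaleR_conv_of_real exp_of_real [symmetric] Ln_of_real exp_minus
        divide_simps flip: exp_add)
       (simp add: algebra_simps flip: exp_add)
  ultimately have *: "(\<lambda>x. exp (w * of_real x) * of_real (exp (- exp x))) absolutely_integrable_on UNIV"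
    and **: "integral UNIV (\<lambda>x. exp (w * of_real x) * of_real (exp (- exp x))) = Gamma w"
    by simp_all
  show int: "integrable lborel (\<lambda>u. exp (w * of_real u) * of_real (exp (- exp u)))"
    using * by (simp add: set_integrable_def integrable_completion)
  show "(\<integral>u. exp (w * of_real u) * of_real (exp (- exp u)) \<partial>lborel) = Gamma w"
    using ** int by (simp add: integral_lborel)
qed

lemma Gamma_integral_exp_shift:
  assumes "Re w > 0"
  shows "integrable lborel (\<lambda>u. exp (w * of_real u) * of_real (exp (- exp (u + k))))"
    and "(\<integral>u. exp (w * of_real u) * of_real (exp (- exp (u + k))) \<partial>lborel)
           = Gamma w * exp (- w * of_real k)"
proof -
  let ?g = "\<lambda>u. exp (w * of_real u) * of_real (exp (- exp u))"
  have eq: "exp (w * of_real u) * of_real (exp (- exp (u + k))) = ?g (k + 1 * u) * exp (- w * of_real k)" for u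
    by (simp add: algebra_simps exp_add exp_minus)
  show "integrable lborel (\<lambda>u. exp (w * of_real u) * of_real (exp (- exp (u + k))))"
    unfolding eq by (intro integrable_mult_left lborel_integrable_real_affine Gamma_integral_exp assms) auto
  show "(\<integral>u. exp (w * of_real u) * of_real (exp (- exp (u + k))) \<partial>lborel)
           = Gamma w * exp (- w * of_real k)"
    unfolding eq using lborel_integral_real_affine[of 1 ?g k] Gamma_integral_exp(2)[OF assms] by simp
qed

text \<open>The extended nonnegative form is the one Tonelli needs, in places where finiteness is
  still to be shown.\<close>

lemma nn_integral_Gamma_exp_shift:
  fixes a k :: real
  assumes "a > 0"
  shows "(\<integral>\<^sup>+u. ennreal (exp (a * u) * exp (- exp (u + k))) \<partial>lborel) = ennreal (Gamma a * exp (- a * k))"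
proof -
  have eq: "exp (complex_of_real a * of_real u) * of_real (exp (- exp (u + k)))
      = complex_of_real (exp (a * u) * exp (- exp (u + k)))" for u
    by (simp flip: exp_of_real)
  have 1: "integrable lborel (\<lambda>u. complex_of_real (exp (a * u) * exp (- exp (u + k))))"
    using Gamma_integral_exp_shift(1)[of "of_real a" k] assms unfolding eq by simp
  have "(\<integral>u. complex_of_real (exp (a * u) * exp (- exp (u + k))) \<partial>lborel)
      = complex_of_real (Gamma a * exp (- a * k))"
    using Gamma_integral_exp_shift(2)[of "of_real a" k] assms unfolding eq
    by (simp add: Gamma_complex_of_real flip: exp_of_real)
  then have 2: "(\<integral>u. exp (a * u) * exp (- exp (u + k)) \<partial>lborel) = Gamma a * exp (- a * k)"
    by (simp only: integral_complex_of_real of_real_eq_iff)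
  show ?thesis
    using 1 unfolding complex_of_real_integrable_eq
    by (subst nn_integral_eq_integral) (auto simp: 2)
qed

text \<open>With s = exp u the inner integral is the Laplace transform at s of the image of
  \<open>h v\<close> dv under \<open>exp (g v)\<close>. Swapping the integrals leaves a Gamma
  integral in u, so a Mellin integral of a Laplace transform becomes a moment of order -a.\<close>

lemma nn_integral_exp_kernel:
  fixes h g :: "real \<Rightarrow> real"
  assumes [measurable]: "h \<in> borel_measurable borel" "g \<in> borel_measurable borel"
    and h: "\<And>v. h v \<ge> 0" and a: "a > 0"
  shows "(\<integral>\<^sup>+u. ennreal (exp (a * u)) * (\<integral>\<^sup>+v. ennreal (h v * exp (- exp (u + g v))) \<partial>lborel) \<partial>lborel)
         = ennreal (Gamma a) * (\<integral>\<^sup>+v. ennreal (h v * exp (- a * g v)) \<partial>lborel)"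
proof -
  have "(\<integral>\<^sup>+u. ennreal (exp (a * u)) * (\<integral>\<^sup>+v. ennreal (h v * exp (- exp (u + g v))) \<partial>lborel) \<partial>lborel)
      = (\<integral>\<^sup>+u. (\<integral>\<^sup>+v. ennreal (h v) * ennreal (exp (a * u) * exp (- exp (u + g v))) \<partial>lborel) \<partial>lborel)"
    using h by (subst nn_integral_cmult[symmetric])
      (auto intro!: nn_integral_cong simp: ennreal_mult'[symmetric] mult_ac)
  also have "\<dots> = (\<integral>\<^sup>+v. (\<integral>\<^sup>+u. ennreal (h v) * ennreal (exp (a * u) * exp (- exp (u + g v))) \<partial>lborel) \<partial>lborel)"
    by (rule lborel_pair.Fubini') measurable
  also have "\<dots> = (\<integral>\<^sup>+v. ennreal (h v) * ennreal (Gamma a * exp (- a * g v)) \<partial>lborel)"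
    by (simp add: nn_integral_cmult nn_integral_Gamma_exp_shift[OF a])
  also have "\<dots> = (\<integral>\<^sup>+v. ennreal (Gamma a) * ennreal (h v * exp (- a * g v)) \<partial>lborel)"
    using h a by (intro nn_integral_cong)
      (auto simp: ennreal_mult'[symmetric] mult_ac less_imp_le[OF Gamma_real_pos])
  also have "\<dots> = ennreal (Gamma a) * (\<integral>\<^sup>+v. ennreal (h v * exp (- a * g v)) \<partial>lborel)"
    by (subst nn_integral_cmult) auto
  finally show ?thesis .
qed

text \<open>The modulus of the double integrand depends on \<open>w\<close> only through
  \<open>Re w\<close>. Hence the single real moment in \<open>int\<close> gives absolute convergence
  on the product space, and Fubini yields the complex identity.\<close>

lemma integral_exp_kernel:
  fixes h g :: "real \<Rightarrow> real"
  assumes [measurable]: "h \<in> borel_measurable borel" "g \<in> borel_measurable borel"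
    and h: "\<And>v. h v \<ge> 0" and w: "Re w > 0"
    and int: "integrable lborel (\<lambda>v. h v * exp (- Re w * g v))"
  shows "integrable lborel (\<lambda>v. of_real (h v) * exp (- w * of_real (g v)))"
    and "integrable lborel (\<lambda>u. exp (w * of_real u) * of_real (\<integral>v. h v * exp (- exp (u + g v)) \<partial>lborel))"
    and "(\<integral>u. exp (w * of_real u) * of_real (\<integral>v. h v * exp (- exp (u + g v)) \<partial>lborel) \<partial>lborel)
         = Gamma w * (\<integral>v. of_real (h v) * exp (- w * of_real (g v)) \<partial>lborel)"
proof -
  let ?F = "\<lambda>u v. exp (w * of_real u) * of_real (h v * exp (- exp (u + g v)))"
  have nm: "ennreal (norm (?F u v)) = ennreal (exp (Re w * u)) * ennreal (h v * exp (- exp (u + g v)))" for u v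
    using h by (simp add: norm_mult abs_mult ennreal_mult'')
  have "(\<integral>\<^sup>+x. ennreal (norm (case_prod ?F x)) \<partial>(lborel \<Otimes>\<^sub>M lborel)) =
      (\<integral>\<^sup>+u. (\<integral>\<^sup>+v. ennreal (norm (?F u v)) \<partial>lborel) \<partial>lborel)"
    by (subst lborel.nn_integral_fst[symmetric]) (auto simp: case_prod_beta)
  also have "\<dots> = ennreal (Gamma (Re w)) * (\<integral>\<^sup>+v. ennreal (h v * exp (- Re w * g v)) \<partial>lborel)"
    unfolding nm using nn_integral_exp_kernel[of h g "Re w"] h w by (simp add: nn_integral_cmult)
  also have "\<dots> < \<infinity>"
    using int h by (subst nn_integral_eq_integral) (auto simp: ennreal_mult_less_top)
  finally have FI: "integrable (lborel \<Otimes>\<^sub>M lborel) (case_prod ?F)"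
    by (intro integrableI_bounded) (simp_all add: case_prod_beta)
  show "integrable lborel (\<lambda>v. of_real (h v) * exp (- w * of_real (g v)))"
    by (rule Bochner_Integration.integrable_bound[OF int]) (auto simp: norm_mult h)
  show "integrable lborel (\<lambda>u. exp (w * of_real u) * of_real (\<integral>v. h v * exp (- exp (u + g v)) \<partial>lborel))"
    using lborel_pair.integrable_fst[OF FI] by (simp only: integral_mult_right_zero integral_complex_of_real)
  have "(\<integral>u. exp (w * of_real u) * of_real (\<integral>v. h v * exp (- exp (u + g v)) \<partial>lborel) \<partial>lborel)
      = (\<integral>u. (\<integral>v. ?F u v \<partial>lborel) \<partial>lborel)"
    by (simp only: integral_mult_right_zero integral_complex_of_real)
  also have "\<dots> = (\<integral>v. (\<integral>u. ?F u v \<partial>lborel) \<partial>lborel)"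
    by (rule lborel_pair.Fubini_integral[OF FI, symmetric])
  also have "\<dots> = (\<integral>v. of_real (h v) * (Gamma w * exp (- w * of_real (g v))) \<partial>lborel)"
    unfolding Gamma_integral_exp_shift(2)[OF w, symmetric]
    by (subst integral_mult_right_zero[symmetric]) (simp add: mult_ac)
  also have "\<dots> = Gamma w * (\<integral>v. of_real (h v) * exp (- w * of_real (g v)) \<partial>lborel)"
    by (subst integral_mult_right_zero[symmetric]) (simp add: mult_ac)
  finally show "(\<integral>u. exp (w * of_real u) * of_real (\<integral>v. h v * exp (- exp (u + g v)) \<partial>lborel) \<partial>lborel)
         = Gamma w * (\<integral>v. of_real (h v) * exp (- w * of_real (g v)) \<partial>lborel)" .
qed

subsection \<open>Gaussian averages and polar coordinates\<close>

text \<open>Lebesgue measure is the image of a product of one-dimensional Lebesgue measures under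
  the coordinate map (\<open>lborel_eq\<close>), so the statement is Fubini for finite
  products.\<close>

lemma integral_lborel_prod:
  fixes f :: "'a::euclidean_space \<Rightarrow> real \<Rightarrow> 'b::{real_normed_field,banach,second_countable_topology}"
  assumes "\<And>b. b \<in> Basis \<Longrightarrow> integrable lborel (f b)"
  shows "integrable lborel (\<lambda>x::'a. \<Prod>b\<in>Basis. f b (x \<bullet> b))"
    and "(\<integral>(x::'a). (\<Prod>b\<in>Basis. f b (x \<bullet> b)) \<partial>lborel) = (\<Prod>b\<in>Basis. \<integral>y. f b y \<partial>lborel)"
proof -
  interpret product_sigma_finite "\<lambda>_::'a. lborel :: real measure" ..
  have f[measurable]: "f b \<in> borel_measurable borel" if "b \<in> Basis" for b
    using assms[OF that] by simp
  have m: "(\<lambda>x::'a. \<Prod>b\<in>Basis. f b (x \<bullet> b)) \<in> borel_measurable borel"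
    by measurable
  have m': "(\<lambda>g. \<Sum>b\<in>Basis. g b *\<^sub>R b) \<in> (\<Pi>\<^sub>M b\<in>Basis. lborel) \<rightarrow>\<^sub>M (borel :: 'a measure)"
    by measurable
  have [simp]: "(\<Prod>b\<in>Basis. f b ((\<Sum>b\<in>Basis. g b *\<^sub>R b) \<bullet> b)) = (\<Prod>b\<in>(Basis::'a set). f b (g b))" for g
    by (intro prod.cong) auto
  show "integrable lborel (\<lambda>x::'a. \<Prod>b\<in>Basis. f b (x \<bullet> b))"
    using product_integrable_prod[of Basis f] assms
    by (subst lborel_eq, subst integrable_distr_eq[OF m' m]) simp
  show "(\<integral>(x::'a). (\<Prod>b\<in>Basis. f b (x \<bullet> b)) \<partial>lborel) = (\<Prod>b\<in>Basis. \<integral>y. f b y \<partial>lborel)"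
    using product_integral_prod[of Basis f] assms
    by (subst lborel_eq, subst integral_distr[OF m' m]) simp
qed

lemma normal_density_fourier:
  assumes "\<sigma> > 0"
  shows "integrable lborel (\<lambda>y. iexp (t * y) * complex_of_real (normal_density 0 \<sigma> y))"
    and "(\<integral>y. iexp (t * y) * complex_of_real (normal_density 0 \<sigma> y) \<partial>lborel)
          = complex_of_real (exp (- (\<sigma>\<^sup>2 * t\<^sup>2 / 2)))"
proof -
  show "integrable lborel (\<lambda>y. iexp (t * y) * complex_of_real (normal_density 0 \<sigma> y))"
    using assms
    by (intro Bochner_Integration.integrable_bound[OF integrable_normal_density[of \<sigma> 0]])
       (auto simp: norm_mult)
  have dens: "normal_density 0 \<sigma> (\<sigma> * y) = std_normal_density y / \<sigma>" for y
    using assms by (simp add: normal_density_def real_sqrt_mult power_mult_distrib)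
  have "(\<integral>y. iexp (t * y) * complex_of_real (normal_density 0 \<sigma> y) \<partial>lborel)
      = \<sigma> *\<^sub>R (\<integral>y. iexp (t * (\<sigma> * y)) * complex_of_real (normal_density 0 \<sigma> (\<sigma> * y)) \<partial>lborel)"
    using lborel_integral_real_affine[of \<sigma> "\<lambda>y. iexp (t * y) * complex_of_real (normal_density 0 \<sigma> y)" 0]
      assms by simp
  also have "\<dots> = (\<integral>y. std_normal_density y *\<^sub>R iexp ((\<sigma> * t) * y) \<partial>lborel)"
    using assms unfolding dens
    by (subst integral_scaleR_right[symmetric])
      (auto intro!: Bochner_Integration.integral_cong simp: scaleR_conv_of_real mult_ac)
  also have "\<dots> = char std_normal_distribution (\<sigma> * t)"
    unfolding char_def by (subst integral_density) (auto simp: normal_density_nonneg)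
  finally show "(\<integral>y. iexp (t * y) * complex_of_real (normal_density 0 \<sigma> y) \<partial>lborel)
          = complex_of_real (exp (- (\<sigma>\<^sup>2 * t\<^sup>2 / 2)))"
    by (simp add: char_std_normal_distribution power_mult_distrib)
qed

text \<open>The centred normal density with covariance \<sigma>^2 times the identity, written as a
  product over coordinates so that its Fourier transform reduces to dimension one.\<close>

definition gauss :: "real \<Rightarrow> 'a::euclidean_space \<Rightarrow> real" where
  "gauss \<sigma> t = (\<Prod>b\<in>Basis. normal_density 0 \<sigma> (t \<bullet> b))"

lemma gauss_nonneg: "gauss \<sigma> t \<ge> 0"
  by (simp add: gauss_def prod_nonneg normal_density_nonneg)

lemma borel_measurable_gauss [measurable]: "gauss \<sigma> \<in> borel_measurable borel"
  unfolding gauss_def by measurable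

lemma gauss_fourier:
  fixes x :: "'a::euclidean_space"
  assumes "\<sigma> > 0"
  shows "integrable lborel (gauss \<sigma> :: 'a \<Rightarrow> real)"
    and "(\<integral>t. iexp (x \<bullet> t) * complex_of_real (gauss \<sigma> t) \<partial>lborel)
          = complex_of_real (exp (- (\<sigma>\<^sup>2 * (norm x)\<^sup>2 / 2)))"
proof -
  show "integrable lborel (gauss \<sigma> :: 'a \<Rightarrow> real)"
    unfolding gauss_def by (rule integral_lborel_prod) (simp add: assms)
  have "iexp (x \<bullet> t) * complex_of_real (gauss \<sigma> t)
      = (\<Prod>b\<in>Basis. iexp ((x \<bullet> b) * (t \<bullet> b)) * complex_of_real (normal_density 0 \<sigma> (t \<bullet> b)))" for t
  proof -
    have "iexp (x \<bullet> t) = (\<Prod>b\<in>Basis. iexp ((x \<bullet> b) * (t \<bullet> b)))"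
      unfolding euclidean_inner[of x t] by (simp add: exp_sum sum_distrib_left)
    then show ?thesis by (simp add: gauss_def prod.distrib)
  qed
  then have "(\<integral>t. iexp (x \<bullet> t) * complex_of_real (gauss \<sigma> t) \<partial>lborel)
      = (\<integral>t. (\<Prod>b\<in>Basis. iexp ((x \<bullet> b) * (t \<bullet> b)) * complex_of_real (normal_density 0 \<sigma> (t \<bullet> b))) \<partial>lborel)"
    by simp
  also have "\<dots> = (\<Prod>b\<in>Basis. complex_of_real (exp (- (\<sigma>\<^sup>2 * (x \<bullet> b)\<^sup>2 / 2))))"
    by (subst integral_lborel_prod(2)[OF normal_density_fourier(1)[OF assms]])
       (simp only: normal_density_fourier(2)[OF assms])
  also have "\<dots> = complex_of_real (exp (\<Sum>b\<in>Basis. - (\<sigma>\<^sup>2 * (x \<bullet> b)\<^sup>2 / 2)))"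
    by (simp add: exp_sum)
  also have "(\<Sum>b\<in>Basis. - (\<sigma>\<^sup>2 * (x \<bullet> b)\<^sup>2 / 2)) = - (\<sigma>\<^sup>2 * (norm x)\<^sup>2 / 2)"
    unfolding power2_norm_eq_inner euclidean_inner[of x x]
    by (simp add: sum_negf power2_eq_square flip: sum_distrib_left sum_divide_distrib)
  finally show "(\<integral>t. iexp (x \<bullet> t) * complex_of_real (gauss \<sigma> t) \<partial>lborel)
          = complex_of_real (exp (- (\<sigma>\<^sup>2 * (norm x)\<^sup>2 / 2)))" .
qed

text \<open>Choosing the variance as \<open>exp u\<close> makes the Gaussian a Laplace kernel with
  the reciprocal parameter \<open>exp (- u)\<close>: this is where the reflection u to -u between
  the two sides of the Laplace identity comes from.\<close>

lemma gauss_exp: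
  fixes t :: "'a::euclidean_space"
  shows "gauss (exp (u / 2)) t
    = (2 * pi) powr (- (real DIM('a) / 2)) * exp (- (real DIM('a) * u / 2)) * exp (- (exp (- u) * (norm t)\<^sup>2 / 2))"
proof -
  have "normal_density 0 (exp (u / 2)) y
      = ((2 * pi) powr (- (1/2)) * exp (- (u / 2))) * exp (- (exp (- u) * y\<^sup>2 / 2))" for y
  proof -
    have "(exp (u / 2))\<^sup>2 = exp u" by (simp flip: exp_of_nat_mult)
    moreover have "sqrt (2 * pi * exp u) = sqrt (2 * pi) * exp (u / 2)"
      using real_sqrt_unique[of "exp (u / 2)" "exp u"] calculation by (simp add: real_sqrt_mult)
    moreover have "(2 * pi) powr (- (1/2)) = 1 / sqrt (2 * pi)"
      by (subst powr_minus, subst powr_half_sqrt) (simp_all add: inverse_eq_divide)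
    ultimately show ?thesis
      by (simp add: normal_density_def exp_minus inverse_eq_divide)
  qed
  then have "gauss (exp (u / 2)) t = (\<Prod>b\<in>Basis.
      ((2 * pi) powr (- (1/2)) * exp (- (u / 2))) * exp (- (exp (- u) * (t \<bullet> b)\<^sup>2 / 2)))"
    by (simp add: gauss_def)
  also have "\<dots> = ((2 * pi) powr (- (1/2)) * exp (- (u / 2))) ^ DIM('a)
      * exp (\<Sum>b\<in>Basis. - (exp (- u) * (t \<bullet> b)\<^sup>2 / 2))"
    by (simp add: prod.distrib exp_sum)
  also have "(\<Sum>b\<in>Basis. - (exp (- u) * (t \<bullet> b)\<^sup>2 / 2)) = - (exp (- u) * (norm t)\<^sup>2 / 2)"
    unfolding power2_norm_eq_inner euclidean_inner[of t t]
    by (simp add: sum_negf power2_eq_square flip: sum_distrib_left sum_divide_distrib)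
  also have "((2 * pi) powr (- (1/2)) * exp (- (u / 2))) ^ DIM('a)
      = (2 * pi) powr (- (real DIM('a) / 2)) * exp (- (real DIM('a) * u / 2))"
    by (simp add: power_mult_distrib powr_powr flip: powr_realpow exp_of_nat_mult)
  finally show ?thesis .
qed

text \<open>Parseval's pairing: the transform of the Gaussian integrated against \<open>p\<close>
  equals the Gaussian integrated against the transform of \<open>p\<close>. Fubini applies because
  \<open>p\<close> and the Gaussian are both integrable. Nonnegative integrals are used since powers
  of exp u will be integrated against both sides before convergence is known.\<close>

lemma linnik_density_gauss_transform:
  fixes p :: "'a::euclidean_space \<Rightarrow> real"
  assumes p: "linnik_density \<alpha> \<nu> p" and \<nu>: "\<nu> > 0"
  shows "(\<integral>\<^sup>+x. ennreal (p x * exp (- (exp u * (norm x)\<^sup>2 / 2))) \<partial>lborel)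
       = (\<integral>\<^sup>+t. ennreal ((1 + norm t powr \<alpha>) powr (- \<nu>) * gauss (exp (u / 2)) (t :: 'a)) \<partial>lborel)"
proof -
  let ?\<sigma> = "exp (u / 2)" and ?\<phi> = "\<lambda>t::'a. (1 + norm t powr \<alpha>) powr (- \<nu>)"
  have \<sigma>: "?\<sigma> > 0" and \<sigma>2: "?\<sigma>\<^sup>2 = exp u" by (simp_all flip: exp_of_nat_mult)
  from p have pm[measurable]: "p \<in> borel_measurable borel" and p0: "\<And>x. p x \<ge> 0"
    and prob: "prob_space (density lborel (\<lambda>x. ennreal (p x)))"
    and char: "\<And>t. (CLINT x|lborel. iexp (x \<bullet> t) * complex_of_real (p x)) = complex_of_real (?\<phi> t)"
    by (auto simp: linnik_density_def)
  have "(\<integral>\<^sup>+x. ennreal (p x) \<partial>lborel) = 1"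
    using prob_space.emeasure_space_1[OF prob] by (simp add: emeasure_density)
  then have pint: "integrable lborel p"
    by (intro integrableI_nonneg) (auto simp: p0)
  have gint: "integrable lborel (gauss ?\<sigma> :: 'a \<Rightarrow> real)" by (rule gauss_fourier[OF \<sigma>])
  let ?F = "\<lambda>x t. iexp (x \<bullet> t) * complex_of_real (p x) * complex_of_real (gauss ?\<sigma> t)"
  have "integrable (lborel \<Otimes>\<^sub>M lborel) (\<lambda>(x, t). p x * gauss ?\<sigma> (t :: 'a))"
    using lborel_pair.Fubini_integrable[of "\<lambda>(x, t). p x * gauss ?\<sigma> (t :: 'a)"] pint gint
    by (simp add: gauss_nonneg p0 abs_mult case_prod_beta)
  then have FI: "integrable (lborel \<Otimes>\<^sub>M lborel) (case_prod ?F)"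
    by (rule Bochner_Integration.integrable_bound) (auto simp: norm_mult gauss_nonneg p0)
  have "complex_of_real (\<integral>x. p x * exp (- (exp u * (norm x)\<^sup>2 / 2)) \<partial>lborel)
      = (\<integral>x. complex_of_real (p x) * complex_of_real (exp (- (exp u * (norm x)\<^sup>2 / 2))) \<partial>lborel)"
    by (simp only: integral_complex_of_real[symmetric] of_real_mult)
  also have "\<dots> = (\<integral>x. (\<integral>t. ?F x t \<partial>lborel) \<partial>lborel)"
    unfolding \<sigma>2[symmetric] gauss_fourier(2)[OF \<sigma>, symmetric]
    by (subst integral_mult_right_zero[symmetric]) (simp add: mult_ac)
  also have "\<dots> = (\<integral>t. (\<integral>x. ?F x t \<partial>lborel) \<partial>lborel)"
    by (rule lborel_pair.Fubini_integral[OF FI, symmetric])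
  also have "\<dots> = complex_of_real (\<integral>t. ?\<phi> t * gauss ?\<sigma> t \<partial>lborel)"
    by (simp only: integral_mult_left_zero char flip: of_real_mult integral_complex_of_real)
  finally have eq: "(\<integral>x. p x * exp (- (exp u * (norm x)\<^sup>2 / 2)) \<partial>lborel) = (\<integral>t. ?\<phi> t * gauss ?\<sigma> t \<partial>lborel)"
    by (simp only: of_real_eq_iff)
  have 1: "integrable lborel (\<lambda>x. p x * exp (- (exp u * (norm x)\<^sup>2 / 2)))"
    by (rule Bochner_Integration.integrable_bound[OF pint]) (auto simp: abs_mult p0 intro!: mult_left_le)
  have "?\<phi> t \<le> 1" for t
    using powr_mono[of "- \<nu>" 0 "1 + norm t powr \<alpha>"] \<nu> by (simp split: if_splits)
  then have 2: "integrable lborel (\<lambda>t. ?\<phi> t * gauss ?\<sigma> t)"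
    by (intro Bochner_Integration.integrable_bound[OF gint]) (auto simp: abs_mult gauss_nonneg intro!: mult_left_le_one_le)
  show ?thesis
    using 1 2 eq by (simp add: nn_integral_eq_integral p0 gauss_nonneg)
qed

text \<open>In a logarithmic radial variable, polar coordinates amount to identifying the image of
  Lebesgue measure under \<open>- ln (norm x)\<close>, and for that the volumes of balls
  suffice.\<close>

lemma nn_integral_polar:
  fixes f :: "real \<Rightarrow> ennreal"
  assumes [measurable]: "f \<in> borel_measurable borel"
  shows "(\<integral>\<^sup>+(x::'a::euclidean_space). f (norm x) \<partial>lborel)
     = ennreal (real DIM('a) * unit_ball_vol (real DIM('a)))
        * (\<integral>\<^sup>+v. f (exp v) * ennreal (exp (real DIM('a) * v)) \<partial>lborel)"
proof -
  let ?n = "real DIM('a)" and ?V = "unit_ball_vol (real DIM('a))"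
  have n: "?n > 0" by simp
  have V: "?V > 0" by simp
  \<comment> \<open>The minus sign matters: \<open>measure_eqI_lessThan\<close> compares measures
    that are finite on rays to the right, and with it such a ray pulls back to a ball instead of the
    complement of one.\<close>
  have dist: "distr lborel borel (\<lambda>x::'a. - ln (norm x)) = density lborel (\<lambda>v. ennreal (?n * ?V * exp (- ?n * v)))"
    (is "?L = ?R")
  proof (rule measure_eqI_lessThan)
    fix y :: real
    have "emeasure ?L {y<..} = emeasure lborel ((\<lambda>x::'a. - ln (norm x)) -` {y<..})"
      by (simp add: emeasure_distr)
    also have "\<dots> = emeasure lborel (ball (0::'a) (exp (- y)))"
    proof (rule emeasure_eq_AE)
      \<comment> \<open>At the origin the value of \<open>ln\<close> is a mere convention, so the
        two sets agree only up to a null set.\<close>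
      show "AE x in lborel. x \<in> (\<lambda>x::'a. - ln (norm x)) -` {y<..} \<longleftrightarrow> x \<in> ball 0 (exp (- y))"
        using AE_lborel_singleton[of "0::'a"]
      proof eventually_elim
        case (elim x)
        then show ?case using ln_less_cancel_iff[of "norm x" "exp (- y)"] by auto
      qed
      show "(\<lambda>x::'a. - ln (norm x)) -` {y<..} \<in> sets lborel"
        using measurable_sets[of "\<lambda>x::'a. - ln (norm x)" lborel borel "{y<..}"] by simp
    qed auto
    also have "\<dots> = ennreal (?V * exp (- ?n * y))"
      by (subst emeasure_ball) (simp_all flip: exp_of_nat_mult)
    finally have L: "emeasure ?L {y<..} = ennreal (?V * exp (- ?n * y))" .
    have "emeasure ?R {y<..} = (\<integral>\<^sup>+v. ennreal (?n * ?V * exp (- ?n * v)) * indicator {y..} v \<partial>lborel)"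
      using AE_lborel_singleton[of y] 
      by (subst emeasure_density)
         (auto intro!: nn_integral_cong_AE simp: indicator_def elim!: eventually_mono)
    also have "\<dots> = ennreal (0 - (- ?V * exp (- ?n * y)))"
    proof (rule nn_integral_FTC_atLeast)
      show "((\<lambda>v. - ?V * exp (- ?n * v)) \<longlongrightarrow> 0) at_top"
        using n by real_asymp
    qed (use n V in \<open>auto intro!: derivative_eq_intros simp: mult_ac\<close>)
    finally show "emeasure ?L {y<..} = emeasure ?R {y<..}"
      using L by simp
    show "emeasure ?L {y<..} < \<infinity>" using L by simp
  qed auto
  have "(\<integral>\<^sup>+(x::'a). f (norm x) \<partial>lborel) = (\<integral>\<^sup>+(x::'a). f (exp (- (- ln (norm x)))) \<partial>lborel)"
    using AE_lborel_singleton[of "0::'a"] by (intro nn_integral_cong_AE) (auto elim!: eventually_mono)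
  also have "\<dots> = (\<integral>\<^sup>+v. f (exp (- v)) \<partial>?L)"
    by (subst nn_integral_distr) auto
  also have "\<dots> = (\<integral>\<^sup>+v. ennreal (?n * ?V * exp (- ?n * v)) * f (exp (- v)) \<partial>lborel)"
    unfolding dist by (subst nn_integral_density) auto
  also have "\<dots> = (\<integral>\<^sup>+v. ennreal (?n * ?V) * (f (exp v) * ennreal (exp (?n * v))) \<partial>lborel)"
    using nn_integral_real_affine[of "\<lambda>v. ennreal (?n * ?V * exp (- ?n * v)) * f (exp (- v))" "-1" 0]
    by (simp add: ennreal_mult' V less_imp_le mult_ac)
  also have "\<dots> = ennreal (?n * ?V) * (\<integral>\<^sup>+v. f (exp v) * ennreal (exp (?n * v)) \<partial>lborel)"
    by (subst nn_integral_cmult) auto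
  finally show ?thesis .
qed

subsection \<open>The Mellin transform of the radial density\<close>

lemma integrable_cmult_iff:
  fixes f :: "'a \<Rightarrow> 'b::{real_normed_field,banach,second_countable_topology}"
  assumes "c \<noteq> 0"
  shows "integrable M (\<lambda>x. c * f x) \<longleftrightarrow> integrable M f"
proof
  assume "integrable M (\<lambda>x. c * f x)"
  then have "integrable M (\<lambda>x. inverse c * (c * f x))" by (rule integrable_mult_right)
  then show "integrable M f" using assms by (simp flip: mult.assoc)
qed auto

text \<open>Euler's Beta integral in a logarithmic variable. Up to the factor
  \<open>Gamma \<nu>\<close>, the power of \<open>1 + exp v\<close> is itself a Gamma integral,
  which makes the claim an instance of \<open>integral_exp_kernel\<close> with \<open>?h\<close> and
  the identity; the remaining moment is \<open>Gamma (\<nu> - z)\<close>, whence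
  \<open>Re z < \<nu>\<close>.\<close>

lemma Beta_integral_exp:
  assumes z: "Re z > 0" "Re z < \<nu>"
  shows "integrable lborel (\<lambda>v. exp (z * of_real v) * complex_of_real ((1 + exp v) powr (- \<nu>)))"
    and "(\<integral>v. exp (z * of_real v) * complex_of_real ((1 + exp v) powr (- \<nu>)) \<partial>lborel)
          = Gamma z * Gamma (of_real \<nu> - z) / of_real (Gamma \<nu>)"
proof -
  have \<nu>: "\<nu> > 0" using z by simp
  let ?h = "\<lambda>u. exp (\<nu> * u) * exp (- exp u)"
  have inner: "(\<integral>u. ?h u * exp (- exp (v + u)) \<partial>lborel) = Gamma \<nu> * (1 + exp v) powr (- \<nu>)" for v
  proof -
    \<comment> \<open>The exponents exp u and exp (v + u) merge into exp u (1 + exp v), a shift of u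
      by \<open>ln (1 + exp v)\<close>.\<close>
    have *: "?h u * exp (- exp (v + u)) = exp (\<nu> * u) * exp (- exp (u + ln (1 + exp v)))" for u
    proof -
      have "exp (u + ln (1 + exp v)) = exp u + exp (v + u)"
        by (simp add: exp_add add_pos_pos algebra_simps)
      then show ?thesis by (simp add: mult.assoc flip: exp_add)
    qed
    have "integral\<^sup>L lborel (\<lambda>u. exp (\<nu> * u) * exp (- exp (u + ln (1 + exp v)))) =
        enn2real (\<integral>\<^sup>+u. ennreal (exp (\<nu> * u) * exp (- exp (u + ln (1 + exp v)))) \<partial>lborel)"
      by (rule integral_eq_nn_integral) auto
    also have "\<dots> = Gamma \<nu> * (1 + exp v) powr (- \<nu>)"
      using \<nu> by (subst nn_integral_Gamma_exp_shift) (auto simp: powr_def add_pos_pos less_imp_le[OF Gamma_real_pos] add_nonneg_eq_0_iff)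
    finally show ?thesis unfolding * .
  qed
  have h_exp: "complex_of_real (?h u) * exp (- z * of_real u)
      = exp ((of_real \<nu> - z) * of_real u) * of_real (exp (- exp u))" for u
    by (simp add: algebra_simps exp_diff exp_minus exp_of_real[symmetric] divide_inverse)
  have int: "integrable lborel (\<lambda>u. ?h u * exp (- Re z * u))"
  proof -
    have "complex_of_real (?h u * exp (- Re z * u))
      = exp ((of_real \<nu> - of_real (Re z)) * of_real u) * of_real (exp (- exp u))" for u
      by (simp add: algebra_simps exp_diff exp_minus exp_of_real[symmetric] divide_inverse)
    moreover have "integrable lborel (\<lambda>u. exp ((of_real \<nu> - of_real (Re z)) * of_real u) * complex_of_real (exp (- exp u)))"
      by (rule Gamma_integral_exp(1)) (use z in simp)
    ultimately have "integrable lborel (\<lambda>u. complex_of_real (?h u * exp (- Re z * u)))"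
      by (simp only:)
    then show ?thesis by (simp only: complex_of_real_integrable_eq)
  qed
  have h: "?h \<in> borel_measurable borel" "(\<lambda>u::real. u) \<in> borel_measurable borel" "\<And>v. ?h v \<ge> 0"
    by auto
  note K = integral_exp_kernel[of ?h "\<lambda>u. u" z, OF h z(1) int, unfolded inner]
  have G: "complex_of_real (Gamma \<nu>) \<noteq> 0" using Gamma_real_pos[OF \<nu>] by simp
  have eq: "exp (z * of_real v) * complex_of_real (Gamma \<nu> * (1 + exp v) powr (- \<nu>))
      = of_real (Gamma \<nu>) * (exp (z * of_real v) * complex_of_real ((1 + exp v) powr (- \<nu>)))" for v
    by simp
  show "integrable lborel (\<lambda>v. exp (z * of_real v) * complex_of_real ((1 + exp v) powr (- \<nu>)))"
    using K(2) unfolding eq by (simp only: integrable_cmult_iff[OF G])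
  have "of_real (Gamma \<nu>) * (\<integral>v. exp (z * of_real v) * complex_of_real ((1 + exp v) powr (- \<nu>)) \<partial>lborel)
      = Gamma z * (\<integral>u. exp ((of_real \<nu> - z) * of_real u) * of_real (exp (- exp u)) \<partial>lborel)"
    using K(3) unfolding eq h_exp by (simp only: integral_mult_right_zero)
  also have "(\<integral>u. exp ((of_real \<nu> - z) * of_real u) * of_real (exp (- exp u)) \<partial>lborel) = Gamma (of_real \<nu> - z)"
    by (rule Gamma_integral_exp(2)) (use z in simp)
  finally show "(\<integral>v. exp (z * of_real v) * complex_of_real ((1 + exp v) powr (- \<nu>)) \<partial>lborel)
          = Gamma z * Gamma (of_real \<nu> - z) / of_real (Gamma \<nu>)"
    using G by (simp add: nonzero_eq_divide_eq mult.commute[of _ "of_real (Gamma \<nu>)"])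
qed

lemma Beta_integral_exp_scaled:
  assumes \<alpha>: "\<alpha> > 0" and z: "Re z > 0" "Re z < \<nu>"
  shows "integrable lborel (\<lambda>v. exp (of_real \<alpha> * z * of_real v) * complex_of_real ((1 + exp (\<alpha> * v)) powr (- \<nu>)))"
    and "(\<integral>v. exp (of_real \<alpha> * z * of_real v) * complex_of_real ((1 + exp (\<alpha> * v)) powr (- \<nu>)) \<partial>lborel)
          = Gamma z * Gamma (of_real \<nu> - z) / (of_real \<alpha> * of_real (Gamma \<nu>))"
proof -
  let ?f = "\<lambda>v. exp (z * of_real v) * complex_of_real ((1 + exp v) powr (- \<nu>))"
  have eq: "exp (of_real \<alpha> * z * of_real v) * complex_of_real ((1 + exp (\<alpha> * v)) powr (- \<nu>)) = ?f (0 + \<alpha> * v)" for v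
    by (simp add: mult_ac)
  show "integrable lborel (\<lambda>v. exp (of_real \<alpha> * z * of_real v) * complex_of_real ((1 + exp (\<alpha> * v)) powr (- \<nu>)))"
    unfolding eq using \<alpha> by (intro lborel_integrable_real_affine Beta_integral_exp z) auto
  show "(\<integral>v. exp (of_real \<alpha> * z * of_real v) * complex_of_real ((1 + exp (\<alpha> * v)) powr (- \<nu>)) \<partial>lborel)
          = Gamma z * Gamma (of_real \<nu> - z) / (of_real \<alpha> * of_real (Gamma \<nu>))"
  proof -
    have gen: "I = X / (c * G)" if "X / G = c * I" "c \<noteq> 0" for I X G c :: complex
      using that by (metis divide_divide_eq_left mult.commute nonzero_mult_div_cancel_left)
    show ?thesis unfolding eq
      using lborel_integral_real_affine[of \<alpha> ?f 0] Beta_integral_exp(2)[OF z] \<alpha>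
      by (intro gen) (auto simp: scaleR_conv_of_real)
  qed
qed

text \<open>Both sides are Laplace transforms at \<open>s = exp u / 2\<close>; in the logarithmic variables \<open>u\<close> and
  \<open>v = ln r\<close> all later changes of variables become affine.\<close>

lemma linnik_radial_laplace:
  fixes p :: "'a::euclidean_space \<Rightarrow> real"
  assumes p: "linnik_density \<alpha> \<nu> p" and \<nu>: "\<nu> > 0"
    and q: "\<And>x. x \<noteq> 0 \<Longrightarrow> q (norm x) = p x"
  defines "n \<equiv> real DIM('a)"
  shows "(\<integral>\<^sup>+v. ennreal (q (exp v) * exp (n * v) * exp (- exp (u + (2 * v - ln 2)))) \<partial>lborel)
       = ennreal ((2 * pi) powr (- (n / 2)) * exp (- (n * u / 2)))
         * (\<integral>\<^sup>+v. ennreal (exp (n * v) * (1 + exp (\<alpha> * v)) powr (- \<nu>) * exp (- exp (- u + (2 * v - ln 2)))) \<partial>lborel)"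
proof -
  obtain e :: 'a where e: "norm e = 1" using norm_Basis SOME_Basis by blast
  then have e0: "e \<noteq> 0" by auto
  from p have pm[measurable]: "p \<in> borel_measurable borel" and p0: "\<And>x. p x \<ge> 0"
    by (auto simp: linnik_density_def)
  have qe: "q r = p (r *\<^sub>R e)" if "r > 0" for r
    using q[of "r *\<^sub>R e"] e e0 that by auto
  \<comment> \<open>The area of the unit sphere. It arises from polar coordinates on both sides and
    can be cancelled, being neither zero nor infinite.\<close>
  let ?A = "ennreal (real DIM('a) * unit_ball_vol (real DIM('a)))"
  have A: "?A \<noteq> 0" "?A \<noteq> \<top>"
    using unit_ball_vol_pos[of "real DIM('a)"] by (auto simp: ennreal_eq_0_iff mult_le_0_iff not_le)
  have ex: "exp (u + (2 * v - ln 2)) = exp u * (exp v)\<^sup>2 / 2" for u v :: real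
    by (simp add: exp_add exp_diff flip: exp_of_nat_mult)
  have "?A * (\<integral>\<^sup>+v. ennreal (q (exp v) * exp (n * v) * exp (- exp (u + (2 * v - ln 2)))) \<partial>lborel)
      = ?A * (\<integral>\<^sup>+v. ennreal (p (exp v *\<^sub>R e) * exp (- (exp u * (exp v)\<^sup>2 / 2))) * ennreal (exp (n * v)) \<partial>lborel)"
    unfolding ex by (simp add: qe ennreal_mult'[symmetric] p0 mult_ac)
  also have "\<dots> = (\<integral>\<^sup>+(x::'a). ennreal (p (norm x *\<^sub>R e) * exp (- (exp u * (norm x)\<^sup>2 / 2))) \<partial>lborel)"
    unfolding n_def by (subst nn_integral_polar) auto
  also have "\<dots> = (\<integral>\<^sup>+x. ennreal (p x * exp (- (exp u * (norm x)\<^sup>2 / 2))) \<partial>lborel)"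
    using AE_lborel_singleton[of "0::'a"]
    by (intro nn_integral_cong_AE) (auto elim!: eventually_mono simp: q simp flip: qe)
  also have "\<dots> = (\<integral>\<^sup>+(t::'a). ennreal ((1 + norm t powr \<alpha>) powr (- \<nu>) * gauss (exp (u / 2)) t) \<partial>lborel)"
    by (rule linnik_density_gauss_transform[OF p \<nu>])
  also have "\<dots> = (\<integral>\<^sup>+(t::'a). ennreal ((1 + norm t powr \<alpha>) powr (- \<nu>) * ((2 * pi) powr (- (n / 2)) * exp (- (n * u / 2)) * exp (- (exp (- u) * (norm t)\<^sup>2 / 2)))) \<partial>lborel)"
    unfolding n_def by (simp add: gauss_exp)
  also have "\<dots> = ?A * (\<integral>\<^sup>+v. ennreal ((1 + exp v powr \<alpha>) powr (- \<nu>) * ((2 * pi) powr (- (n / 2)) * exp (- (n * u / 2)) * exp (- (exp (- u) * (exp v)\<^sup>2 / 2)))) * ennreal (exp (n * v)) \<partial>lborel)"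
    unfolding n_def by (subst nn_integral_polar) auto
  also have "\<dots> = ?A * (\<integral>\<^sup>+v. ennreal ((2 * pi) powr (- (n / 2)) * exp (- (n * u / 2)))
         * ennreal (exp (n * v) * (1 + exp (\<alpha> * v)) powr (- \<nu>) * exp (- exp (- u + (2 * v - ln 2)))) \<partial>lborel)"
    unfolding ex by (simp add: exp_powr_real ennreal_mult'[symmetric] mult_ac)
  also have "\<dots> = ?A * (ennreal ((2 * pi) powr (- (n / 2)) * exp (- (n * u / 2)))
         * (\<integral>\<^sup>+v. ennreal (exp (n * v) * (1 + exp (\<alpha> * v)) powr (- \<nu>) * exp (- exp (- u + (2 * v - ln 2)))) \<partial>lborel))"
    by (subst nn_integral_cmult) auto
  finally show ?thesis
    using A by (simp only: ennreal_mult_cancel_left) simp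
qed

text \<open>The Laplace identity is multiplied by \<open>exp (w * u)\<close> with w = \<alpha> z / 2
  and integrated over u. On the left \<open>integral_exp_kernel\<close> produces
  \<open>Gamma w\<close> times the Mellin transform of \<open>q\<close>; on the right, after
  reflecting u, it produces \<open>Gamma (n / 2 - w)\<close> times a Beta integral. The three
  conditions in \<open>z\<close> are the convergence conditions of these integrals.\<close>

lemma linnik_mellin:
  fixes p :: "'a::euclidean_space \<Rightarrow> real"
  assumes p: "linnik_density \<alpha> \<nu> p" and \<alpha>: "\<alpha> > 0" and \<nu>: "\<nu> > 0"
    and q: "\<And>x. x \<noteq> 0 \<Longrightarrow> q (norm x) = p x"
  defines "n \<equiv> real DIM('a)"
  assumes z: "Re z > 0" "Re z < \<nu>" "\<alpha> * Re z < n"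
  shows "integrable lborel (\<lambda>v. of_real (q (exp v)) * exp ((of_real n - of_real \<alpha> * z) * of_real v))"
    and "(\<integral>v. of_real (q (exp v)) * exp ((of_real n - of_real \<alpha> * z) * of_real v) \<partial>lborel)
      = of_real (pi powr (- (n / 2)) / (\<alpha> * Gamma \<nu>)) * exp (- (of_real \<alpha> * z * of_real (ln 2)))
        * (Gamma z * Gamma (of_real \<nu> - z) * Gamma ((of_real n - of_real \<alpha> * z) / 2) / Gamma (of_real \<alpha> * z / 2))"
proof -
  obtain e :: 'a where e: "norm e = 1" using norm_Basis SOME_Basis by blast
  then have e0: "e \<noteq> 0" by auto
  from p have pm[measurable]: "p \<in> borel_measurable borel" and p0: "\<And>x. p x \<ge> 0"
    by (auto simp: linnik_density_def)
  have qe: "q (exp v) = p (exp v *\<^sub>R e)" for v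
    using q[of "exp v *\<^sub>R e"] e e0 by auto
  define w where "w = of_real \<alpha> * z / 2"
  define a where "a = Re w"
  have aw: "a = \<alpha> * Re z / 2" and a: "a > 0" "n / 2 - a > 0"
    using z \<alpha> by (simp_all add: a_def w_def)
  define H where "H v = q (exp v) * exp (n * v)" for v
  define B where "B v = exp (n * v) * (1 + exp (\<alpha> * v)) powr (- \<nu>)" for v
  \<comment> \<open>The summand \<open>- ln 2\<close> carries the factor 1/2 of the Gaussian
    exponent: exp (u + g v) is exp u (exp v)^2 / 2.\<close>
  define g where "g v = 2 * v - ln 2" for v :: real
  define C where "C = (2 * pi) powr (- (n / 2))"
  have C: "C > 0" by (simp add: C_def)
  have [measurable]: "H \<in> borel_measurable borel" "B \<in> borel_measurable borel" "g \<in> borel_measurable borel"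
    unfolding H_def[abs_def] B_def[abs_def] g_def[abs_def] qe by measurable
  have H0: "H v \<ge> 0" and B0: "B v \<ge> 0" for v
    by (simp_all add: H_def B_def qe p0)
  have star: "(\<integral>\<^sup>+v. ennreal (H v * exp (- exp (u + g v))) \<partial>lborel)
      = ennreal (C * exp (- (n * u / 2))) * (\<integral>\<^sup>+v. ennreal (B v * exp (- exp (- u + g v))) \<partial>lborel)" for u
    using linnik_radial_laplace[OF p \<nu> q, of u] by (simp add: H_def B_def g_def C_def n_def)

  have Bexp: "complex_of_real (B v) * exp (- (of_real (n/2) - s) * of_real (g v))
      = exp ((of_real (n/2) - s) * of_real (ln 2)) * (exp (2 * s * of_real v) * complex_of_real ((1 + exp (\<alpha> * v)) powr (- \<nu>)))" for s v
  proof -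
    have "complex_of_real (exp (n * v)) * exp (- (of_real (n/2) - s) * of_real (g v))
      = exp ((of_real (n/2) - s) * of_real (ln 2)) * exp (2 * s * of_real v)"
      unfolding g_def by (simp add: exp_of_real[symmetric] field_simps flip: exp_add)
    then show ?thesis by (simp add: B_def mult_ac)
  qed
  have Bint: "integrable lborel (\<lambda>v. B v * exp (- (n/2 - a) * g v))"
  proof -
    have "complex_of_real (B v * exp (- (n/2 - a) * g v)) =
      complex_of_real (B v) * exp (- (of_real (n/2) - of_real a) * of_real (g v))" for v
      by (simp flip: exp_of_real)
    then have "integrable lborel (\<lambda>v. complex_of_real (B v * exp (- (n/2 - a) * g v)))"
      unfolding Bexp using Beta_integral_exp_scaled(1)[OF \<alpha>, of "of_real (Re z)" \<nu>] z(1,2)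
      by (simp add: aw)
    then show ?thesis by (simp only: complex_of_real_integrable_eq)
  qed
  \<comment> \<open>Convergence on the side of \<open>q\<close> is not known beforehand. Running the
    whole computation with nonnegative integrals bounds it by the finite moment of
    \<open>B\<close>.\<close>
  have Hint: "integrable lborel (\<lambda>v. H v * exp (- a * g v))"
  proof (rule integrableI_nonneg)
    have "ennreal (Gamma a) * (\<integral>\<^sup>+v. ennreal (H v * exp (- a * g v)) \<partial>lborel)
        = (\<integral>\<^sup>+u. ennreal (exp (a * u)) * (\<integral>\<^sup>+v. ennreal (H v * exp (- exp (u + g v))) \<partial>lborel) \<partial>lborel)"
      by (rule nn_integral_exp_kernel[symmetric]) (auto simp: H0 a)
    also have "\<dots> = (\<integral>\<^sup>+u. ennreal C * (ennreal (exp (- (n/2 - a) * u))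
        * (\<integral>\<^sup>+v. ennreal (B v * exp (- exp (- u + g v))) \<partial>lborel)) \<partial>lborel)"
    proof (intro nn_integral_cong)
      fix u :: real
      have "ennreal (exp (a * u)) * ennreal (C * exp (- (n * u / 2))) = ennreal C * ennreal (exp (- (n/2 - a) * u))"
        using C by (simp add: algebra_simps flip: ennreal_mult exp_add)
      then show "ennreal (exp (a * u)) * (\<integral>\<^sup>+v. ennreal (H v * exp (- exp (u + g v))) \<partial>lborel)
        = ennreal C * (ennreal (exp (- (n/2 - a) * u))
        * (\<integral>\<^sup>+v. ennreal (B v * exp (- exp (- u + g v))) \<partial>lborel))"
        unfolding star by (simp only: mult.assoc[symmetric])
    qed
    also have "\<dots> = ennreal C * (\<integral>\<^sup>+u. ennreal (exp (- (n/2 - a) * u))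
        * (\<integral>\<^sup>+v. ennreal (B v * exp (- exp (- u + g v))) \<partial>lborel) \<partial>lborel)"
      by (rule nn_integral_cmult) measurable
    also have "\<dots> = ennreal C * (\<integral>\<^sup>+u. ennreal (exp ((n/2 - a) * u))
        * (\<integral>\<^sup>+v. ennreal (B v * exp (- exp (u + g v))) \<partial>lborel) \<partial>lborel)"
      using nn_integral_real_affine[of "\<lambda>u. ennreal (exp (- (n/2 - a) * u))
        * (\<integral>\<^sup>+v. ennreal (B v * exp (- exp (- u + g v))) \<partial>lborel)" "-1" 0]
      by (simp add: left_diff_distrib)
    also have "\<dots> = ennreal C * (ennreal (Gamma (n/2 - a)) * (\<integral>\<^sup>+v. ennreal (B v * exp (- (n/2 - a) * g v)) \<partial>lborel))"
      using a by (subst nn_integral_exp_kernel) (auto simp: B0)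
    also have "\<dots> < \<infinity>"
      using Bint B0 by (subst nn_integral_eq_integral) (auto simp: ennreal_mult_less_top)
    finally show "(\<integral>\<^sup>+v. ennreal (H v * exp (- a * g v)) \<partial>lborel) < \<infinity>"
      using Gamma_real_pos[OF a(1)] by (auto simp: ennreal_mult_less_top)
  qed (auto simp: H0)
  \<comment> \<open>\<open>enn2real\<close> sends infinity to 0, which is also the Bochner integral
    of a nonnegative measurable function that is not integrable; so the identity descends from
    \<open>star\<close> directly.\<close>
  have star': "(\<integral>v. H v * exp (- exp (u + g v)) \<partial>lborel)
      = C * exp (- (n * u / 2)) * (\<integral>v. B v * exp (- exp (- u + g v)) \<partial>lborel)" for u
    using star[of u] C H0 B0 by (simp add: integral_eq_nn_integral enn2real_mult)
  have wa: "Re w > 0" "Re (of_real (n/2) - w) > 0" using a by (simp_all add: a_def)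
  have Hm: "H \<in> borel_measurable borel" and Bm: "B \<in> borel_measurable borel" and gm: "g \<in> borel_measurable borel"
    by measurable
  note KH = integral_exp_kernel[of H g w, OF Hm gm H0 wa(1), folded a_def, OF Hint]
  have Bint': "integrable lborel (\<lambda>v. B v * exp (- Re (of_real (n/2) - w) * g v))"
    using Bint by (simp add: a_def)
  note KB = integral_exp_kernel[of B g "of_real (n/2) - w", OF Bm gm B0 wa(2) Bint']
  have Hexp: "complex_of_real (H v) * exp (- w * of_real (g v))
      = exp (w * of_real (ln 2)) * (of_real (q (exp v)) * exp ((of_real n - of_real \<alpha> * z) * of_real v))" for v
    unfolding H_def g_def w_def
    by (simp add: exp_of_real[symmetric] field_simps flip: exp_add)
  show "integrable lborel (\<lambda>v. of_real (q (exp v)) * exp ((of_real n - of_real \<alpha> * z) * of_real v))"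
    using KH(1) unfolding Hexp by (simp only: integrable_cmult_iff[OF exp_not_eq_zero])
  let ?M = "\<integral>v. of_real (q (exp v)) * exp ((of_real n - of_real \<alpha> * z) * of_real v) \<partial>lborel"
  have "Gamma w * (exp (w * of_real (ln 2)) * ?M) = Gamma w * (\<integral>v. complex_of_real (H v) * exp (- w * of_real (g v)) \<partial>lborel)"
    by (simp only: Hexp integral_mult_right_zero)
  also have "\<dots> = (\<integral>u. exp (w * of_real u) * of_real (\<integral>v. H v * exp (- exp (u + g v)) \<partial>lborel) \<partial>lborel)"
    by (rule KH(3)[symmetric])
  also have "\<dots> = (\<integral>u. of_real C * (exp (- (of_real (n/2) - w) * of_real u) * of_real (\<integral>v. B v * exp (- exp (- u + g v)) \<partial>lborel)) \<partial>lborel)"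
  proof (rule Bochner_Integration.integral_cong)
    fix u :: real
    have "exp (w * of_real u) * of_real (C * exp (- (n * u / 2))) = of_real C * exp (- (of_real (n/2) - w) * of_real u)"
      by (simp add: algebra_simps exp_of_real[symmetric] flip: exp_add)
    then show "exp (w * of_real u) * of_real (\<integral>v. H v * exp (- exp (u + g v)) \<partial>lborel)
      = of_real C * (exp (- (of_real (n/2) - w) * of_real u) * of_real (\<integral>v. B v * exp (- exp (- u + g v)) \<partial>lborel))"
      unfolding star' of_real_mult[of _ "integral\<^sup>L _ _"] by (simp only: mult.assoc[symmetric])
  qed simp
  also have "\<dots> = of_real C * (\<integral>u. exp (- (of_real (n/2) - w) * of_real u) * of_real (\<integral>v. B v * exp (- exp (- u + g v)) \<partial>lborel) \<partial>lborel)"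
    by (rule integral_mult_right_zero)
  \<comment> \<open>Reflection of u brings the reciprocal Laplace parameter into the form that
    \<open>KB\<close> expects.\<close>
  also have "\<dots> = of_real C * (\<integral>u. exp ((of_real (n/2) - w) * of_real u) * of_real (\<integral>v. B v * exp (- exp (u + g v)) \<partial>lborel) \<partial>lborel)"
    using lborel_integral_real_affine[of "-1" "\<lambda>u. exp (- (of_real (n/2) - w) * of_real u) * of_real (\<integral>v. B v * exp (- exp (- u + g v)) \<partial>lborel)" 0]
    by (simp add: left_diff_distrib)
  also have "\<dots> = of_real C * (Gamma (of_real (n/2) - w) * (\<integral>v. complex_of_real (B v) * exp (- (of_real (n/2) - w) * of_real (g v)) \<partial>lborel))"
    by (simp only: KB(3))
  also have "\<dots> = of_real C * (Gamma (of_real (n/2) - w) * (exp ((of_real (n/2) - w) * of_real (ln 2)) *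
      (\<integral>v. exp (2 * w * of_real v) * complex_of_real ((1 + exp (\<alpha> * v)) powr (- \<nu>)) \<partial>lborel)))"
    by (simp only: Bexp integral_mult_right_zero)
  also have "2 * w = of_real \<alpha> * z" by (simp add: w_def)
  also have "(\<integral>v. exp (of_real \<alpha> * z * of_real v) * complex_of_real ((1 + exp (\<alpha> * v)) powr (- \<nu>)) \<partial>lborel)
      = Gamma z * Gamma (of_real \<nu> - z) / (of_real \<alpha> * of_real (Gamma \<nu>))"
    by (rule Beta_integral_exp_scaled) (use \<alpha> z in auto)
  finally have main: "Gamma w * (exp (w * of_real (ln 2)) * ?M) = of_real C * (Gamma (of_real (n/2) - w) *
      (exp ((of_real (n/2) - w) * of_real (ln 2)) * (Gamma z * Gamma (of_real \<nu> - z) / (of_real \<alpha> * of_real (Gamma \<nu>)))))" .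
  have "w \<notin> \<int>\<^sub>\<le>\<^sub>0" using wa(1) by (auto elim!: nonpos_Ints_cases)
  then have Gw: "Gamma w \<noteq> 0" by (simp add: Gamma_eq_zero_iff)
  have "C * exp (n / 2 * ln 2) = pi powr (- (n / 2))"
    unfolding C_def by (subst powr_mult) (auto simp: powr_def exp_minus)
  then have CC: "of_real C * exp (of_real (n/2) * of_real (ln 2)) = complex_of_real (pi powr (- (n / 2)))"
    by (metis exp_of_real of_real_mult)
  have Gn: "of_real (n/2) - w = (of_real n - of_real \<alpha> * z) / 2" by (simp add: w_def diff_divide_distrib)
  have "?M = of_real C * exp ((of_real (n/2) - w) * of_real (ln 2)) / exp (w * of_real (ln 2))
     * (Gamma (of_real (n/2) - w) * (Gamma z * Gamma (of_real \<nu> - z) / (of_real \<alpha> * of_real (Gamma \<nu>))) / Gamma w)"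
  proof -
    have gen: "M = c * E / X * (G * Y / W)" if "W * (X * M) = c * (G * (E * Y))" "W \<noteq> 0" "X \<noteq> 0"
      for M c E X G Y W :: complex
    proof -
      have "M = W * (X * M) / (W * X)" using that(2,3) by simp
      then show ?thesis unfolding that(1) by (simp add: mult_ac)
    qed
    show ?thesis by (rule gen[OF main Gw exp_not_eq_zero])
  qed
  \<comment> \<open>The powers of 2 combine to 2^(n/2 - 2 w); the part 2^(n/2) cancels against the
    one in \<open>C\<close>, and 2^(-\<alpha> z) remains.\<close>
  also have "of_real C * exp ((of_real (n/2) - w) * of_real (ln 2)) / exp (w * of_real (ln 2))
      = complex_of_real (pi powr (- (n / 2))) * exp (- (of_real \<alpha> * z * of_real (ln 2)))"
  proof -
    have "(of_real (n/2) - w) * of_real (ln 2) - w * of_real (ln 2)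
        = of_real (n/2) * complex_of_real (ln 2) + - (of_real \<alpha> * z * of_real (ln 2))"
      by (simp add: w_def field_simps)
    then have "exp ((of_real (n/2) - w) * of_real (ln 2)) / exp (w * of_real (ln 2))
        = exp (of_real (n/2) * complex_of_real (ln 2)) * exp (- (of_real \<alpha> * z * of_real (ln 2)))"
      by (simp only: exp_diff[symmetric] exp_add)
    then show ?thesis
      unfolding CC[symmetric] by (simp only: mult.assoc times_divide_eq_right[symmetric])
  qed
  finally show "?M = of_real (pi powr (- (n / 2)) / (\<alpha> * Gamma \<nu>)) * exp (- (of_real \<alpha> * z * of_real (ln 2)))
        * (Gamma z * Gamma (of_real \<nu> - z) * Gamma ((of_real n - of_real \<alpha> * z) / 2) / Gamma (of_real \<alpha> * z / 2))"
    unfolding Gn by (simp add: w_def)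
qed

subsection \<open>Fourier inversion for densities\<close>

text \<open>Up to the factor -1 / (i t) this is the difference quotient of x to exp (- i t x) at
  \<open>a\<close> with step 1 / (k + 1). It is the pointwise limit needed when the interval in
  Levy's formula shrinks to a point.\<close>

lemma Levy_kernel_difference_quotient:
  fixes a t :: real
  assumes "t \<noteq> 0"
  shows "(\<lambda>k. (iexp (- (t * a)) - iexp (- (t * (a + 1 / real (Suc k))))) / (\<i> * t) * of_nat (Suc k)) \<longlonglongrightarrow> iexp (- (t * a))"
proof -
  have d: "((\<lambda>x::complex. exp (- (\<i> * t * x))) has_field_derivative (- (\<i> * t)) * exp (- (\<i> * t * of_real a))) (at (of_real a))"
    by (auto intro!: derivative_eq_intros)
  have "((\<lambda>h. (exp (- (\<i> * t * (of_real a + h))) - exp (- (\<i> * t * of_real a))) / h)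
      \<longlongrightarrow> (- (\<i> * t)) * exp (- (\<i> * t * of_real a))) (at 0)"
    using d by (simp add: DERIV_def)
  moreover have "filterlim (\<lambda>k. complex_of_real (1 / real (Suc k))) (at 0) sequentially"
    unfolding filterlim_at
  proof
    have "(\<lambda>k. 1 / real (Suc k)) \<longlonglongrightarrow> 0"
      using LIMSEQ_inverse_real_of_nat by (simp add: inverse_eq_divide)
    from tendsto_of_real[OF this, where 'a=complex] show "(\<lambda>k. complex_of_real (1 / real (Suc k))) \<longlonglongrightarrow> 0" by simp
  qed (simp del: of_nat_Suc)
  ultimately have "(\<lambda>k. (exp (- (\<i> * t * (of_real a + of_real (1 / real (Suc k))))) - exp (- (\<i> * t * of_real a))) / of_real (1 / real (Suc k)))
     \<longlonglongrightarrow> (- (\<i> * t)) * exp (- (\<i> * t * of_real a))"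
    by (rule filterlim_compose)
  from tendsto_mult_left[OF this, of "- 1 / (\<i> * t)"]
  show ?thesis
  proof (rule Lim_transform_eventually[OF _ always_eventually, THEN tendsto_eq_rhs], intro allI)
    fix k
    have "(X - Y) / c * s = - 1 / c * ((Y - X) / (1 / s))" for X Y c s :: complex
      by (simp add: diff_divide_distrib ring_distribs)
    moreover have "complex_of_real (1 / real (Suc k)) = 1 / of_nat (Suc k)" by (simp del: of_nat_Suc)
    moreover have "iexp (- (t * a)) = exp (- (\<i> * t * of_real a))"
      "iexp (- (t * (a + 1 / real (Suc k)))) = exp (- (\<i> * t * (of_real a + of_real (1 / real (Suc k)))))"
      by (simp_all add: mult.assoc del: of_nat_Suc)
    ultimately show "- 1 / (\<i> * t) * ((exp (- (\<i> * t * (of_real a + of_real (1 / real (Suc k))))) - exp (- (\<i> * t * of_real a))) / of_real (1 / real (Suc k)))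
      = (iexp (- (t * a)) - iexp (- (t * (a + 1 / real (Suc k))))) / (\<i> * t) * of_nat (Suc k)"
      by (simp only:)
  qed (use assms in \<open>simp_all add: mult_ac\<close>)
qed

text \<open>Levy's formula, applied to the normalised density, gives the mass of intervals as a
  truncated integral. Integrability of \<open>\<phi>\<close> removes the truncation. Dividing by the
  length of the interval and letting it shrink recovers \<open>m a\<close> by continuity. Both
  limits are dominated by a multiple of \<open>norm (\<phi> t)\<close>.\<close>

lemma Fourier_inversion_density:
  fixes m :: "real \<Rightarrow> real" and \<phi> :: "real \<Rightarrow> complex"
  assumes cont: "continuous_on UNIV m" and m0: "\<And>v. m v \<ge> 0" and int: "integrable lborel m"
    and pos: "(\<integral>v. m v \<partial>lborel) > 0"
    and \<phi>: "\<And>t. \<phi> t = (\<integral>v. iexp (t * v) * of_real (m v) \<partial>lborel)"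
    and \<phi>int: "integrable lborel \<phi>"
  shows "of_real (m a) = 1 / (2 * pi) * (\<integral>t. iexp (- (t * a)) * \<phi> t \<partial>lborel)"
proof -
  define c where "c = (\<integral>v. m v \<partial>lborel)"
  have c: "c > 0" using pos by (simp add: c_def)
  have [measurable]: "m \<in> borel_measurable borel" "\<phi> \<in> borel_measurable borel"
    using int \<phi>int by (auto dest: borel_measurable_integrable)
  define M where "M = density lborel (\<lambda>v. ennreal (m v / c))"
  have "emeasure M (space M) = ennreal (\<integral>v. m v / c \<partial>lborel)"
    unfolding M_def using int m0 c by (subst emeasure_density) (auto simp: nn_integral_eq_integral)
  then have "prob_space M" using c by (intro prob_spaceI) (simp add: c_def)
  then interpret prob_space M .
  interpret real_distribution M
    by standard (simp_all add: M_def)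
  have charM: "char M t = \<phi> t / c" for t
    unfolding char_def M_def \<phi> using m0 c
    by (subst integral_density) (auto simp: scaleR_conv_of_real mult_ac)
  have meas: "measure M A = (\<integral>v. indicator A v *\<^sub>R m v \<partial>lborel) / c" if "A \<in> sets borel" for A
  proof -
    have "measure M A = enn2real (\<integral>\<^sup>+v. ennreal (indicator A v *\<^sub>R m v / c) \<partial>lborel)"
      using that unfolding measure_def M_def
      by (subst emeasure_density) (auto intro!: arg_cong[where f=enn2real] nn_integral_cong simp: indicator_def)
    also have "\<dots> = (\<integral>v. indicator A v *\<^sub>R m v / c \<partial>lborel)"
      using that m0 c by (subst integral_eq_nn_integral) auto
    finally show ?thesis by simp
  qed
  have sing: "measure M {x} = 0" for x
  proof -
    have "(\<integral>v. indicator {x} v *\<^sub>R m v \<partial>lborel) = 0"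
    proof (rule integral_eq_zero_AE)
      show "AE v in lborel. indicator {x} v *\<^sub>R m v = 0"
        using AE_lborel_singleton[of x] by eventually_elim simp
    qed
    then show ?thesis by (subst meas) auto
  qed
  \<comment> \<open>At t = 0 the quotient is 0 by the convention for division, not its limit b - a;
    this affects one point only, which is discarded as a null set when the interval shrinks.\<close>
  define F where "F a b t = (iexp (- (t * a)) - iexp (- (t * b))) / (\<i> * t)" for a b t :: real
  have [measurable]: "F a b \<in> borel_measurable borel" for a b
    unfolding F_def[abs_def] by measurable
  \<comment> \<open>A bound uniform in t. It is the majorant for removing the truncation and,
    divided by b - a, for the limit of shrinking intervals.\<close>
  have Fb: "norm (F a b t) \<le> b - a" if "a \<le> b" for a b t
  proof (cases "t = 0")
    case False
    have "norm (F a b t) = cmod ((iexp (- t * a) - iexp (- t * b)) / (\<i> * complex_of_real t))"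
      by (simp add: F_def)
    also have "\<dots> = cmod ((iexp ((- t) * b) - iexp ((- t) * a)) / (\<i> * (- t)))"
      by (simp add: norm_divide norm_minus_commute norm_mult)
    also have "\<dots> \<le> b - a"
      by (rule Levy_Inversion_aux2) (use that False in auto)
    finally show ?thesis .
  qed (use that in \<open>simp add: F_def\<close>)
  have key: "of_real (integral {a..b} m) = 1 / (2 * pi) * (\<integral>t. F a b t * \<phi> t \<partial>lborel)" if ab: "a \<le> b" for a b
  proof -
    have "(\<lambda>T::nat. 1 / (2 * pi) * (CLBINT t=-real T..real T. F a b t * char M t)) \<longlonglongrightarrow> of_real (measure M {a<..b})"
      using Levy_Inversion[OF ab sing sing] unfolding F_def by simp
    also have "(\<lambda>T::nat. 1 / (2 * pi) * (CLBINT t=-real T..real T. F a b t * char M t))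
        = (\<lambda>T::nat. 1 / (2 * pi) * (\<integral>t. indicator {-real T..real T} t *\<^sub>R (F a b t * (\<phi> t / c)) \<partial>lborel))"
      unfolding charM by (subst interval_integral_Icc) (simp, simp only: set_lebesgue_integral_def)
    finally have lim1: "\<dots> \<longlonglongrightarrow> of_real (measure M {a<..b})" .
    have "(\<lambda>T::nat. (\<integral>t. indicator {-real T..real T} t *\<^sub>R (F a b t * (\<phi> t / c)) \<partial>lborel))
        \<longlonglongrightarrow> (\<integral>t. F a b t * (\<phi> t / c) \<partial>lborel)"
    proof (rule integral_dominated_convergence)
      show "integrable lborel (\<lambda>t. (b - a) / c * norm (\<phi> t))"
        using \<phi>int by (intro integrable_mult_right integrable_norm)
      show "AE t in lborel. norm (indicator {-real T..real T} t *\<^sub>R (F a b t * (\<phi> t / c))) \<le> (b - a) / c * norm (\<phi> t)" for T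
        using Fb[OF ab] c ab
        by (auto simp: indicator_def norm_mult norm_divide divide_simps intro!: mult_right_mono)
      show "AE t in lborel. (\<lambda>T. indicator {-real T..real T} t *\<^sub>R (F a b t * (\<phi> t / c))) \<longlonglongrightarrow> F a b t * (\<phi> t / c)"
      proof (rule AE_I2)
        fix t :: real
        have "eventually (\<lambda>T. t \<in> {-real T..real T}) sequentially"
          using eventually_ge_at_top[of "nat \<lceil>\<bar>t\<bar>\<rceil>"] by eventually_elim (auto simp: nat_le_iff ceiling_le_iff)
        then show "(\<lambda>T. indicator {-real T..real T} t *\<^sub>R (F a b t * (\<phi> t / c))) \<longlonglongrightarrow> F a b t * (\<phi> t / c)"
          by (intro tendsto_eventually) (auto elim!: eventually_mono)
      qed
    qed auto
    from tendsto_mult_left[OF this, of "1 / (2 * pi)"]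
    have "of_real (measure M {a<..b}) = 1 / (2 * pi) * (\<integral>t. F a b t * (\<phi> t / c) \<partial>lborel)"
      using lim1 by (intro LIMSEQ_unique) auto
    also have "(\<integral>t. F a b t * (\<phi> t / c) \<partial>lborel) = (\<integral>t. F a b t * \<phi> t \<partial>lborel) / c"
      by (simp flip: integral_divide_zero)
    also have "measure M {a<..b} = integral {a..b} m / c"
    proof -
      have "(\<integral>v. indicator {a<..b} v *\<^sub>R m v \<partial>lborel) = (\<integral>v. indicator {a..b} v *\<^sub>R m v \<partial>lborel)"
        using AE_lborel_singleton[of a] by (intro integral_cong_AE) (auto simp: indicator_def elim!: eventually_mono)
      also have "\<dots> = integral {a..b} m"
      proof -
        have "set_integrable lborel {a..b} m"
          unfolding set_integrable_def by (rule integrable_mult_indicator) (use int in auto)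
        from set_borel_integral_eq_integral(2)[OF this] show ?thesis
          by (simp add: set_lebesgue_integral_def)
      qed
      finally show ?thesis by (subst meas) auto
    qed
    finally show ?thesis using c by (simp add: field_simps)
  qed
  define h where "h k = 1 / real (Suc k)" for k
  have h: "h k > 0" for k by (simp add: h_def)
  have h0: "h \<longlonglongrightarrow> 0"
    unfolding h_def using LIMSEQ_inverse_real_of_nat by (simp add: inverse_eq_divide)
  have lim1: "(\<lambda>k. integral {a..a + h k} m / h k) \<longlonglongrightarrow> m a"
  proof -
    have "((\<lambda>x. integral {a..x} m) has_real_derivative m a) (at a within {a..a + 1})"
      by (rule integral_has_real_derivative) (auto intro: continuous_on_subset[OF cont])
    then have "((\<lambda>x. (integral {a..x} m - integral {a..a} m) / (x - a)) \<longlongrightarrow> m a) (at a within {a..a + 1})"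
      by (simp add: has_field_derivative_iff)
    moreover have "filterlim (\<lambda>k. a + h k) (at a within {a..a + 1}) sequentially"
    proof -
      have "(\<lambda>k. a + h k) \<longlonglongrightarrow> a" using tendsto_add[OF tendsto_const h0, of a] by simp
      moreover have "a + h k \<in> {a..a + 1}" "a + h k \<noteq> a" for k
        using h[of k] by (auto simp: h_def)
      ultimately show ?thesis by (auto simp: filterlim_at)
    qed
    ultimately have "(\<lambda>k. (integral {a..a + h k} m - integral {a..a} m) / (a + h k - a)) \<longlonglongrightarrow> m a"
      by (rule filterlim_compose)
    then show ?thesis by simp
  qed
  have "(\<lambda>k. \<integral>t. F a (a + h k) t * of_nat (Suc k) * \<phi> t \<partial>lborel) \<longlonglongrightarrow> (\<integral>t. iexp (- (t * a)) * \<phi> t \<partial>lborel)"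
  proof (rule integral_dominated_convergence)
    show "integrable lborel (\<lambda>t. norm (\<phi> t))" using \<phi>int by (rule integrable_norm)
    show "AE t in lborel. (\<lambda>k. F a (a + h k) t * of_nat (Suc k) * \<phi> t) \<longlonglongrightarrow> iexp (- (t * a)) * \<phi> t"
      using AE_lborel_singleton[of 0]
    proof eventually_elim
      case (elim t)
      show ?case
        using Levy_kernel_difference_quotient[OF elim, of a] unfolding F_def h_def
        by (intro tendsto_mult tendsto_const)
    qed
    show "AE t in lborel. norm (F a (a + h k) t * of_nat (Suc k) * \<phi> t) \<le> norm (\<phi> t)" for k
    proof (rule AE_I2)
      fix t
      have "norm (F a (a + h k) t) * real (Suc k) \<le> h k * real (Suc k)"
        using Fb[of a "a + h k" t] h[of k] by (intro mult_right_mono) auto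
      also have "\<dots> = 1" by (simp add: h_def)
      finally have "norm (F a (a + h k) t) * real (Suc k) * norm (\<phi> t) \<le> 1 * norm (\<phi> t)"
        by (rule mult_right_mono) simp
      then show "norm (F a (a + h k) t * of_nat (Suc k) * \<phi> t) \<le> norm (\<phi> t)"
        by (simp add: norm_mult del: of_nat_Suc)
    qed
  qed auto
  from tendsto_mult_left[OF this, of "1 / (2 * pi)"]
  have lim2: "(\<lambda>k. of_real (integral {a..a + h k} m / h k)) \<longlonglongrightarrow> 1 / (2 * pi) * (\<integral>t. iexp (- (t * a)) * \<phi> t \<partial>lborel)"
  proof (rule Lim_transform_eventually, intro always_eventually allI)
    fix k
    have "(\<integral>t. F a (a + h k) t * of_nat (Suc k) * \<phi> t \<partial>lborel) = of_nat (Suc k) * (\<integral>t. F a (a + h k) t * \<phi> t \<partial>lborel)"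
      by (subst integral_mult_right_zero[symmetric]) (simp add: mult_ac)
    then show "1 / (2 * pi) * (\<integral>t. F a (a + h k) t * of_nat (Suc k) * \<phi> t \<partial>lborel) = of_real (integral {a..a + h k} m / h k)"
      using key[of a "a + h k"] h[of k] by (simp add: h_def mult_ac del: of_nat_Suc)
  qed
  show ?thesis
    by (rule LIMSEQ_unique[OF tendsto_of_real[OF lim1] lim2])
qed

subsection \<open>Growth of the Gamma function on vertical strips\<close>

text \<open>Triangle inequality in Euler's integral, whose integrand has a modulus that depends on
  \<open>Re z\<close> alone.\<close>

lemma norm_Gamma_le_Gamma_Re:
  assumes "Re z > 0"
  shows "norm (Gamma z) \<le> Gamma (Re z)"
proof -
  let ?f = "\<lambda>w u. exp (w * complex_of_real u) * of_real (exp (- exp u))"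
  have "norm (Gamma z) = norm (\<integral>u. ?f z u \<partial>lborel)"
    using assms by (simp add: Gamma_integral_exp)
  also have "\<dots> \<le> (\<integral>u. norm (?f z u) \<partial>lborel)"
    by (rule integral_norm_bound)
  also have "(\<integral>u. norm (?f z u) \<partial>lborel) = Gamma (Re z)"
  proof -
    have "complex_of_real (\<integral>u. norm (?f z u) \<partial>lborel) = (\<integral>u. ?f (of_real (Re z)) u \<partial>lborel)"
      by (subst integral_complex_of_real[symmetric]) (simp add: norm_mult flip: exp_of_real)
    also have "\<dots> = complex_of_real (Gamma (Re z))"
      using assms by (simp add: Gamma_integral_exp Gamma_complex_of_real)
    finally show ?thesis by (simp only: of_real_eq_iff)
  qed
  finally show ?thesis .
qed

text \<open>In Gauss's product each factor \<open>(x + k) / \<bar>x + k + i y\<bar>\<close> increases with \<open>x\<close>.\<close>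

lemma norm_Gamma_ratio_mono:
  assumes "0 < a" "a \<le> b"
  shows "norm (Gamma (Complex a y)) * Gamma b \<le> norm (Gamma (Complex b y)) * Gamma a"
proof (rule tendsto_le[OF sequentially_bot])
  show "(\<lambda>n. norm (Gamma_series (Complex a y) n) * Gamma_series b n) \<longlonglongrightarrow> norm (Gamma (Complex a y)) * Gamma b"
    by (intro tendsto_intros)
  show "(\<lambda>n. norm (Gamma_series (Complex b y) n) * Gamma_series a n) \<longlonglongrightarrow> norm (Gamma (Complex b y)) * Gamma a"
    by (intro tendsto_intros)
  show "\<forall>\<^sub>F n in sequentially. norm (Gamma_series (Complex a y) n) * Gamma_series b n
      \<le> norm (Gamma_series (Complex b y) n) * Gamma_series a n"
  proof (intro always_eventually allI)
    fix n
    have factor: "(a + real k) * norm (Complex b y + of_nat k) \<le> (b + real k) * norm (Complex a y + of_nat k)" for k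
    proof (rule power2_le_imp_le)
      \<comment> \<open>After squaring, the product of (a + k)^2 and (b + k)^2 occurs on both sides,
        and only this comparison is left.\<close>
      have "(a + real k)\<^sup>2 * y\<^sup>2 \<le> (b + real k)\<^sup>2 * y\<^sup>2"
        using assms by (intro mult_right_mono power_mono) auto
      then show "((a + real k) * norm (Complex b y + of_nat k))\<^sup>2 \<le> ((b + real k) * norm (Complex a y + of_nat k))\<^sup>2"
        by (simp only: power_mult_distrib cmod_power2) (simp add: algebra_simps)
    qed (use assms in auto)
    have A: "(\<Prod>k<n+1. a + real k) * (\<Prod>k<n+1. norm (Complex b y + of_nat k))
       \<le> (\<Prod>k<n+1. b + real k) * (\<Prod>k<n+1. norm (Complex a y + of_nat k))"
      unfolding prod.distrib[symmetric] using factor assms by (intro prod_mono) auto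
    have poch: "pochhammer a (n+1) * norm (pochhammer (Complex b y) (n+1))
        \<le> pochhammer b (n+1) * norm (pochhammer (Complex a y) (n+1))"
      using A by (simp add: pochhammer_prod prod_norm atLeast0LessThan)
    have pos: "pochhammer a (n+1) > 0" "pochhammer b (n+1) > 0"
      using assms by (auto intro!: pochhammer_pos)
    have nz: "norm (pochhammer (Complex x y) (n+1)) > 0" if "x > 0" for x
    proof -
      have "Complex x y \<noteq> - of_nat k" for k using that by (simp add: complex_eq_iff)
      then show ?thesis by (simp add: pochhammer_eq_0_iff)
    qed
    have nrm: "norm (Gamma_series (Complex x y) n) = fact n * exp (x * ln (real n)) / norm (pochhammer (Complex x y) (n+1))" for x
      by (simp add: Gamma_series_def norm_mult norm_divide)
    have ser: "Gamma_series x n = fact n * exp (x * ln (real n)) / pochhammer x (n+1)" for x :: real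
      by (simp add: Gamma_series_def)
    show "norm (Gamma_series (Complex a y) n) * Gamma_series b n
      \<le> norm (Gamma_series (Complex b y) n) * Gamma_series a n"
      unfolding nrm ser times_divide_times_eq
    proof (rule frac_le)
      show "fact n * exp (a * ln (real n)) * (fact n * exp (b * ln (real n)))
          \<le> fact n * exp (b * ln (real n)) * (fact n * exp (a * ln (real n)))"
        by (simp add: mult_ac)
    qed (use poch pos nz[of b] nz[of a] assms in \<open>auto simp: mult_ac\<close>)
  qed
qed

lemma Gamma_shift:
  fixes z :: complex
  assumes "Im z \<noteq> 0"
  shows "Gamma (z + of_nat k) = pochhammer z k * Gamma z"
proof -
  have "z \<notin> \<int>\<^sub>\<le>\<^sub>0" using assms by (auto elim!: nonpos_Ints_cases)
  then show ?thesis by (simp add: pochhammer_Gamma Gamma_eq_zero_iff)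
qed

lemma norm_pochhammer_ge:
  "\<bar>Im z\<bar> ^ k \<le> norm (pochhammer z k)"
proof -
  have "\<bar>Im z\<bar> ^ k = (\<Prod>i<k. \<bar>Im z\<bar>)" by simp
  also have "\<dots> \<le> (\<Prod>i<k. norm (z + of_nat i))"
    using abs_Im_le_cmod[of "z + of_nat i" for i] by (intro prod_mono) auto
  finally show ?thesis by (simp add: pochhammer_prod prod_norm atLeast0LessThan)
qed

lemma norm_pochhammer_le:
  assumes "\<bar>Im z\<bar> \<ge> 1"
  shows "norm (pochhammer z k) \<le> ((1 + \<bar>Re z\<bar> + real k) * \<bar>Im z\<bar>) ^ k"
proof -
  have "norm (z + of_nat i) \<le> (1 + \<bar>Re z\<bar> + real k) * \<bar>Im z\<bar>" if "i < k" for i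
  proof -
    have "norm (z + of_nat i) \<le> \<bar>Re z + real i\<bar> + \<bar>Im z\<bar>"
      using cmod_le[of "z + of_nat i"] by simp
    also have "\<dots> \<le> (\<bar>Re z\<bar> + real k) * 1 + \<bar>Im z\<bar>" using that by auto
    also have "\<dots> \<le> (\<bar>Re z\<bar> + real k) * \<bar>Im z\<bar> + \<bar>Im z\<bar>"
      using assms by (intro add_right_mono mult_left_mono) auto
    finally show ?thesis by (simp add: algebra_simps)
  qed
  then have "(\<Prod>i<k. norm (z + of_nat i)) \<le> (\<Prod>i<k. (1 + \<bar>Re z\<bar> + real k) * \<bar>Im z\<bar>)"
    by (intro prod_mono) auto
  then show ?thesis by (simp add: pochhammer_prod prod_norm atLeast0LessThan)
qed

text \<open>One constant bounds \<open>Gamma\<close> from above and away from zero; the lower bound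
  is the boundedness of the continuous function \<open>rGamma\<close>.\<close>

lemma Gamma_bounded_on_interval:
  fixes a b :: real
  assumes "a > 0"
  shows "\<exists>K>0. \<forall>x\<in>{a..b}. Gamma x \<le> K \<and> 1 \<le> K * Gamma x"
proof -
  have ni: "{a..b} \<inter> \<int>\<^sub>\<le>\<^sub>0 = {}" using assms by (auto elim!: nonpos_Ints_cases)
  have "bounded (Gamma ` {a..b})" "bounded (rGamma ` {a..b})"
    by (intro compact_imp_bounded compact_continuous_image continuous_on_Gamma continuous_on_rGamma ni compact_Icc)+
  then obtain K1 K2 where "\<forall>x\<in>{a..b}. \<bar>Gamma x\<bar> \<le> K1" "\<forall>x\<in>{a..b}. \<bar>rGamma x\<bar> \<le> K2"
    unfolding bounded_iff by auto
  then have K: "\<And>x. x \<in> {a..b} \<Longrightarrow> \<bar>Gamma x\<bar> \<le> K1" "\<And>x. x \<in> {a..b} \<Longrightarrow> \<bar>rGamma x\<bar> \<le> K2"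
    by blast+
  show ?thesis
  proof (intro exI[of _ "max 1 (max K1 K2)"] conjI ballI)
    fix x assume x: "x \<in> {a..b}"
    then show "Gamma x \<le> max 1 (max K1 K2)" using K(1)[OF x] by auto
    have G: "Gamma x > 0" using x assms by (intro Gamma_real_pos) auto
    then have "inverse (Gamma x) \<le> max 1 (max K1 K2)"
      using K(2)[OF x] by (auto simp: rGamma_inverse_Gamma)
    then show "1 \<le> max 1 (max K1 K2) * Gamma x" using G by (simp add: field_simps)
  qed auto
qed

text \<open>Decay faster than any power comes from the functional equation: \<open>Gamma z\<close>
  is \<open>Gamma (z + k)\<close> over a product of k factors, each of modulus at least the modulus
  of \<open>Im z\<close>, and the numerator is bounded once \<open>a + k\<close> is positive. Taking
  k at least \<open>m\<close> gives the required power.\<close>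

lemma Gamma_decay_strip:
  fixes a b :: real
  shows "\<exists>K>0. \<forall>z. Re z \<in> {a..b} \<longrightarrow> \<bar>Im z\<bar> \<ge> 1 \<longrightarrow> norm (Gamma z) * \<bar>Im z\<bar> ^ m \<le> K"
proof -
  obtain k0 :: nat where k0: "real k0 > - a" using reals_Archimedean2 by blast
  define k where "k = max m k0"
  have k: "k \<ge> m" "a + real k > 0" using k0 by (auto simp: k_def)
  obtain K where K0: "K > 0" and K1: "\<forall>x\<in>{a + real k..b + real k}. Gamma x \<le> K \<and> 1 \<le> K * Gamma x"
    using Gamma_bounded_on_interval[OF k(2)] by metis
  then have K: "K > 0" "\<And>x. x \<in> {a + real k..b + real k} \<Longrightarrow> Gamma x \<le> K" by auto
  show ?thesis
  proof (intro exI[of _ K] conjI allI impI K(1))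
    fix z assume z: "Re z \<in> {a..b}" "\<bar>Im z\<bar> \<ge> 1"
    have "norm (Gamma z) * \<bar>Im z\<bar> ^ m \<le> norm (Gamma z) * \<bar>Im z\<bar> ^ k"
      using z k by (intro mult_left_mono power_increasing) auto
    also have "\<dots> \<le> norm (Gamma z) * norm (pochhammer z k)"
      by (intro mult_left_mono norm_pochhammer_ge) auto
    also have "\<dots> = norm (Gamma (z + of_nat k))"
      using z by (subst Gamma_shift) (auto simp: norm_mult)
    also have "\<dots> \<le> Gamma (Re (z + of_nat k))"
      using z k by (intro norm_Gamma_le_Gamma_Re) auto
    also have "\<dots> \<le> K" using z by (intro K(2)) auto
    finally show "norm (Gamma z) * \<bar>Im z\<bar> ^ m \<le> K" .
  qed
qed

text \<open>Both arguments are moved into the right half-plane, where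
  \<open>norm_Gamma_ratio_mono\<close> compares values with equal imaginary part. Moving
  \<open>z\<close> by k costs nothing, as the product only helps; moving \<open>z'\<close> by j
  costs a polynomial of degree j in \<open>Im z\<close>.\<close>

lemma Gamma_ratio_strip:
  fixes a b a' b' :: real
  shows "\<exists>K>0. \<exists>j. \<forall>z z'. Re z \<in> {a..b} \<longrightarrow> Re z' \<in> {a'..b'} \<longrightarrow> Im z = Im z' \<longrightarrow> \<bar>Im z\<bar> \<ge> 1
     \<longrightarrow> norm (Gamma z) \<le> K * \<bar>Im z\<bar> ^ j * norm (Gamma z')"
proof -
  obtain k :: nat where k: "real k > - a" using reals_Archimedean2 by blast
  \<comment> \<open>So large that Re z + k \<le> Re z' + j throughout the strips, which is the order
    of abscissae that the monotonicity requires.\<close>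
  obtain j :: nat where j: "real j > \<bar>b\<bar> + real k + \<bar>a'\<bar>" using reals_Archimedean2 by blast
  have ak: "a + real k > 0" and aj: "a' + real j > 0" using k j by auto
  obtain K1 where "K1 > 0" "\<forall>x\<in>{a + real k..b + real k}. Gamma x \<le> K1 \<and> 1 \<le> K1 * Gamma x"
    using Gamma_bounded_on_interval[OF ak] by metis
  then have K1: "K1 > 0" "\<And>x. x \<in> {a + real k..b + real k} \<Longrightarrow> Gamma x \<le> K1" by auto
  obtain K2 where "K2 > 0" "\<forall>x\<in>{a' + real j..b' + real j}. Gamma x \<le> K2 \<and> 1 \<le> K2 * Gamma x"
    using Gamma_bounded_on_interval[OF aj] by metis
  then have K2: "K2 > 0" "\<And>x. x \<in> {a' + real j..b' + real j} \<Longrightarrow> 1 \<le> K2 * Gamma x" by auto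
  define D where "D = (1 + \<bar>a'\<bar> + \<bar>b'\<bar> + real j) ^ j"
  have D: "D > 0" by (simp add: D_def add_pos_nonneg)
  show ?thesis
  proof (intro exI[of _ "K2 * K1 * D"] exI[of _ j] conjI allI impI)
    fix z z' assume z: "Re z \<in> {a..b}" "Re z' \<in> {a'..b'}" "Im z = Im z'" "\<bar>Im z\<bar> \<ge> 1"
    have zk: "z + of_nat k = Complex (Re z + real k) (Im z)" and zj: "z' + of_nat j = Complex (Re z' + real j) (Im z)"
      using z by (auto simp: complex_eq_iff)
    have "norm (Gamma z) \<le> norm (Gamma z) * \<bar>Im z\<bar> ^ k"
      using z by (simp add: mult_le_cancel_left1)
    also have "\<dots> \<le> norm (Gamma z) * norm (pochhammer z k)"
      by (intro mult_left_mono norm_pochhammer_ge) auto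
    also have "\<dots> = norm (Gamma (z + of_nat k))"
      using z by (subst Gamma_shift) (auto simp: norm_mult)
    also have "\<dots> \<le> norm (Gamma (z + of_nat k)) * (K2 * Gamma (Re z' + real j))"
      using z K2(2)[of "Re z' + real j"] by (simp add: mult_le_cancel_left1)
    also have "\<dots> = K2 * (norm (Gamma (z + of_nat k)) * Gamma (Re z' + real j))" by simp
    also have "\<dots> \<le> K2 * (norm (Gamma (z' + of_nat j)) * Gamma (Re z + real k))"
      unfolding zk zj using z ak j K2(1) by (intro mult_left_mono norm_Gamma_ratio_mono) auto
    also have "\<dots> \<le> K2 * (norm (Gamma (z' + of_nat j)) * K1)"
      using z K2(1) by (intro mult_left_mono K1(2)) auto
    also have "norm (Gamma (z' + of_nat j)) = norm (pochhammer z' j) * norm (Gamma z')"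
      using z by (subst Gamma_shift) (auto simp: norm_mult)
    also have "K2 * (norm (pochhammer z' j) * norm (Gamma z') * K1) \<le> K2 * (D * \<bar>Im z\<bar> ^ j * norm (Gamma z') * K1)"
    proof -
      have "norm (pochhammer z' j) \<le> ((1 + \<bar>Re z'\<bar> + real j) * \<bar>Im z'\<bar>) ^ j"
        using z by (intro norm_pochhammer_le) auto
      also have "\<dots> \<le> ((1 + \<bar>a'\<bar> + \<bar>b'\<bar> + real j) * \<bar>Im z'\<bar>) ^ j"
        using z by (intro power_mono mult_right_mono) auto
      also have "\<dots> = D * \<bar>Im z\<bar> ^ j" using z by (simp add: D_def power_mult_distrib)
      finally show ?thesis using K1 K2 by (intro mult_left_mono mult_right_mono) auto
    qed
    finally show "norm (Gamma z) \<le> K2 * K1 * D * \<bar>Im z\<bar> ^ j * norm (Gamma z')" by (simp add: mult_ac)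
  qed (use K1 K2 D in auto)
qed

subsection \<open>Shifting a vertical line of integration\<close>

lemma integrable_inverse_square_tail:
  fixes f :: "real \<Rightarrow> complex"
  assumes cont: "continuous_on UNIV f" and Y: "Y > 0"
    and b: "\<And>y. \<bar>y\<bar> \<ge> Y \<Longrightarrow> norm (f y) * y\<^sup>2 \<le> K"
  shows "integrable lborel f"
proof -
  have "integrable lborel (\<lambda>x::real. inverse (1 + x\<^sup>2))"
    using integrable_inverse_1_plus_square by (simp add: set_integrable_def)
  moreover have "compact ((\<lambda>y. norm (f y) * (1 + y\<^sup>2)) ` {-Y..Y})"
    by (intro compact_continuous_image continuous_intros continuous_on_subset[OF cont]) auto
  then obtain L where "\<forall>x\<in>(\<lambda>y. norm (f y) * (1 + y\<^sup>2)) ` {-Y..Y}. norm x \<le> L"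
    by (auto dest!: compact_imp_bounded simp only: bounded_iff)
  then have L: "norm (f y) * (1 + y\<^sup>2) \<le> L" if "y \<in> {-Y..Y}" for y
    using that by auto
  \<comment> \<open>On the tail, norm (f y) is at most K / Y^2 and norm (f y) y^2 at most K; their
    sum bounds norm (f y) (1 + y^2).\<close>
  define C where "C = max L (K / Y\<^sup>2 + K)"
  have "norm (f y) * (1 + y\<^sup>2) \<le> C" for y
  proof (cases "\<bar>y\<bar> \<le> Y")
    case False
    have "norm (f y) * Y\<^sup>2 \<le> norm (f y) * y\<^sup>2"
      using False Y by (intro mult_left_mono) (auto intro: power2_le_iff_abs_le[THEN iffD2] simp: abs_le_square_iff[symmetric])
    also have "\<dots> \<le> K" using False by (intro b) auto
    finally have "norm (f y) \<le> K / Y\<^sup>2" using Y by (simp add: field_simps)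
    then show ?thesis using b[of y] False by (simp add: C_def distrib_left)
  next
    case True
    then have "norm (f y) * (1 + y\<^sup>2) \<le> L" by (intro L) auto
    then show ?thesis by (simp add: C_def)
  qed
  then have "norm (f y) \<le> C * inverse (1 + y\<^sup>2)" for y
    by (simp add: field_simps add_pos_nonneg)
  moreover have "f \<in> borel_measurable borel"
    using cont by (rule borel_measurable_continuous_onI)
  ultimately show ?thesis
    by (intro Bochner_Integration.integrable_bound[of lborel "\<lambda>x. C * inverse (1 + x\<^sup>2)" f] AE_I2
        integrable_mult_right) (auto intro: order_trans[OF _ abs_ge_self])
qed

lemma integral_symmetric_interval_tendsto:
  fixes f :: "real \<Rightarrow> complex"
  assumes "integrable lborel f"
  shows "(\<lambda>T. integral {- real T..real T} f) \<longlonglongrightarrow> (\<integral>y. f y \<partial>lborel)"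
proof -
  have [measurable]: "f \<in> borel_measurable borel" using assms by auto
  have eq: "integral {- real T..real T} f = (\<integral>y. indicator {- real T..real T} y *\<^sub>R f y \<partial>lborel)" for T
    using set_borel_integral_eq_integral(2)[of "{- real T..real T}" f] assms
    by (simp add: set_integrable_def set_lebesgue_integral_def integrable_mult_indicator)
  show ?thesis unfolding eq
  proof (rule integral_dominated_convergence)
    show "integrable lborel (\<lambda>y. norm (f y))" using assms by (rule integrable_norm)
    show "AE y in lborel. (\<lambda>T. indicator {- real T..real T} y *\<^sub>R f y) \<longlonglongrightarrow> f y"
    proof (rule AE_I2)
      fix t :: real
      have "eventually (\<lambda>T. t \<in> {-real T..real T}) sequentially"
        using eventually_ge_at_top[of "nat \<lceil>\<bar>t\<bar>\<rceil>"] by eventually_elim (auto simp: nat_le_iff ceiling_le_iff)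
      then show "(\<lambda>T. indicator {-real T..real T} t *\<^sub>R f t) \<longlonglongrightarrow> f t"
        by (intro tendsto_eventually) (auto elim!: eventually_mono)
    qed
  qed (auto simp: indicator_def)
qed

text \<open>The residue theorem on rectangles of height 2 T, with T tending to infinity: the
  horizontal sides contribute at most K (c1 - c0) / T^2. As \<open>P\<close> is real, each such
  rectangle encloses all of it and no horizontal side meets it. The strip between \<open>l\<close>
  and \<open>u\<close> gives an open domain containing both lines; dz = i dy accounts for the factor
  2 pi without i.\<close>

lemma vertical_line_shift:
  fixes f :: "complex \<Rightarrow> complex"
  assumes lu: "l < c0" "c0 < c1" "c1 < u" and fin: "finite P"
    and P: "\<And>w. w \<in> P \<Longrightarrow> c0 < Re w \<and> Re w < c1 \<and> Im w = 0"
    and holo: "f holomorphic_on ({z. l < Re z \<and> Re z < u} - P)"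
    and Y: "Y > 0" and bound: "\<And>z. Re z \<in> {c0..c1} \<Longrightarrow> \<bar>Im z\<bar> \<ge> Y \<Longrightarrow> norm (f z) * (Im z)\<^sup>2 \<le> K"
  shows "integrable lborel (\<lambda>y. f (Complex c0 y))" and "integrable lborel (\<lambda>y. f (Complex c1 y))"
    and "(\<integral>y. f (Complex c0 y) \<partial>lborel) = (\<integral>y. f (Complex c1 y) \<partial>lborel) - 2 * pi * (\<Sum>w\<in>P. residue f w)"
proof -
  define S where "S = {z. l < Re z \<and> Re z < u}"
  have S: "open S" "connected S"
  proof -
    have "S = {z. l < Re z} \<inter> {z. Re z < u}" by (auto simp: S_def)
    then show "open S" "connected S"
      by (auto intro!: convex_connected convex_Int convex_halfspace_Re_gt convex_halfspace_Re_lt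
          open_Int open_halfspace_Re_gt open_halfspace_Re_lt)
  qed
  have holo': "f holomorphic_on (S - P)" using holo by (simp add: S_def)
  have cont: "continuous_on A f" if "A \<subseteq> S - P" for A
    using holomorphic_on_imp_continuous_on[OF holo'] that by (rule continuous_on_subset)
  have K0: "K \<ge> 0"
  proof -
    have "0 \<le> norm (f (Complex c0 Y)) * Y\<^sup>2" by simp
    also have "\<dots> \<le> K" using bound[of "Complex c0 Y"] lu Y by simp
    finally show ?thesis .
  qed
  have line: "continuous_on UNIV (\<lambda>y. f (Complex c y))" if "c = c0 \<or> c = c1" for c
  proof -
    have eq: "Complex c y = of_real c + \<i> * of_real y" for y by (simp add: complex_eq_iff)
    have "range (Complex c) \<subseteq> S - P" using that P lu by (force simp: S_def)
    then show ?thesis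
      by (intro continuous_on_compose2[OF cont[OF order_refl]]) (auto simp: eq intro!: continuous_intros)
  qed
  show i0: "integrable lborel (\<lambda>y. f (Complex c0 y))" and i1: "integrable lborel (\<lambda>y. f (Complex c1 y))"
    using lu bound[of "Complex c0 y" for y] bound[of "Complex c1 y" for y]
    by (auto intro!: integrable_inverse_square_tail[OF line Y, of _ K])
  define R where "R = (\<Sum>w\<in>P. residue f w)"
  define B where "B T = contour_integral (linepath (Complex c0 (- T)) (Complex c1 (- T))) f" for T
  define U where "U T = contour_integral (linepath (Complex c1 T) (Complex c0 T)) f" for T
  have hor: "norm (contour_integral (linepath w w') f) \<le> K / T\<^sup>2 * (c1 - c0)"
    if hyp: "T \<ge> Y" "\<bar>Im w\<bar> = T" "Im w' = Im w" "(Re w = c0 \<and> Re w' = c1) \<or> (Re w = c1 \<and> Re w' = c0)" for w w' T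
  proof -
    have T: "T > 0" using Y hyp by simp
    have seg: "Re z \<in> {c0..c1}" "Im z = Im w" if "z \<in> closed_segment w w'" for z
      using that closed_segment_same_Im[of w w'] hyp(3,4) lu
      by (auto simp: closed_segment_eq_real_ivl split: if_splits)
    have "norm (contour_integral (linepath w w') f) \<le> K / T\<^sup>2 * norm (w' - w)"
    proof (rule contour_integral_bound_linepath)
      have "closed_segment w w' \<subseteq> S - P"
      proof
        fix z assume z: "z \<in> closed_segment w w'"
        have "Im z \<noteq> 0" using seg(2)[OF z] hyp(2) T by auto
        then show "z \<in> S - P" using seg(1)[OF z] P[of z] lu by (auto simp: S_def)
      qed
      then show "f contour_integrable_on linepath w w'"
        by (intro contour_integrable_continuous_linepath cont)
      show "norm (f z) \<le> K / T\<^sup>2" if z: "z \<in> closed_segment w w'" for z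
      proof -
        have abs: "\<bar>Im z\<bar> = T" using seg(2)[OF z] hyp(2) by simp
        then have "(Im z)\<^sup>2 = T\<^sup>2" by (metis power2_abs)
        then show ?thesis using bound[OF seg(1)[OF z]] abs hyp(1) T by (simp add: pos_le_divide_eq)
      qed
    qed (use K0 in auto)
    also have "norm (w' - w) = c1 - c0"
      using hyp(3,4) lu by (auto simp: cmod_def)
    finally show ?thesis .
  qed
  have rect: "B T + \<i> * integral {-T..T} (\<lambda>y. f (Complex c1 y)) + U T - \<i> * integral {-T..T} (\<lambda>y. f (Complex c0 y))
      = 2 * pi * \<i> * R" if T: "T \<ge> Y" for T
  proof -
    let ?a = "Complex c0 (- T)" and ?b = "Complex c1 (- T)" and ?c = "Complex c1 T" and ?d = "Complex c0 T"
    have T0: "T > 0" using Y T by simp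
    have img: "path_image (rectpath ?a ?c) \<subseteq> S - P"
      using lu T0 P by (subst path_image_rectpath) (auto simp: S_def dest!: P)
    have sub: "closed_segment ?a ?b \<subseteq> S - P" "closed_segment ?b ?c \<subseteq> S - P"
      "closed_segment ?c ?d \<subseteq> S - P" "closed_segment ?d ?a \<subseteq> S - P"
      using img by (auto simp: rectpath_def Let_def path_image_join)
    have ci: "f contour_integrable_on linepath ?a ?b" "f contour_integrable_on linepath ?b ?c"
       "f contour_integrable_on linepath ?c ?d" "f contour_integrable_on linepath ?d ?a"
      using sub by (auto intro!: contour_integrable_continuous_linepath cont)
    have "contour_integral (rectpath ?a ?c) f = 2 * pi * \<i> * (\<Sum>w\<in>P. winding_number (rectpath ?a ?c) w * residue f w)"
    proof (rule Residue_theorem[OF S fin holo' valid_path_rectpath _ img])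
      show "\<forall>z. z \<notin> S \<longrightarrow> winding_number (rectpath ?a ?c) z = 0"
        using lu T0 by (auto intro!: winding_number_rectpath_outside simp: S_def in_cbox_complex_iff)
    qed auto
    also have "(\<Sum>w\<in>P. winding_number (rectpath ?a ?c) w * residue f w) = R"
      unfolding R_def using T0 P
      by (intro sum.cong refl) (auto simp: winding_number_rectpath in_box_complex_iff)
    also have "contour_integral (rectpath ?a ?c) f = contour_integral (linepath ?a ?b) f +
       (contour_integral (linepath ?b ?c) f + (contour_integral (linepath ?c ?d) f + contour_integral (linepath ?d ?a) f))"
      unfolding rectpath_def Let_def using ci by (simp add: contour_integrable_joinI)
    also have "contour_integral (linepath ?d ?a) f = - contour_integral (linepath ?a ?d) f"
      by (rule contour_integral_reverse_linepath) (use sub(4) in \<open>auto intro!: cont simp: closed_segment_commute\<close>)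
    also have "contour_integral (linepath ?b ?c) f = \<i> * integral {-T..T} (\<lambda>y. f (Complex c1 y))"
      by (rule contour_integral_linepath_same_Re) (use T0 in auto)
    also have "contour_integral (linepath ?a ?d) f = \<i> * integral {-T..T} (\<lambda>y. f (Complex c0 y))"
      by (rule contour_integral_linepath_same_Re) (use T0 in auto)
    finally show ?thesis by (simp add: B_def U_def algebra_simps)
  qed
  have ev: "eventually (\<lambda>T. real T \<ge> Y) sequentially"
    using eventually_ge_at_top[of "nat \<lceil>Y\<rceil>"] by eventually_elim (auto simp: nat_le_iff ceiling_le_iff)
  have z: "(\<lambda>T. K / (real T)\<^sup>2 * (c1 - c0)) \<longlonglongrightarrow> 0"
    by real_asymp
  have "\<forall>\<^sub>F T in sequentially. norm (B (real T)) \<le> K / (real T)\<^sup>2 * (c1 - c0)"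
    using ev by (rule eventually_mono) (unfold B_def, rule hor, use Y in auto)
  then have B0: "(\<lambda>T. B (real T)) \<longlonglongrightarrow> 0"
    using z by (rule Lim_null_comparison)
  have "\<forall>\<^sub>F T in sequentially. norm (U (real T)) \<le> K / (real T)\<^sup>2 * (c1 - c0)"
    using ev by (rule eventually_mono) (unfold U_def, rule hor, use Y in auto)
  then have U0: "(\<lambda>T. U (real T)) \<longlonglongrightarrow> 0"
    using z by (rule Lim_null_comparison)
  have "(\<lambda>T. B (real T) + \<i> * integral {-real T..real T} (\<lambda>y. f (Complex c1 y)) + U (real T)
      - \<i> * integral {-real T..real T} (\<lambda>y. f (Complex c0 y)))
      \<longlonglongrightarrow> 0 + \<i> * (\<integral>y. f (Complex c1 y) \<partial>lborel) + 0 - \<i> * (\<integral>y. f (Complex c0 y) \<partial>lborel)"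
    by (intro tendsto_intros B0 U0 integral_symmetric_interval_tendsto i0 i1)
  moreover have "(\<lambda>T. B (real T) + \<i> * integral {-real T..real T} (\<lambda>y. f (Complex c1 y)) + U (real T)
      - \<i> * integral {-real T..real T} (\<lambda>y. f (Complex c0 y))) \<longlonglongrightarrow> 2 * pi * \<i> * R"
    by (rule tendsto_eventually, rule eventually_mono[OF ev], rule rect)
  ultimately have "0 + \<i> * (\<integral>y. f (Complex c1 y) \<partial>lborel) + 0 - \<i> * (\<integral>y. f (Complex c0 y) \<partial>lborel) = 2 * pi * \<i> * R"
    by (rule LIMSEQ_unique)
  then have "\<i> * (\<integral>y. f (Complex c0 y) \<partial>lborel) = \<i> * ((\<integral>y. f (Complex c1 y) \<partial>lborel) - 2 * pi * R)"
    by (simp add: algebra_simps)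
  then show "(\<integral>y. f (Complex c0 y) \<partial>lborel) = (\<integral>y. f (Complex c1 y) \<partial>lborel) - 2 * pi * (\<Sum>w\<in>P. residue f w)"
    by (simp add: R_def)
qed

subsection \<open>The kernel and its residues\<close>

lemma Re_pos_not_nonpos_Int: "Re z > 0 \<Longrightarrow> z \<notin> \<int>\<^sub>\<le>\<^sub>0"
  by (auto elim!: nonpos_Ints_cases)

text \<open>The regular factor of \<open>Gamma\<close> at its pole \<open>-k\<close>: near \<open>-k\<close>,
  \<open>Gamma w = Gamma_residual k w / (w + k)\<close>.\<close>

definition Gamma_residual :: "nat \<Rightarrow> complex \<Rightarrow> complex" where
  "Gamma_residual k w = Gamma (w + of_nat k + 1) / pochhammer w k"

text \<open>Integers have distance at least 1, so within the open unit disc around -k no other pole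
  of \<open>Gamma\<close> interferes.\<close>

lemma near_nonpos_Int:
  assumes "norm (w + of_nat k) < 1"
  shows "Re (w + of_nat k + 1) > 0" and "pochhammer w k \<noteq> 0"
    and "w \<noteq> - of_nat k \<Longrightarrow> w \<notin> \<int>\<^sub>\<le>\<^sub>0"
proof -
  have "\<bar>Re (w + of_nat k)\<bar> < 1" using abs_Re_le_cmod assms by (rule le_less_trans)
  then show "Re (w + of_nat k + 1) > 0" by simp
  have *: "i = k" if "w = - of_nat i" for i
  proof -
    have "norm (complex_of_int (int k - int i)) < 1" using assms that by simp
    then have "\<bar>int k - int i\<bar> < 1" by (simp only: norm_of_int of_int_less_1_iff flip: of_int_abs)
    then show ?thesis by simp
  qed
  show "pochhammer w k \<noteq> 0" using * by (force simp: pochhammer_eq_0_iff)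
  show "w \<noteq> - of_nat k \<Longrightarrow> w \<notin> \<int>\<^sub>\<le>\<^sub>0"
    using * by (auto elim!: nonpos_Ints_cases')
qed

text \<open>The functional equation applied k + 1 times; the last factor of the rising factorial, w
  + k, is the one that vanishes at the pole.\<close>

lemma Gamma_eq_residual:
  assumes "norm (w + of_nat k) < 1" "w \<noteq> - of_nat k"
  shows "Gamma w = Gamma_residual k w / (w + of_nat k)"
proof -
  have "w \<notin> \<int>\<^sub>\<le>\<^sub>0" using near_nonpos_Int(3)[OF assms] .
  then have "Gamma w \<noteq> 0" "pochhammer w (Suc k) = Gamma (w + of_nat (Suc k)) / Gamma w"
    by (simp add: Gamma_eq_zero_iff, rule pochhammer_Gamma)
  then have "Gamma (w + of_nat (Suc k)) = pochhammer w (Suc k) * Gamma w"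
    by simp
  moreover have "w + of_nat k \<noteq> 0" using assms(2) by (simp add: eq_neg_iff_add_eq_0)
  moreover have "w + of_nat k + 1 = w + of_nat (Suc k)" by simp
  ultimately show ?thesis
    using near_nonpos_Int(2)[OF assms(1)]
    by (simp only: Gamma_residual_def pochhammer_Suc) simp
qed

lemma Gamma_residual_holomorphic:
  assumes "f holomorphic_on A" and "\<And>z. z \<in> A \<Longrightarrow> norm (f z + of_nat k) < 1"
  shows "(\<lambda>z. Gamma_residual k (f z)) holomorphic_on A"
proof -
  have "f z + of_nat k + 1 \<notin> \<int>\<^sub>\<le>\<^sub>0" if "z \<in> A" for z
    by (intro Re_pos_not_nonpos_Int near_nonpos_Int(1) assms(2) that)
  then show ?thesis
    unfolding Gamma_residual_def
    using near_nonpos_Int(2)[OF assms(2)] by (auto intro!: holomorphic_intros assms(1))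
qed

lemma Gamma_residual_at_pole: "Gamma_residual k (- of_nat k) = (- 1) ^ k / fact k"
proof -
  have "pochhammer (- of_nat k :: complex) k = (- 1) ^ k * fact k"
    by (simp add: pochhammer_minus pochhammer_fact)
  then show ?thesis
    by (cases "even k") (simp_all add: Gamma_residual_def)
qed

text \<open>Induction through
  \<open>Gamma_residual (Suc k) w = Gamma_residual k (w + 1) / w\<close>: the quotient rule adds 1 /
  (k + 1), which is the step of the digamma recurrence. These derivatives produce the terms
  \<open>Digamma (l + 1)\<close> and \<open>Digamma (j + 1)\<close> at double poles.\<close>

lemma Gamma_residual_deriv:
  "(Gamma_residual k has_field_derivative (- 1) ^ k / fact k * Digamma (of_nat k + 1)) (at (- of_nat k))"
proof (induction k)
  case 0
  have "((\<lambda>w. Gamma (w + 1)) has_field_derivative Digamma 1) (at (0::complex))"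
    by (auto intro!: derivative_eq_intros)
  then show ?case by (simp add: Gamma_residual_def[abs_def])
next
  case (Suc k)
  have rec: "Gamma_residual (Suc k) w = Gamma_residual k (w + 1) / w" for w
    by (simp add: Gamma_residual_def pochhammer_rec add_ac)
  have IH: "((\<lambda>w. Gamma_residual k (w + 1)) has_field_derivative
      ((- 1) ^ k / fact k * Digamma (of_nat k + 1)) * 1) (at (- of_nat (Suc k)))"
    by (rule DERIV_chain2[of "Gamma_residual k"]) (use Suc.IH in \<open>auto intro!: derivative_eq_intros\<close>)
  have "((\<lambda>w. Gamma_residual k (w + 1) / w) has_field_derivative
     (((- 1) ^ k / fact k * Digamma (of_nat k + 1)) * (- of_nat (Suc k))
        - Gamma_residual k (- of_nat (Suc k) + 1) * 1) / ((- of_nat (Suc k)) * (- of_nat (Suc k)))) (at (- of_nat (Suc k)))"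
    by (rule DERIV_divide) (use IH in \<open>auto simp del: of_nat_Suc\<close>)
  also have "Gamma_residual k (- of_nat (Suc k) + 1) = (- 1) ^ k / fact k"
    using Gamma_residual_at_pole[of k] by simp
  also have "(((- 1) ^ k / fact k * Digamma (of_nat k + 1)) * (- of_nat (Suc k))
        - (- 1) ^ k / fact k * 1) / ((- of_nat (Suc k)) * (- of_nat (Suc k)))
      = (- 1) ^ Suc k / fact (Suc k) * (Digamma (of_nat k + 1) + 1 / of_nat (Suc k) :: complex)"
  proof -
    have "(s / f * D * (- m) - s / f * 1) / ((- m) * (- m)) = - s / (m * f) * (D + 1 / m)"
      if "m \<noteq> 0" "f \<noteq> 0" for s f D m :: complex
      using that by (simp add: field_simps)
    from this[of "of_nat (Suc k)" "fact k"] show ?thesis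
      by (simp del: of_nat_Suc)
  qed
  also have "Digamma (of_nat k + 1) + 1 / of_nat (Suc k) = (Digamma (of_nat (Suc k) + 1) :: complex)"
    using Digamma_plus1[of "of_nat (Suc k) :: complex"] by (simp add: add_ac del: of_nat_Suc) (simp add: add_ac)
  finally show ?case by (simp only: rec[abs_def])
qed

text \<open>The denominator is written with the entire function \<open>rGamma\<close>, so that poles
  can come only from the three \<open>Gamma\<close> factors.\<close>

definition linnik_kernel :: "real \<Rightarrow> real \<Rightarrow> real \<Rightarrow> complex \<Rightarrow> complex" where
  "linnik_kernel \<alpha> \<nu> n z = Gamma z * Gamma (of_real \<nu> - z)
     * Gamma ((of_real n - of_real \<alpha> * z) / 2) * rGamma (of_real \<alpha> * z / 2)"

text \<open>The quotient of the last two factors grows at most like a power j of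
  \<open>Im z\<close>; \<open>Gamma (\<nu> - z)\<close> is bounded; and the decay of
  \<open>Gamma z\<close> is used with the power j + 2, which leaves the inverse square needed for
  integrability.\<close>

lemma linnik_kernel_bound:
  assumes \<alpha>: "0 < \<alpha>" "\<alpha> < 2"
  shows "\<exists>K. \<exists>Y>0. \<forall>z. Re z \<in> {a..b} \<longrightarrow> \<bar>Im z\<bar> \<ge> Y \<longrightarrow> norm (linnik_kernel \<alpha> \<nu> n z) * (Im z)\<^sup>2 \<le> K"
proof -
  obtain K3 j where K3: "K3 > 0"
     "\<forall>z z'. Re z \<in> {(n - \<alpha> * b) / 2..(n - \<alpha> * a) / 2} \<longrightarrow> Re z' \<in> {\<alpha> * a / 2..\<alpha> * b / 2} \<longrightarrow> Im z = Im z' \<longrightarrow> \<bar>Im z\<bar> \<ge> 1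
     \<longrightarrow> norm (Gamma z) \<le> K3 * \<bar>Im z\<bar> ^ j * norm (Gamma z')"
    using Gamma_ratio_strip by metis
  obtain K1 where K1: "K1 > 0" "\<forall>z. Re z \<in> {a..b} \<longrightarrow> \<bar>Im z\<bar> \<ge> 1 \<longrightarrow> norm (Gamma z) * \<bar>Im z\<bar> ^ (j + 2) \<le> K1"
    using Gamma_decay_strip by metis
  obtain K2 where K2: "K2 > 0" "\<forall>z. Re z \<in> {\<nu> - b..\<nu> - a} \<longrightarrow> \<bar>Im z\<bar> \<ge> 1 \<longrightarrow> norm (Gamma z) * \<bar>Im z\<bar> ^ 0 \<le> K2"
    using Gamma_decay_strip by metis
  \<comment> \<open>Since Im w = \<alpha> / 2 Im z, the threshold 2 / \<alpha> ensures that the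
    imaginary part of \<open>w\<close> also has modulus at least 1.\<close>
  define Y where "Y = max 1 (2 / \<alpha>)"
  have "norm (linnik_kernel \<alpha> \<nu> n z) * (Im z)\<^sup>2 \<le> K1 * K2 * K3"
    if z: "Re z \<in> {a..b}" "\<bar>Im z\<bar> \<ge> Y" for z
  proof -
    define w where "w = of_real \<alpha> * z / 2"
    define v where "v = (of_real n - of_real \<alpha> * z) / 2"
    have y1: "\<bar>Im z\<bar> \<ge> 1" and y2: "\<bar>Im z\<bar> \<ge> 2 / \<alpha>" using z by (simp_all add: Y_def)
    have Imw: "\<bar>Im w\<bar> = \<alpha> / 2 * \<bar>Im z\<bar>" using \<alpha> by (simp add: w_def abs_mult)
    have w1: "\<bar>Im w\<bar> \<ge> 1" using y2 \<alpha> unfolding Imw by (simp add: field_simps)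
    have w2: "\<bar>Im w\<bar> \<le> \<bar>Im z\<bar>" unfolding Imw using \<alpha> mult_right_mono[of "\<alpha> / 2" 1 "\<bar>Im z\<bar>"] by simp
    have Rew: "Re w \<in> {\<alpha> * a / 2..\<alpha> * b / 2}" and Rev: "Re v \<in> {(n - \<alpha> * b) / 2..(n - \<alpha> * a) / 2}"
      using z \<alpha> by (auto simp: w_def v_def)
    have "w \<notin> \<int>\<^sub>\<le>\<^sub>0" using w1 by (auto elim!: nonpos_Ints_cases)
    then have Gw: "norm (Gamma w) * norm (rGamma w) = 1"
      by (simp add: rGamma_inverse_Gamma norm_inverse Gamma_eq_zero_iff)
    \<comment> \<open>The imaginary parts of \<open>v\<close> and \<open>w\<close> are opposite,
      while the ratio bound asks for equal ones; conjugation preserves the modulus.\<close>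
    have "norm (Gamma v) = norm (Gamma (cnj v))" by (simp flip: cnj_Gamma)
    also have "\<dots> \<le> K3 * \<bar>Im (cnj v)\<bar> ^ j * norm (Gamma w)"
      by (rule K3(2)[rule_format]) (use Rev Rew w1 in \<open>auto simp: v_def w_def\<close>)
    also have "\<bar>Im (cnj v)\<bar> = \<bar>Im w\<bar>" by (simp add: v_def w_def)
    also have "K3 * \<bar>Im w\<bar> ^ j * norm (Gamma w) \<le> K3 * \<bar>Im z\<bar> ^ j * norm (Gamma w)"
      using K3(1) w2 by (intro mult_right_mono mult_left_mono power_mono) auto
    finally have "norm (Gamma v) * norm (rGamma w) \<le> K3 * \<bar>Im z\<bar> ^ j * norm (Gamma w) * norm (rGamma w)"
      by (rule mult_right_mono) simp
    also have "\<dots> = K3 * \<bar>Im z\<bar> ^ j" using Gw by (simp add: mult.assoc)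
    finally have 3: "norm (Gamma v) * norm (rGamma w) \<le> K3 * \<bar>Im z\<bar> ^ j" .
    have 2: "norm (Gamma (of_real \<nu> - z)) \<le> K2"
      using K2(2)[rule_format, of "of_real \<nu> - z"] z y1 by auto
    have 1: "norm (Gamma z) * \<bar>Im z\<bar> ^ (j + 2) \<le> K1"
      using K1(2) z(1) y1 by blast
    have "norm (linnik_kernel \<alpha> \<nu> n z) * (Im z)\<^sup>2
        = norm (Gamma z) * (Im z)\<^sup>2 * norm (Gamma (of_real \<nu> - z)) * (norm (Gamma v) * norm (rGamma w))"
      by (simp add: linnik_kernel_def norm_mult v_def w_def)
    also have "\<dots> \<le> norm (Gamma z) * (Im z)\<^sup>2 * K2 * (K3 * \<bar>Im z\<bar> ^ j)"
      by (intro mult_mono[OF mult_left_mono[OF 2] 3]) (use K2(1) in auto)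
    also have "\<dots> = (norm (Gamma z) * \<bar>Im z\<bar> ^ (j + 2)) * (K2 * K3)"
      by (simp add: power_add power2_eq_square)
    also have "\<dots> \<le> K1 * (K2 * K3)"
      using 1 K2 K3 by (intro mult_right_mono) auto
    finally show ?thesis by (simp add: mult_ac)
  qed
  moreover have "Y > 0" by (simp add: Y_def)
  ultimately show ?thesis by blast
qed

text \<open>Here \<open>x\<close> stands for ln (r / 2); the exponential is the power (r /
  2)^(\<alpha> z - n), in a form that is visibly entire in z.\<close>

definition linnik_integrand :: "real \<Rightarrow> real \<Rightarrow> real \<Rightarrow> real \<Rightarrow> complex \<Rightarrow> complex" where
  "linnik_integrand \<alpha> \<nu> n x z = linnik_kernel \<alpha> \<nu> n z * exp ((of_real \<alpha> * z - of_real n) * of_real x)"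

section \<open>Residues at the simple poles of each family and at their common points\<close>

context
  fixes \<alpha> \<nu> n x :: real
  assumes \<alpha>: "0 < \<alpha>" "\<alpha> < 2" and \<nu>: "\<nu> > 0" and n: "n > 0"
begin

text \<open>Only \<open>Gamma (\<nu> - z)\<close> is singular here, by the hypothesis on the other
  family. Its argument decreases in z, which gives the minus sign; that sign cancels the one from
  moving the line to the right.\<close>

lemma residue_nu_pole:
  assumes "\<And>j::nat. \<nu> + real l \<noteq> (n + 2 * real j) / \<alpha>"
  shows "residue (linnik_integrand \<alpha> \<nu> n x) (of_real (\<nu> + real l)) = - of_real ((- 1) ^ l / fact l * Gamma (\<nu> + real l)
     * (Gamma ((n - \<alpha> * (\<nu> + real l)) / 2) / Gamma (\<alpha> * (\<nu> + real l) / 2)) * exp ((\<alpha> * (\<nu> + real l) - n) * x))"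
proof -
  define w0 where "w0 = \<nu> + real l"
  have w0: "w0 > 0" using \<nu> by (simp add: w0_def add_pos_nonneg)
  \<comment> \<open>The ball keeps \<open>\<nu> - z\<close> near a single pole of
    \<open>Gamma\<close>; the condition on \<open>rGamma\<close> removes the poles of the other
    factor, an open condition by continuity.\<close>
  define U where "U = {z. Re z > 0} \<inter> ball (of_real w0) 1 \<inter> {z. rGamma ((of_real n - of_real \<alpha> * z) / 2) \<noteq> 0}"
  have U: "open U"
    unfolding U_def
    by (intro open_Int open_halfspace_Re_gt open_ball open_Collect_neq continuous_intros
      continuous_on_compose2[OF continuous_on_rGamma[of UNIV]]) auto
  have nn: "(complex_of_real n - of_real \<alpha> * of_real w0) / 2 \<notin> \<int>\<^sub>\<le>\<^sub>0"
  proof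
    assume "(complex_of_real n - of_real \<alpha> * of_real w0) / 2 \<in> \<int>\<^sub>\<le>\<^sub>0"
    then obtain j :: nat where "(complex_of_real n - of_real \<alpha> * of_real w0) / 2 = - of_nat j"
      by (auto elim!: nonpos_Ints_cases')
    then have "complex_of_real ((n - \<alpha> * w0) / 2) = complex_of_real (- real j)" by simp
    then have "(n - \<alpha> * w0) / 2 = - real j" by (simp only: of_real_eq_iff)
    then have "w0 = (n + 2 * real j) / \<alpha>" using \<alpha> by (simp add: field_simps)
    then show False using assms[of j] by (simp add: w0_def)
  qed
  have wU: "of_real w0 \<in> U"
    using w0 nn by (simp add: U_def rGamma_eq_zero_iff)
  define h where "h z = - (Gamma z * Gamma_residual l (of_real \<nu> - z) * Gamma ((of_real n - of_real \<alpha> * z) / 2)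
     * rGamma (of_real \<alpha> * z / 2) * exp ((of_real \<alpha> * z - of_real n) * of_real x))" for z
  have near: "norm (of_real \<nu> - z + of_nat l) < 1" if "z \<in> U" for z
    using that by (simp add: U_def w0_def dist_norm algebra_simps)
  have pos: "z \<notin> \<int>\<^sub>\<le>\<^sub>0" if "z \<in> U" for z
    using that by (intro Re_pos_not_nonpos_Int) (simp add: U_def)
  have nz: "(of_real n - of_real \<alpha> * z) / 2 \<notin> \<int>\<^sub>\<le>\<^sub>0" if "z \<in> U" for z
    using that by (simp add: U_def rGamma_eq_zero_iff)
  have "h holomorphic_on U"
    unfolding h_def
    by (intro holomorphic_intros Gamma_residual_holomorphic)
       (erule near | erule pos | erule nz | simp)+
  then have "residue (\<lambda>z. h z / (z - of_real w0)) (of_real w0) = h (of_real w0)"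
    by (rule residue_simple[OF U wU])
  moreover have "residue (linnik_integrand \<alpha> \<nu> n x) (of_real w0) = residue (\<lambda>z. h z / (z - of_real w0)) (of_real w0)"
  proof (rule residue_cong)
    have "eventually (\<lambda>z. z \<in> U - {of_real w0}) (at (of_real w0))"
      using eventually_at_in_open[OF U wU] .
    then show "\<forall>\<^sub>F z in at (of_real w0). linnik_integrand \<alpha> \<nu> n x z = h z / (z - of_real w0)"
    proof eventually_elim
      case (elim z)
      have "of_real \<nu> - z + of_nat l = - (z - of_real w0)" by (simp add: w0_def)
      moreover have "of_real \<nu> - z \<noteq> - of_nat l" using elim by (auto simp: w0_def algebra_simps)
      ultimately have "Gamma (of_real \<nu> - z) = Gamma_residual l (of_real \<nu> - z) / (- (z - of_real w0))"
        using Gamma_eq_residual[OF near] elim by (metis DiffD1)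
      moreover have "G * (A / (- d)) * B * R * E = - (G * A * B * R * E) / d" for G A B R E d :: complex
        by (simp add: divide_inverse)
      ultimately show ?case by (simp only: linnik_integrand_def linnik_kernel_def h_def)
    qed
  qed simp
  ultimately have "residue (linnik_integrand \<alpha> \<nu> n x) (of_real w0) = h (of_real w0)" by simp
  also have "\<dots> = - (of_real (Gamma w0) * of_real ((- 1) ^ l / fact l) * of_real (Gamma ((n - \<alpha> * w0) / 2))
      * of_real (1 / Gamma (\<alpha> * w0 / 2)) * of_real (exp ((\<alpha> * w0 - n) * x)))"
  proof -
    have "Gamma_residual l (of_real \<nu> - of_real w0) = of_real ((- 1) ^ l / fact l)"
      using Gamma_residual_at_pole[of l] by (simp add: w0_def)
    moreover have "Gamma ((of_real n - of_real \<alpha> * of_real w0) / 2) = complex_of_real (Gamma ((n - \<alpha> * w0) / 2))"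
      by (simp flip: Gamma_complex_of_real)
    moreover have "exp ((of_real \<alpha> * of_real w0 - of_real n) * of_real x) = complex_of_real (exp ((\<alpha> * w0 - n) * x))"
      by (simp flip: exp_of_real)
    moreover have "rGamma (of_real \<alpha> * of_real w0 / 2) = complex_of_real (1 / Gamma (\<alpha> * w0 / 2))"
      by (simp add: rGamma_inverse_Gamma inverse_eq_divide flip: Gamma_complex_of_real)
    ultimately show ?thesis by (simp only: h_def Gamma_complex_of_real)
  qed
  also have "\<dots> = - of_real ((- 1) ^ l / fact l * Gamma w0
     * (Gamma ((n - \<alpha> * w0) / 2) / Gamma (\<alpha> * w0 / 2)) * exp ((\<alpha> * w0 - n) * x))"
  proof -
    have "Gw * s * G * (1 / H) * e = s * Gw * (G / H) * e" for Gw s G H e :: real by simp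
    then show ?thesis by (simp only: of_real_mult[symmetric])
  qed
  finally show ?thesis unfolding w0_def .
qed

text \<open>Near this point (n - \<alpha> z) / 2 + j equals - (\<alpha> / 2) (z - w0). The slope is
  the origin of the minus sign and of the factor 2 / \<alpha> before the second sum.\<close>

lemma residue_n_pole:
  assumes "\<And>l::nat. (n + 2 * real j) / \<alpha> \<noteq> \<nu> + real l"
  shows "residue (linnik_integrand \<alpha> \<nu> n x) (of_real ((n + 2 * real j) / \<alpha>)) = - of_real (2 / \<alpha> * ((- 1) ^ j / fact j
     * (Gamma ((n + 2 * real j) / \<alpha>) / Gamma ((n + 2 * real j) / 2)) * Gamma (\<nu> - (n + 2 * real j) / \<alpha>) * exp (2 * real j * x)))"
proof -
  define w0 where "w0 = (n + 2 * real j) / \<alpha>"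
  have w0: "w0 > 0" using n \<alpha> by (simp add: w0_def add_pos_nonneg)
  have aw0: "\<alpha> * w0 = n + 2 * real j" using \<alpha> by (simp add: w0_def)
  then have aw0': "of_real \<alpha> * complex_of_real w0 = of_real n + 2 * of_nat j"
    by (metis of_real_mult of_real_add of_real_of_nat_eq of_real_numeral)
  define U where "U = {z. Re z > 0} \<inter> ball (of_real w0) 1 \<inter> {z. rGamma (of_real \<nu> - z) \<noteq> 0}"
  have U: "open U"
    unfolding U_def
    by (intro open_Int open_halfspace_Re_gt open_ball open_Collect_neq continuous_intros
      continuous_on_compose2[OF continuous_on_rGamma[of UNIV]]) auto
  have nn: "complex_of_real \<nu> - of_real w0 \<notin> \<int>\<^sub>\<le>\<^sub>0"
  proof
    assume "complex_of_real \<nu> - of_real w0 \<in> \<int>\<^sub>\<le>\<^sub>0"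
    then obtain l :: nat where "complex_of_real \<nu> - of_real w0 = - of_nat l"
      by (auto elim!: nonpos_Ints_cases')
    then have "complex_of_real (\<nu> - w0) = complex_of_real (- real l)" by simp
    then have "\<nu> - w0 = - real l" by (simp only: of_real_eq_iff)
    then show False using assms[of l] by (simp add: w0_def)
  qed
  have wU: "of_real w0 \<in> U"
    using w0 nn by (simp add: U_def rGamma_eq_zero_iff)
  define h where "h z = - (2 / of_real \<alpha>) * (Gamma z * Gamma (of_real \<nu> - z) * Gamma_residual j ((of_real n - of_real \<alpha> * z) / 2)
     * rGamma (of_real \<alpha> * z / 2) * exp ((of_real \<alpha> * z - of_real n) * of_real x))" for z
  have shift: "(of_real n - of_real \<alpha> * z) / 2 + of_nat j = - (of_real \<alpha> / 2) * (z - complex_of_real w0)" for z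
    using aw0' by (simp add: field_simps)
  have near: "norm ((of_real n - of_real \<alpha> * z) / 2 + of_nat j) < 1" if "z \<in> U" for z
  proof -
    have "norm (z - of_real w0) < 1" using that by (simp add: U_def dist_norm norm_minus_commute)
    \<comment> \<open>Because \<alpha> / 2 < 1, the unit ball around \<open>w0\<close> is mapped
      into the unit disc around -j.\<close>
    then have "\<alpha> / 2 * norm (z - of_real w0) < 1 * 1" using \<alpha> by (intro mult_strict_mono) auto
    then show ?thesis unfolding shift using \<alpha> by (simp add: norm_mult)
  qed
  have pos: "z \<notin> \<int>\<^sub>\<le>\<^sub>0" if "z \<in> U" for z
    using that by (intro Re_pos_not_nonpos_Int) (simp add: U_def)
  have nz: "of_real \<nu> - z \<notin> \<int>\<^sub>\<le>\<^sub>0" if "z \<in> U" for z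
    using that by (simp add: U_def rGamma_eq_zero_iff)
  have "h holomorphic_on U"
    unfolding h_def
    by (intro holomorphic_intros Gamma_residual_holomorphic)
       (erule near | erule pos | erule nz | simp)+
  then have "residue (\<lambda>z. h z / (z - of_real w0)) (of_real w0) = h (of_real w0)"
    by (rule residue_simple[OF U wU])
  moreover have "residue (linnik_integrand \<alpha> \<nu> n x) (of_real w0) = residue (\<lambda>z. h z / (z - of_real w0)) (of_real w0)"
  proof (rule residue_cong)
    have "eventually (\<lambda>z. z \<in> U - {of_real w0}) (at (of_real w0))"
      using eventually_at_in_open[OF U wU] .
    then show "\<forall>\<^sub>F z in at (of_real w0). linnik_integrand \<alpha> \<nu> n x z = h z / (z - of_real w0)"
    proof eventually_elim
      case (elim z)
      have "(of_real n - of_real \<alpha> * z) / 2 + of_nat j \<noteq> 0" unfolding shift using elim \<alpha> by auto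
      then have "(of_real n - of_real \<alpha> * z) / 2 \<noteq> - of_nat j" by (metis add.left_inverse)
      then have "Gamma ((of_real n - of_real \<alpha> * z) / 2)
          = Gamma_residual j ((of_real n - of_real \<alpha> * z) / 2) / (- (of_real \<alpha> / 2) * (z - of_real w0))"
        using Gamma_eq_residual[OF near] elim unfolding shift by (metis DiffD1)
      moreover have "G * B * (A / (- (a / 2) * d)) * R * E = - (2 / a) * (G * B * A * R * E) / d" for G A B R E d a :: complex
        by (cases "a = 0"; cases "d = 0") (simp_all add: field_simps)
      ultimately show ?case by (simp only: linnik_integrand_def linnik_kernel_def h_def)
    qed
  qed simp
  ultimately have "residue (linnik_integrand \<alpha> \<nu> n x) (of_real w0) = h (of_real w0)" by simp
  also have "\<dots> = - of_real (2 / \<alpha>) * (of_real (Gamma w0) * of_real (Gamma (\<nu> - w0)) * of_real ((- 1) ^ j / fact j)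
      * of_real (1 / Gamma ((n + 2 * real j) / 2)) * of_real (exp (2 * real j * x)))"
  proof -
    have "(of_real n - of_real \<alpha> * complex_of_real w0) / 2 = - of_nat j" by (simp add: aw0')
    then have "Gamma_residual j ((of_real n - of_real \<alpha> * of_real w0) / 2) = of_real ((- 1) ^ j / fact j)"
      using Gamma_residual_at_pole[of j] by simp
    moreover have "Gamma (of_real \<nu> - of_real w0) = complex_of_real (Gamma (\<nu> - w0))"
      by (simp flip: Gamma_complex_of_real)
    moreover have "exp ((of_real \<alpha> * of_real w0 - of_real n) * of_real x) = complex_of_real (exp (2 * real j * x))"
      unfolding aw0' by (simp flip: exp_of_real)
    moreover have "rGamma (of_real \<alpha> * of_real w0 / 2) = complex_of_real (1 / Gamma ((n + 2 * real j) / 2))"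
      unfolding aw0' by (simp add: rGamma_inverse_Gamma inverse_eq_divide flip: Gamma_complex_of_real)
    moreover have "- (2 / complex_of_real \<alpha>) = - of_real (2 / \<alpha>)" by simp
    ultimately show ?thesis by (simp only: h_def Gamma_complex_of_real)
  qed
  also have "\<dots> = - of_real (2 / \<alpha> * ((- 1) ^ j / fact j
     * (Gamma w0 / Gamma ((n + 2 * real j) / 2)) * Gamma (\<nu> - w0) * exp (2 * real j * x)))"
  proof -
    have "- c * (Gw * G * s * (1 / H) * e) = - (c * (s * (Gw / H) * G * e))" for c Gw s G H e :: real by simp
    then show ?thesis by (simp only: of_real_mult[symmetric] of_real_minus[symmetric])
  qed
  finally show ?thesis unfolding w0_def .
qed

text \<open>Two singular factors give \<open>h z / (z - w0)^2\<close>, so the residue is the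
  derivative of \<open>h\<close>, computed as \<open>h\<close> times its logarithmic derivative: one
  digamma value for each Gamma factor, and \<alpha> x from the exponential. The two minus signs of
  the simple factors cancel, which is why the third sum enters the expansion with the opposite
  sign.\<close>

lemma residue_double_pole:
  assumes lj: "\<nu> + real l = (n + 2 * real j) / \<alpha>"
  defines "w0 \<equiv> \<nu> + real l"
  shows "residue (linnik_integrand \<alpha> \<nu> n x) (of_real w0) = of_real ((- 1) ^ (l + j) / (fact l * fact j) * (Gamma w0 / Gamma (\<alpha> * w0 / 2))
     * (2 / \<alpha> * Digamma w0 - 2 / \<alpha> * Digamma (real l + 1) - Digamma (\<alpha> * w0 / 2) - Digamma (real j + 1) + 2 * x)
     * exp ((\<alpha> * w0 - n) * x))"
proof -
  have w0: "w0 > 0" using \<nu> by (simp add: w0_def add_pos_nonneg)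
  have aw0: "\<alpha> * w0 = n + 2 * real j" using \<alpha> lj by (simp add: w0_def)
  then have aw0': "of_real \<alpha> * complex_of_real w0 = of_real n + 2 * of_nat j"
    by (metis of_real_mult of_real_add of_real_of_nat_eq of_real_numeral)
  define U where "U = {z. Re z > 0} \<inter> ball (complex_of_real w0) 1"
  have U: "open U"
    unfolding U_def by (intro open_Int open_halfspace_Re_gt open_ball)
  have wU: "of_real w0 \<in> U"
    using w0 by (simp add: U_def)
  define E where "E z = exp ((of_real \<alpha> * z - of_real n) * complex_of_real x)" for z
  define h where "h z = 2 / of_real \<alpha> * (Gamma z * Gamma_residual l (of_real \<nu> - z) * Gamma_residual j ((of_real n - of_real \<alpha> * z) / 2)
     * rGamma (of_real \<alpha> * z / 2) * E z)" for z
  have shift: "(of_real n - of_real \<alpha> * z) / 2 + of_nat j = - (of_real \<alpha> / 2) * (z - complex_of_real w0)" for z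
    using aw0' by (simp add: field_simps)
  have near2: "norm ((of_real n - of_real \<alpha> * z) / 2 + of_nat j) < 1" if "z \<in> U" for z
  proof -
    have "norm (z - of_real w0) < 1" using that by (simp add: U_def dist_norm norm_minus_commute)
    then have "\<alpha> / 2 * norm (z - of_real w0) < 1 * 1" using \<alpha> by (intro mult_strict_mono) auto
    then show ?thesis unfolding shift using \<alpha> by (simp add: norm_mult)
  qed
  have near1: "norm (of_real \<nu> - z + of_nat l) < 1" if "z \<in> U" for z
    using that by (simp add: U_def w0_def dist_norm algebra_simps)
  have pos: "z \<notin> \<int>\<^sub>\<le>\<^sub>0" if "z \<in> U" for z
    using that by (intro Re_pos_not_nonpos_Int) (simp add: U_def)
  have "h holomorphic_on U"
    unfolding h_def E_def
    by (intro holomorphic_intros Gamma_residual_holomorphic) (erule near1 | erule near2 | erule pos | simp add: \<alpha>)+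
  then have "residue (\<lambda>z. h z / (z - of_real w0) ^ Suc 1) (of_real w0) = (deriv ^^ 1) h (of_real w0) / fact 1"
    by (rule residue_holomorphic_over_power[OF U wU])
  moreover have "residue (linnik_integrand \<alpha> \<nu> n x) (of_real w0) = residue (\<lambda>z. h z / (z - of_real w0) ^ Suc 1) (of_real w0)"
  proof (rule residue_cong)
    have "eventually (\<lambda>z. z \<in> U - {of_real w0}) (at (of_real w0))"
      using eventually_at_in_open[OF U wU] .
    then show "\<forall>\<^sub>F z in at (of_real w0). linnik_integrand \<alpha> \<nu> n x z = h z / (z - of_real w0) ^ Suc 1"
    proof eventually_elim
      case (elim z)
      have "of_real \<nu> - z + of_nat l = - (z - of_real w0)" by (simp add: w0_def)
      moreover have "of_real \<nu> - z \<noteq> - of_nat l" using elim by (auto simp: w0_def algebra_simps)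
      ultimately have 1: "Gamma (of_real \<nu> - z) = Gamma_residual l (of_real \<nu> - z) / (- (z - of_real w0))"
        using Gamma_eq_residual[OF near1] elim by (metis DiffD1)
      have "(of_real n - of_real \<alpha> * z) / 2 + of_nat j \<noteq> 0" unfolding shift using elim \<alpha> by auto
      then have "(of_real n - of_real \<alpha> * z) / 2 \<noteq> - of_nat j" by (metis add.left_inverse)
      then have "Gamma ((of_real n - of_real \<alpha> * z) / 2)
          = Gamma_residual j ((of_real n - of_real \<alpha> * z) / 2) / (- (of_real \<alpha> / 2) * (z - of_real w0))"
        using Gamma_eq_residual[OF near2] elim unfolding shift by (metis DiffD1)
      moreover have "G * (A / (- d)) * (B / (- (a / 2) * d)) * R * E = 2 / a * (G * A * B * R * E) / d ^ Suc 1" for G A B R E d a :: complex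
        by (cases "a = 0"; cases "d = 0") (simp_all add: field_simps)
      ultimately show ?case by (simp only: linnik_integrand_def linnik_kernel_def h_def E_def 1)
    qed
  qed simp
  ultimately have resF: "residue (linnik_integrand \<alpha> \<nu> n x) (of_real w0) = deriv h (of_real w0)" by simp
  have "(h has_field_derivative
      2 / of_real \<alpha> * ((- 1) ^ l / fact l * ((- 1) ^ j / fact j) * Gamma (of_real w0) * rGamma (of_real \<alpha> * of_real w0 / 2) * E (of_real w0))
      * (Digamma (of_real w0) - Digamma (of_nat l + 1) - of_real \<alpha> / 2 * Digamma (of_nat j + 1)
          - of_real \<alpha> / 2 * Digamma (of_real \<alpha> * of_real w0 / 2) + of_real \<alpha> * of_real x)) (at (of_real w0))"
  proof -
    let ?w = "complex_of_real w0"
    have e1: "of_real \<nu> - ?w = - of_nat l" by (simp add: w0_def)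
    have e2: "(of_real n - of_real \<alpha> * ?w) / 2 = - of_nat j" by (simp add: aw0')
    have ni: "?w \<notin> \<int>\<^sub>\<le>\<^sub>0" "of_real \<alpha> * ?w / 2 \<notin> \<int>\<^sub>\<le>\<^sub>0"
      using w0 \<alpha> by (auto intro!: Re_pos_not_nonpos_Int mult_pos_pos)
    have d1: "((\<lambda>z. Gamma_residual l (of_real \<nu> - z)) has_field_derivative ((- 1) ^ l / fact l * Digamma (of_nat l + 1)) * (- 1)) (at ?w)"
      by (rule DERIV_chain2[of "Gamma_residual l"]) (use Gamma_residual_deriv[of l] in \<open>auto simp: e1 intro!: derivative_eq_intros\<close>)
    have d2: "((\<lambda>z. Gamma_residual j ((of_real n - of_real \<alpha> * z) / 2)) has_field_derivative
        ((- 1) ^ j / fact j * Digamma (of_nat j + 1)) * (- of_real \<alpha> / 2)) (at ?w)"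
      by (rule DERIV_chain2[of "Gamma_residual j"]) (use Gamma_residual_deriv[of j] in \<open>auto simp: e2 intro!: derivative_eq_intros\<close>)
    have d3: "(Gamma has_field_derivative Gamma ?w * Digamma ?w) (at ?w)"
      by (rule has_field_derivative_Gamma[OF ni(1)])
    have d4: "((\<lambda>z. rGamma (of_real \<alpha> * z / 2)) has_field_derivative
        (- rGamma (of_real \<alpha> * ?w / 2) * Digamma (of_real \<alpha> * ?w / 2)) * (of_real \<alpha> / 2)) (at ?w)"
      by (rule DERIV_chain2[of rGamma]) (use ni(2) in \<open>auto intro!: derivative_eq_intros\<close>)
    have d5: "(E has_field_derivative E ?w * (of_real \<alpha> * of_real x)) (at ?w)"
      unfolding E_def by (auto intro!: derivative_eq_intros)
    have v: "Gamma_residual l (of_real \<nu> - ?w) = (- 1) ^ l / fact l"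
       "Gamma_residual j ((of_real n - of_real \<alpha> * ?w) / 2) = (- 1) ^ j / fact j"
      unfolding e1 e2 by (rule Gamma_residual_at_pole)+
    \<comment> \<open>The left side is literally what the nested product rule yields; the right side
      factors out the common product and leaves the logarithmic derivative.\<close>
    have alg: "c * ((((G * D0 * a + a * La * (- 1) * G) * b + b * Lb * (- k / 2) * (G * a)) * R
          + - R * Dr * (k / 2) * (G * a * b)) * e + e * (k * y) * (G * a * b * R))
        = c * (a * b * G * R * e) * (D0 - La - k / 2 * Lb - k / 2 * Dr + k * y)"
      for c G D0 a La b Lb k R Dr e y :: complex
      by (simp add: field_simps)
    show ?thesis
      unfolding h_def
      using DERIV_cmult[OF DERIV_mult[OF DERIV_mult[OF DERIV_mult[OF DERIV_mult[OF d3 d1] d2] d4] d5], of "2 / of_real \<alpha>"]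
      unfolding v alg .
  qed
  then have "deriv h (of_real w0) = 
      2 / of_real \<alpha> * ((- 1) ^ l / fact l * ((- 1) ^ j / fact j) * Gamma (of_real w0) * rGamma (of_real \<alpha> * of_real w0 / 2) * E (of_real w0))
      * (Digamma (of_real w0) - Digamma (of_nat l + 1) - of_real \<alpha> / 2 * Digamma (of_nat j + 1)
          - of_real \<alpha> / 2 * Digamma (of_real \<alpha> * of_real w0 / 2) + of_real \<alpha> * of_real x)"
    by (rule DERIV_imp_deriv)
  also have "\<dots> = of_real (2 / \<alpha> * ((- 1) ^ l / fact l * ((- 1) ^ j / fact j) * Gamma w0 * (1 / Gamma (\<alpha> * w0 / 2)) * exp ((\<alpha> * w0 - n) * x))
      * (Digamma w0 - Digamma (real l + 1) - \<alpha> / 2 * Digamma (real j + 1)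
          - \<alpha> / 2 * Digamma (\<alpha> * w0 / 2) + \<alpha> * x))"
  proof -
    have c1: "complex_of_real (Digamma w0) = Digamma (of_real w0)"
      "complex_of_real (Digamma (\<alpha> * w0 / 2)) = Digamma (of_real \<alpha> * of_real w0 / 2)"
      "complex_of_real (Digamma (real l + 1)) = Digamma (of_nat l + 1)"
      "complex_of_real (Digamma (real j + 1)) = Digamma (of_nat j + 1)"
      using w0 \<alpha> Polygamma_of_real[of w0 0, where 'a=complex] Polygamma_of_real[of "\<alpha> * w0 / 2" 0, where 'a=complex]
        Polygamma_of_real[of "real l + 1" 0, where 'a=complex] Polygamma_of_real[of "real j + 1" 0, where 'a=complex]
      by auto
    have c2: "complex_of_real (exp ((\<alpha> * w0 - n) * x)) = E (of_real w0)"
      by (simp add: E_def flip: exp_of_real)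
    have c3: "complex_of_real (1 / Gamma (\<alpha> * w0 / 2)) = rGamma (of_real \<alpha> * of_real w0 / 2)"
      by (simp add: rGamma_inverse_Gamma inverse_eq_divide flip: Gamma_complex_of_real)
    have c4: "complex_of_real ((- 1) ^ k / fact k) = (- 1) ^ k / fact k" for k by simp
    have c5: "complex_of_real (2 / \<alpha>) = 2 / of_real \<alpha>" "complex_of_real (\<alpha> / 2) = of_real \<alpha> / 2" by simp_all
    show ?thesis
      by (simp only: of_real_mult of_real_add of_real_diff Gamma_complex_of_real c1 c2 c3 c4 c5)
  qed
  also have "2 / \<alpha> * ((- 1) ^ l / fact l * ((- 1) ^ j / fact j) * Gamma w0 * (1 / Gamma (\<alpha> * w0 / 2)) * exp ((\<alpha> * w0 - n) * x))
      * (Digamma w0 - Digamma (real l + 1) - \<alpha> / 2 * Digamma (real j + 1)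
          - \<alpha> / 2 * Digamma (\<alpha> * w0 / 2) + \<alpha> * x)
     = (- 1) ^ (l + j) / (fact l * fact j) * (Gamma w0 / Gamma (\<alpha> * w0 / 2))
     * (2 / \<alpha> * Digamma w0 - 2 / \<alpha> * Digamma (real l + 1) - Digamma (\<alpha> * w0 / 2) - Digamma (real j + 1) + 2 * x)
     * exp ((\<alpha> * w0 - n) * x)"
  proof -
    have "2 / \<alpha> * (A * B * G * (1 / H) * e) * (D1 - D2 - \<alpha> / 2 * D3 - \<alpha> / 2 * D4 + \<alpha> * x)
       = A * B * (G / H) * (2 / \<alpha> * D1 - 2 / \<alpha> * D2 - D4 - D3 + 2 * x) * e" for A B G H e D1 D2 D3 D4
    proof -
      have "D1 - D2 - \<alpha> / 2 * D3 - \<alpha> / 2 * D4 + \<alpha> * x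
          = \<alpha> / 2 * (2 / \<alpha> * D1 - 2 / \<alpha> * D2 - D4 - D3 + 2 * x)"
        using \<alpha> by (simp add: field_simps)
      moreover have "2 / \<alpha> * P * (\<alpha> / 2 * Q) = P * Q" for P Q
        using \<alpha> by simp
      ultimately have "2 / \<alpha> * (A * B * G * (1 / H) * e) * (D1 - D2 - \<alpha> / 2 * D3 - \<alpha> / 2 * D4 + \<alpha> * x)
          = A * B * G * (1 / H) * e * (2 / \<alpha> * D1 - 2 / \<alpha> * D2 - D4 - D3 + 2 * x)"
        by (simp only:)
      then show ?thesis by (simp add: mult_ac)
    qed
    from this[of "(- 1) ^ l / fact l" "(- 1) ^ j / fact j"]
    show ?thesis by (simp add: power_add)
  qed
  finally show ?thesis unfolding resF .
qed

end

subsection \<open>The contour integral of the radial density\<close>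

lemma norm_linnik_integrand:
  "norm (linnik_integrand \<alpha> \<nu> n x z) = norm (linnik_kernel \<alpha> \<nu> n z) * exp ((\<alpha> * Re z - n) * x)"
  by (simp add: linnik_integrand_def norm_mult)

text \<open>The new line of integration has to lie to the right of the poles \<open>(n + 2 j) / \<alpha> \<le> \<nu> + N - 1/2\<close>
  counted by the second sum, but to the left of all later poles.\<close>

lemma ex_contour_abscissa:
  fixes \<alpha> n M M' :: real
  assumes \<alpha>: "\<alpha> > 0" and M: "M < M'"
  obtains c1 u where "M < c1" "c1 < u" "u \<le> M'" "\<And>j::nat. (n + 2 * real j) / \<alpha> \<le> M \<or> u \<le> (n + 2 * real j) / \<alpha>"
proof -
  define j0 where "j0 = (LEAST j::nat. (n + 2 * real j) / \<alpha> > M)"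
  obtain k :: nat where "real k > \<bar>M * \<alpha>\<bar> + \<bar>n\<bar>" using reals_Archimedean2 by blast
  then have "(n + 2 * real k) / \<alpha> > M" using \<alpha> by (simp add: field_simps)
  then have j0: "(n + 2 * real j0) / \<alpha> > M" unfolding j0_def by (rule LeastI)
  \<comment> \<open>\<open>j0\<close> indexes the first pole of the family beyond \<open>M\<close>.
    \<open>M'\<close> will be \<nu> + N, the first pole of the other family beyond the
    cut-off.\<close>
  define u where "u = min M' ((n + 2 * real j0) / \<alpha>)"
  have u: "M < u" using M j0 by (simp add: u_def)
  show ?thesis
  proof (rule that)
    show "M < (M + u) / 2" "(M + u) / 2 < u" using u by simp_all
    show "u \<le> M'" by (simp add: u_def)
    fix j :: nat
    show "(n + 2 * real j) / \<alpha> \<le> M \<or> u \<le> (n + 2 * real j) / \<alpha>"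
    proof (cases "j < j0")
      case True
      then show ?thesis using not_less_Least[OF True[unfolded j0_def]] by auto
    next
      case False
      then have "(n + 2 * real j0) / \<alpha> \<le> (n + 2 * real j) / \<alpha>"
        using \<alpha> by (intro divide_right_mono) auto
      then show ?thesis by (auto simp: u_def)
    qed
  qed
qed

lemma finite_n_poles:
  assumes "\<alpha> > 0"
  shows "finite {j::nat. (n + 2 * real j) / \<alpha> \<le> M}"
proof (rule finite_subset)
  show "{j::nat. (n + 2 * real j) / \<alpha> \<le> M} \<subseteq> {..nat \<lceil>(\<bar>M * \<alpha>\<bar> + \<bar>n\<bar>)\<rceil>}"
  proof
    fix j assume "j \<in> {j::nat. (n + 2 * real j) / \<alpha> \<le> M}"
    then have "real j \<le> \<bar>M * \<alpha>\<bar> + \<bar>n\<bar>" using assms by (simp add: field_simps)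
    then show "j \<in> {..nat \<lceil>(\<bar>M * \<alpha>\<bar> + \<bar>n\<bar>)\<rceil>}" by (simp add: le_nat_iff le_ceiling_iff)
  qed
qed simp

text \<open>No singularity with 0 < Re z < u lies outside \<open>P\<close>: the bound u \<le> \<nu>
  + N excludes \<nu> + l with l \<ge> N, \<open>gap\<close> excludes the later poles of the other
  family, and those of \<open>Gamma z\<close> have Re z \<le> 0. As \<open>P\<close> is a set, a
  common pole is counted once.\<close>

lemma linnik_integrand_shift:
  fixes \<alpha> \<nu> n x c0 c1 u :: real and N :: nat
  assumes \<alpha>: "0 < \<alpha>" "\<alpha> < 2" and \<nu>: "\<nu> > 0" and n: "n > 0"
    and c0: "0 < c0" "c0 < \<nu>" "\<alpha> * c0 < n"
    and c1: "\<nu> + real N - 1/2 < c1" "c1 < u" "u \<le> \<nu> + real N" and N: "N \<ge> 1"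
    and gap: "\<And>j::nat. (n + 2 * real j) / \<alpha> \<le> \<nu> + real N - 1/2 \<or> u \<le> (n + 2 * real j) / \<alpha>"
  defines "P \<equiv> (\<lambda>l. \<nu> + real l) ` {..<N} \<union> (\<lambda>j. (n + 2 * real j) / \<alpha>) ` {j. (n + 2 * real j) / \<alpha> \<le> \<nu> + real N - 1/2}"
  defines "F \<equiv> linnik_integrand \<alpha> \<nu> n x"
  shows "integrable lborel (\<lambda>y. F (Complex c0 y))" and "integrable lborel (\<lambda>y. F (Complex c1 y))"
    and "(\<integral>y. F (Complex c0 y) \<partial>lborel) = (\<integral>y. F (Complex c1 y) \<partial>lborel) - 2 * pi * (\<Sum>w\<in>P. residue F (of_real w))"
proof -
  have c01: "c0 < c1" using c0 c1 N by linarith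
  have fin: "finite P" unfolding P_def using \<alpha> finite_n_poles by auto
  obtain K Y where Y: "Y > 0" and K: "\<forall>z. Re z \<in> {c0..c1} \<longrightarrow> \<bar>Im z\<bar> \<ge> Y \<longrightarrow> norm (linnik_kernel \<alpha> \<nu> n z) * (Im z)\<^sup>2 \<le> K"
    using linnik_kernel_bound[OF \<alpha>] by metis
  \<comment> \<open>\<open>x\<close> is fixed, so the exponential is bounded on the strip and the
    decay of the kernel carries over with a constant depending on \<open>x\<close>.\<close>
  define L where "L = K * exp ((\<bar>\<alpha> * c1\<bar> + \<bar>n\<bar>) * \<bar>x\<bar>)"
  have bound: "norm (F z) * (Im z)\<^sup>2 \<le> L" if z: "Re z \<in> {c0..c1}" "\<bar>Im z\<bar> \<ge> Y" for z
  proof -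
    have "(\<alpha> * Re z - n) * x \<le> \<bar>\<alpha> * Re z - n\<bar> * \<bar>x\<bar>"
      by (metis abs_ge_self abs_mult)
    also have "\<dots> \<le> (\<bar>\<alpha> * c1\<bar> + \<bar>n\<bar>) * \<bar>x\<bar>"
    proof (rule mult_right_mono)
      have "\<bar>\<alpha> * Re z\<bar> \<le> \<bar>\<alpha> * c1\<bar>" using z c0 \<alpha> by (simp add: abs_mult mult_left_mono)
      then show "\<bar>\<alpha> * Re z - n\<bar> \<le> \<bar>\<alpha> * c1\<bar> + \<bar>n\<bar>" by linarith
    qed simp
    finally have e: "exp ((\<alpha> * Re z - n) * x) \<le> exp ((\<bar>\<alpha> * c1\<bar> + \<bar>n\<bar>) * \<bar>x\<bar>)" by simp
    have k: "norm (linnik_kernel \<alpha> \<nu> n z) * (Im z)\<^sup>2 \<le> K" using K z by blast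
    then have K0: "K \<ge> 0" by (rule order_trans[rotated]) simp
    have "norm (F z) * (Im z)\<^sup>2 = (norm (linnik_kernel \<alpha> \<nu> n z) * (Im z)\<^sup>2) * exp ((\<alpha> * Re z - n) * x)"
      by (simp add: F_def norm_linnik_integrand)
    also have "\<dots> \<le> L" unfolding L_def by (rule mult_mono[OF k e K0]) simp
    finally show ?thesis .
  qed
  have nonpole: "z \<notin> \<int>\<^sub>\<le>\<^sub>0" "of_real \<nu> - z \<notin> \<int>\<^sub>\<le>\<^sub>0" "(of_real n - of_real \<alpha> * z) / 2 \<notin> \<int>\<^sub>\<le>\<^sub>0"
    if z: "z \<in> {z. 0 < Re z \<and> Re z < u} - of_real ` P" for z
  proof -
    show "z \<notin> \<int>\<^sub>\<le>\<^sub>0" using z by (intro Re_pos_not_nonpos_Int) simp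
    show "of_real \<nu> - z \<notin> \<int>\<^sub>\<le>\<^sub>0"
    proof
      assume "of_real \<nu> - z \<in> \<int>\<^sub>\<le>\<^sub>0"
      then obtain l :: nat where "of_real \<nu> - z = - of_nat l" by (auto elim!: nonpos_Ints_cases')
      then have zl: "z = of_real (\<nu> + real l)" by (simp add: algebra_simps)
      then have "real l < real N" using z c1 by simp
      then have "\<nu> + real l \<in> P" by (auto simp: P_def)
      then show False using z zl by blast
    qed
    show "(of_real n - of_real \<alpha> * z) / 2 \<notin> \<int>\<^sub>\<le>\<^sub>0"
    proof
      assume "(of_real n - of_real \<alpha> * z) / 2 \<in> \<int>\<^sub>\<le>\<^sub>0"
      then obtain j :: nat where "(of_real n - of_real \<alpha> * z) / 2 = - of_nat j" by (auto elim!: nonpos_Ints_cases')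
      then have zl: "z = of_real ((n + 2 * real j) / \<alpha>)" using \<alpha> by (simp add: field_simps)
      then have "(n + 2 * real j) / \<alpha> < u" using z by simp
      then have "(n + 2 * real j) / \<alpha> \<in> P" using gap[of j] by (auto simp: P_def)
      then show False using z zl by blast
    qed
  qed
  have holo: "F holomorphic_on ({z. 0 < Re z \<and> Re z < u} - of_real ` P)"
    unfolding F_def linnik_integrand_def linnik_kernel_def
    by (intro holomorphic_intros) (erule nonpole | use nonpole(1) in blast | simp)+
  have PP: "c0 < Re w \<and> Re w < c1 \<and> Im w = 0" if w: "w \<in> of_real ` P" for w
  proof -
    obtain s where s: "s \<in> P" "w = of_real s" using w by blast
    have "c0 < s \<and> s < c1"
      using s(1) unfolding P_def
    proof
      assume "s \<in> (\<lambda>l. \<nu> + real l) ` {..<N}"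
      then obtain l where l: "s = \<nu> + real l" "l < N" by blast
      then have "real l + 1 \<le> real N" by linarith
      then show ?thesis using l c0 c1 by linarith
    next
      assume "s \<in> (\<lambda>j. (n + 2 * real j) / \<alpha>) ` {j. (n + 2 * real j) / \<alpha> \<le> \<nu> + real N - 1/2}"
      then obtain j where j: "s = (n + 2 * real j) / \<alpha>" "s \<le> \<nu> + real N - 1/2" by blast
      have "\<alpha> * c0 < n + 2 * real j" using c0 by linarith
      then have "c0 < s" using \<alpha> by (simp add: j(1) pos_less_divide_eq mult.commute)
      then show ?thesis using j c1 by linarith
    qed
    then show ?thesis using s by simp
  qed
  have inj: "inj_on complex_of_real P" by (simp add: inj_on_def)
  note V = vertical_line_shift[OF c0(1) c01 c1(2) finite_imageI[OF fin] PP holo Y bound]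
  show "integrable lborel (\<lambda>y. F (Complex c0 y))" by (rule V(1))
  show "integrable lborel (\<lambda>y. F (Complex c1 y))" by (rule V(2))
  show "(\<integral>y. F (Complex c0 y) \<partial>lborel) = (\<integral>y. F (Complex c1 y) \<partial>lborel) - 2 * pi * (\<Sum>w\<in>P. residue F (of_real w))"
    using V(3) by (simp add: sum.reindex[OF inj])
qed

text \<open>On the line Re z = c0 the Mellin transform is the Fourier transform of the weighted
  profile \<open>m\<close>, with frequency t at z = c0 - i t / \<alpha>.
  \<open>Fourier_inversion_density\<close> at ln r, the substitution y = - t / \<alpha> and removal
  of the weight give the contour integral.\<close>

lemma linnik_contour_representation:
  fixes p :: "'a::euclidean_space \<Rightarrow> real"
  assumes p: "linnik_density \<alpha> \<nu> p" and \<alpha>: "\<alpha> > 0" and \<nu>: "\<nu> > 0"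
    and q: "\<And>x. x \<noteq> 0 \<Longrightarrow> q (norm x) = p x"
  defines "n \<equiv> real DIM('a)"
  assumes c0: "0 < c0" "c0 < \<nu>" "\<alpha> * c0 < n"
    and int: "\<And>x. integrable lborel (\<lambda>y. linnik_integrand \<alpha> \<nu> n x (Complex c0 y))"
    and r: "r > 0"
  shows "complex_of_real (q r) = of_real (1 / (2 powr n * pi powr (n / 2) * Gamma \<nu>))
     * (of_real (1 / (2 * pi)) * (\<integral>y. linnik_integrand \<alpha> \<nu> n (ln (r / 2)) (Complex c0 y) \<partial>lborel))"
proof -
  obtain e :: 'a where e: "norm e = 1" using norm_Basis SOME_Basis by blast
  then have e0: "e \<noteq> 0" by auto
  from p have p0: "\<And>x. p x \<ge> 0" and pc: "continuous_on (- {0}) p"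
    by (auto simp: linnik_density_def)
  have qe: "q (exp v) = p (exp v *\<^sub>R e)" for v
    using q[of "exp v *\<^sub>R e"] e e0 by auto
  define m where "m v = q (exp v) * exp ((n - \<alpha> * c0) * v)" for v
  define C where "C = pi powr (- (n / 2)) / (\<alpha> * Gamma \<nu>)"
  have C: "C > 0" using \<alpha> \<nu> by (simp add: C_def Gamma_real_pos)
  let ?z = "\<lambda>t. Complex c0 (- t / \<alpha>)"
  have mel1: "integrable lborel (\<lambda>v. of_real (q (exp v)) * exp ((of_real n - of_real \<alpha> * ?z t) * of_real v))" for t
    unfolding n_def by (rule linnik_mellin(1)[OF p \<alpha> \<nu> q]) (use c0 in \<open>simp_all add: n_def\<close>)
  have mel2: "(\<integral>v. of_real (q (exp v)) * exp ((of_real n - of_real \<alpha> * ?z t) * of_real v) \<partial>lborel)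
      = of_real C * exp (- (of_real \<alpha> * ?z t * of_real (ln 2)))
        * (Gamma (?z t) * Gamma (of_real \<nu> - ?z t) * Gamma ((of_real n - of_real \<alpha> * ?z t) / 2) / Gamma (of_real \<alpha> * ?z t / 2))" for t
    unfolding n_def C_def by (rule linnik_mellin(2)[OF p \<alpha> \<nu> q]) (use c0 in \<open>simp_all add: n_def\<close>)
  have mexp: "of_real (q (exp v)) * exp ((of_real n - of_real \<alpha> * ?z t) * of_real v) = iexp (t * v) * of_real (m v)" for t v
  proof -
    have "(of_real n - of_real \<alpha> * ?z t) * of_real v = of_real ((n - \<alpha> * c0) * v) + \<i> * of_real (t * v)"
      using \<alpha> by (simp add: complex_eq_iff)
    then have "exp ((of_real n - of_real \<alpha> * ?z t) * of_real v) = of_real (exp ((n - \<alpha> * c0) * v)) * iexp (t * v)"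
      by (simp only: exp_add exp_of_real)
    then show ?thesis by (simp only: m_def of_real_mult mult_ac)
  qed
  define \<phi> where "\<phi> t = (\<integral>v. iexp (t * v) * of_real (m v) \<partial>lborel)" for t
  have \<phi>eq: "\<phi> t = of_real C * exp (- (of_real \<alpha> * ?z t * of_real (ln 2))) * linnik_kernel \<alpha> \<nu> n (?z t)" for t
    using mel2[of t] unfolding mexp \<phi>_def linnik_kernel_def by (simp only: rGamma_inverse_Gamma divide_inverse)
  \<comment> \<open>The factor 2^(-\<alpha> z) is absorbed as the value x = - ln 2, so integrability
    of \<open>\<phi>\<close> becomes an instance of \<open>int\<close>.\<close>
  have \<phi>F: "\<phi> t = of_real (C * exp (- (n * ln 2))) * linnik_integrand \<alpha> \<nu> n (- ln 2) (?z t)" for t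
  proof -
    have "exp (- (of_real \<alpha> * ?z t * of_real (ln 2)))
       = of_real (exp (- (n * ln 2))) * exp ((of_real \<alpha> * ?z t - of_real n) * complex_of_real (- ln 2))"
    proof -
      have "- (of_real \<alpha> * ?z t * of_real (ln 2))
        = of_real (- (n * ln 2)) + (of_real \<alpha> * ?z t - of_real n) * complex_of_real (- ln 2)"
        by (simp add: algebra_simps)
      then show ?thesis by (simp only: exp_add exp_of_real)
    qed
    then show ?thesis unfolding \<phi>eq linnik_integrand_def by simp
  qed
  have mint: "integrable lborel m"
  proof -
    have "integrable lborel (\<lambda>v. complex_of_real (m v))" using mel1[of 0] unfolding mexp by simp
    then show ?thesis by (simp only: complex_of_real_integrable_eq)
  qed
  have m0: "m v \<ge> 0" for v by (simp add: m_def qe p0)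
  have mcont: "continuous_on UNIV m"
    unfolding m_def qe by (intro continuous_intros continuous_on_compose2[OF pc]) (use e0 in auto)
  \<comment> \<open>The total mass is the value of the transform at frequency 0, a product of Gamma
    factors at real points off their poles, hence nonzero.\<close>
  have mpos: "(\<integral>v. m v \<partial>lborel) > 0"
  proof -
    have "complex_of_real (\<integral>v. m v \<partial>lborel) = \<phi> 0" by (simp add: \<phi>_def)
    also have "\<phi> 0 \<noteq> 0"
      unfolding \<phi>eq linnik_kernel_def using C c0 \<alpha>
      by (auto simp: Gamma_eq_zero_iff rGamma_eq_zero_iff dest!: Re_pos_not_nonpos_Int[THEN notE, rotated])
    finally have "(\<integral>v. m v \<partial>lborel) \<noteq> 0" by auto
    moreover have "(\<integral>v. m v \<partial>lborel) \<ge> 0" using m0 by simp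
    ultimately show ?thesis by linarith
  qed
  have \<phi>int: "integrable lborel \<phi>"
  proof -
    have "integrable lborel (\<lambda>t. linnik_integrand \<alpha> \<nu> n (- ln 2) (Complex c0 (0 + (- 1 / \<alpha>) * t)))"
      by (rule lborel_integrable_real_affine[OF int]) (use \<alpha> in auto)
    then have "integrable lborel (\<lambda>t. of_real (C * exp (- (n * ln 2))) * linnik_integrand \<alpha> \<nu> n (- ln 2) (Complex c0 (0 + (- 1 / \<alpha>) * t)))"
      by (rule integrable_mult_right)
    then show ?thesis unfolding \<phi>F[abs_def] by simp
  qed
  define v where "v = ln r"
  have ev: "exp v = r" using r by (simp add: v_def)
  have xv: "ln (r / 2) = v - ln 2" using r by (simp add: v_def ln_div)
  have Qm: "q r = m v * exp ((\<alpha> * c0 - n) * v)"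
    by (simp add: m_def ev flip: exp_add) (simp add: algebra_simps)
  have minv: "of_real (m v) = of_real (1 / (2 * pi)) * (\<integral>t. iexp (- (t * v)) * \<phi> t \<partial>lborel)"
    by (rule Fourier_inversion_density[OF mcont m0 mint mpos \<phi>_def \<phi>int])
  have "(\<integral>t. iexp (- (t * v)) * \<phi> t \<partial>lborel) = \<alpha> *\<^sub>R (\<integral>y. iexp (- ((0 + (- \<alpha>) * y) * v)) * \<phi> (0 + (- \<alpha>) * y) \<partial>lborel)"
    using lborel_integral_real_affine[of "- \<alpha>" "\<lambda>t. iexp (- (t * v)) * \<phi> t" 0] \<alpha> by simp
  also have "\<dots> = of_real \<alpha> * (\<integral>y. of_real (C * exp (- (n * ln 2))) * (iexp (\<alpha> * y * v) * linnik_integrand \<alpha> \<nu> n (- ln 2) (Complex c0 y)) \<partial>lborel)"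
    unfolding \<phi>F scaleR_conv_of_real using \<alpha> by (simp add: mult_ac)
  also have "\<dots> = of_real \<alpha> * (of_real (C * exp (- (n * ln 2))) * (\<integral>y. iexp (\<alpha> * y * v) * linnik_integrand \<alpha> \<nu> n (- ln 2) (Complex c0 y) \<partial>lborel))"
    by (simp only: integral_mult_right_zero)
  finally have I: "(\<integral>t. iexp (- (t * v)) * \<phi> t \<partial>lborel) = of_real \<alpha> * (of_real (C * exp (- (n * ln 2))) * (\<integral>y. iexp (\<alpha> * y * v) * linnik_integrand \<alpha> \<nu> n (- ln 2) (Complex c0 y) \<partial>lborel))" .
  have "of_real (exp ((\<alpha> * c0 - n) * v)) * (\<integral>y. iexp (\<alpha> * y * v) * linnik_integrand \<alpha> \<nu> n (- ln 2) (Complex c0 y) \<partial>lborel)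
      = (\<integral>y. linnik_integrand \<alpha> \<nu> n (ln (r / 2)) (Complex c0 y) \<partial>lborel)"
  proof (subst integral_mult_right_zero[symmetric], rule Bochner_Integration.integral_cong)
    fix y
    have "of_real (exp ((\<alpha> * c0 - n) * v)) * iexp (\<alpha> * y * v) = exp ((of_real \<alpha> * Complex c0 y - of_real n) * of_real v)"
    proof -
      have "(of_real \<alpha> * Complex c0 y - of_real n) * of_real v = of_real ((\<alpha> * c0 - n) * v) + \<i> * of_real (\<alpha> * y * v)"
        by (simp add: complex_eq_iff)
      then show ?thesis by (simp only: exp_add exp_of_real)
    qed
    then have "of_real (exp ((\<alpha> * c0 - n) * v)) * (iexp (\<alpha> * y * v) * linnik_integrand \<alpha> \<nu> n (- ln 2) (Complex c0 y))
      = linnik_kernel \<alpha> \<nu> n (Complex c0 y) * (exp ((of_real \<alpha> * Complex c0 y - of_real n) * of_real v)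
          * exp ((of_real \<alpha> * Complex c0 y - of_real n) * of_real (- ln 2)))"
      by (simp add: linnik_integrand_def mult_ac)
    also have "\<dots> = linnik_integrand \<alpha> \<nu> n (ln (r / 2)) (Complex c0 y)"
      unfolding linnik_integrand_def xv exp_add[symmetric] by (simp add: algebra_simps)
    finally show "of_real (exp ((\<alpha> * c0 - n) * v)) * (iexp (\<alpha> * y * v) * linnik_integrand \<alpha> \<nu> n (- ln 2) (Complex c0 y))
      = linnik_integrand \<alpha> \<nu> n (ln (r / 2)) (Complex c0 y)" .
  qed simp
  note JE = this
  have "\<alpha> * (C * exp (- (n * ln 2))) = 1 / (2 powr n * pi powr (n / 2) * Gamma \<nu>)"
    using \<alpha> by (simp add: C_def powr_def exp_minus field_simps)
  then have CC: "complex_of_real \<alpha> * of_real (C * exp (- (n * ln 2))) = of_real (1 / (2 powr n * pi powr (n / 2) * Gamma \<nu>))"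
    by (simp only: of_real_mult[symmetric])
  have gen: "P * (A * (B * X)) * E = D * (P * J)" if "E * X = J" "A * B = D" for P A B X E D J :: complex
    unfolding that[symmetric] by (simp add: mult_ac)
  show ?thesis
    unfolding Qm of_real_mult[of "m v"] minv I by (rule gen[OF JE CC])
qed

subsection \<open>The expansion\<close>

lemma exp_ln_half_powr: "(r::real) > 0 \<Longrightarrow> exp (a * ln (r / 2)) = (r / 2) powr a"
  by (simp add: powr_def)

text \<open>\<open>P\<close> splits into three disjoint sets: poles of the first family alone, poles
  of the second alone, and common poles, the last listed by \<open>l\<close>. On each of them one of
  the three residue formulas applies.\<close>

lemma sum_residues:
  fixes n N :: nat and \<alpha> \<nu> r :: real
  assumes \<alpha>: "0 < \<alpha>" "\<alpha> < 2" and \<nu>: "\<nu> > 0" and n: "n > 0" and N: "N \<ge> 1" and r: "r > 0"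
  defines "P \<equiv> (\<lambda>l. \<nu> + real l) ` {..<N} \<union> (\<lambda>j. (real n + 2 * real j) / \<alpha>) ` {j. (real n + 2 * real j) / \<alpha> \<le> \<nu> + real N - 1/2}"
  shows "(\<Sum>w\<in>P. residue (linnik_integrand \<alpha> \<nu> (real n) (ln (r / 2))) (of_real w))
     = - of_real (S_sum1 \<alpha> \<nu> n N r + 2 / \<alpha> * S_sum2 \<alpha> \<nu> n N r - S_sum3 \<alpha> \<nu> n N r)"
proof -
  let ?res = "\<lambda>w. residue (linnik_integrand \<alpha> \<nu> (real n) (ln (r / 2))) (complex_of_real w)"
  let ?a = "\<lambda>l::nat. \<nu> + real l" and ?b = "\<lambda>j::nat. (real n + 2 * real j) / \<alpha>"
  have rn: "real n > 0" using n by simp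
  define I1 where "I1 = {l. l \<le> N - 1 \<and> (\<forall>j::nat. real l \<noteq> (real n + 2 * real j) / \<alpha> - \<nu>)}"
  define I3 where "I3 = {l. l \<le> N - 1 \<and> (\<exists>j::nat. real l = (real n + 2 * real j) / \<alpha> - \<nu>)}"
  define I2 where "I2 = {j. int j \<le> \<lfloor>(\<alpha> * (\<nu> + real N - 1/2) - real n) / 2\<rfloor> \<and>
            (\<forall>l::nat. real j \<noteq> (\<alpha> * (\<nu> + real l) - real n) / 2)}"
  have b_iff: "?b j \<le> \<nu> + real N - 1/2 \<longleftrightarrow> int j \<le> \<lfloor>(\<alpha> * (\<nu> + real N - 1/2) - real n) / 2\<rfloor>" for j
    unfolding le_floor_iff using \<alpha> by (simp add: pos_divide_le_eq) (auto simp: algebra_simps)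
  have ab_iff: "real j = (\<alpha> * (\<nu> + real l) - real n) / 2 \<longleftrightarrow> ?a l = ?b j" for l j
    using \<alpha> by (auto simp: field_simps)
  have la_iff: "real l = ?b j - \<nu> \<longleftrightarrow> ?a l = ?b j" for l j
    by (auto simp: algebra_simps)
  have P: "P = ?a ` I1 \<union> (?b ` I2 \<union> ?a ` I3)"
  proof
    show "P \<subseteq> ?a ` I1 \<union> (?b ` I2 \<union> ?a ` I3)"
    proof
      fix w assume "w \<in> P"
      then consider l where "l < N" "w = ?a l" | j where "?b j \<le> \<nu> + real N - 1/2" "w = ?b j"
        by (auto simp: P_def)
      then show "w \<in> ?a ` I1 \<union> (?b ` I2 \<union> ?a ` I3)"
      proof cases
        case 1
        then have "l \<in> I1 \<or> l \<in> I3" by (auto simp: I1_def I3_def)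
        then show ?thesis using 1 by blast
      next
        case 2
        show ?thesis
        proof (cases "\<exists>l. ?a l = ?b j")
          case True
          then obtain l where l: "?a l = ?b j" by blast
          \<comment> \<open>Here the half in the cut-off acts: a common pole \<nu> + l \<le> \<nu> +
            N - 1/2 has l < N, so it is already indexed by the first family.\<close>
          then have "real l < real N" using 2 by linarith
          then have "l \<in> I3" using l unfolding I3_def la_iff by auto
          then show ?thesis using 2 l by (metis UnI2 image_eqI)
        next
          case False
          then have "j \<in> I2" using 2 unfolding I2_def b_iff[symmetric] ab_iff by auto
          then show ?thesis using 2 by blast
        qed
      qed
    qed
    have "?a ` I1 \<subseteq> P" "?a ` I3 \<subseteq> P" using N by (auto simp: P_def I1_def I3_def)
    moreover have "?b ` I2 \<subseteq> P" unfolding P_def I2_def b_iff[symmetric] by auto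
    ultimately show "?a ` I1 \<union> (?b ` I2 \<union> ?a ` I3) \<subseteq> P" by blast
  qed
  have "finite P"
    unfolding P_def using finite_n_poles[OF \<alpha>(1)] by auto
  then have fin: "finite (?a ` I1)" "finite (?b ` I2)" "finite (?a ` I3)" unfolding P by auto
  have inja: "inj_on ?a S" for S by (simp add: inj_on_def)
  have injb: "inj_on ?b S" for S using \<alpha> by (simp add: inj_on_def)
  have disj1: "?a ` I1 \<inter> (?b ` I2 \<union> ?a ` I3) = {}"
  proof -
    have "?a l \<noteq> ?b j" if "l \<in> I1" for l j using that unfolding I1_def la_iff by auto
    moreover have "I1 \<inter> I3 = {}" by (auto simp: I1_def I3_def)
    ultimately show ?thesis by (fastforce simp: image_iff)
  qed
  have disj2: "?b ` I2 \<inter> ?a ` I3 = {}"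
  proof -
    have "?a l \<noteq> ?b j" if "j \<in> I2" for l j using that unfolding I2_def ab_iff by auto
    then show ?thesis by fastforce
  qed
  have s1: "(\<Sum>l\<in>I1. ?res (?a l)) = - of_real (S_sum1 \<alpha> \<nu> n N r)"
    unfolding S_sum1_def I1_def[symmetric] of_real_sum sum_negf[symmetric]
  proof (rule sum.cong)
    fix l assume "l \<in> I1"
    then have "?a l \<noteq> ?b j" for j unfolding I1_def la_iff by auto
    from residue_nu_pole[OF \<alpha> \<nu> rn this, of "ln (r / 2)"]
    show "?res (?a l) = - of_real ((-1) ^ l / fact l * Gamma (\<nu> + real l)
        * (Gamma ((real n - \<alpha> * (\<nu> + real l)) / 2) / Gamma (\<alpha> * (\<nu> + real l) / 2))
        * (r / 2) powr (\<alpha> * \<nu> - real n + \<alpha> * real l))"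
      unfolding exp_ln_half_powr[OF r] by (simp only: ring_distribs diff_add_eq)
  qed simp
  have s2: "(\<Sum>j\<in>I2. ?res (?b j)) = - of_real (2 / \<alpha> * S_sum2 \<alpha> \<nu> n N r)"
    unfolding S_sum2_def I2_def[symmetric] sum_distrib_left of_real_sum sum_negf[symmetric]
  proof (rule sum.cong)
    fix j assume "j \<in> I2"
    then have nl: "?b j \<noteq> ?a l" for l unfolding I2_def ab_iff by auto
    have e: "exp (2 * real j * ln (r / 2)) = (r / 2) ^ (2 * j)"
      unfolding exp_ln_half_powr[OF r] using r powr_realpow[of "r / 2" "2 * j"] by simp
    have g: "(\<alpha> * \<nu> - real n - 2 * real j) / \<alpha> = \<nu> - ?b j" using \<alpha> by (simp add: field_simps)
    show "?res (?b j) = - of_real (2 / \<alpha> * ((-1) ^ j / fact j * (Gamma ((real n + 2 * real j) / \<alpha>) / Gamma ((real n + 2 * real j) / 2))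
        * Gamma ((\<alpha> * \<nu> - real n - 2 * real j) / \<alpha>) * (r / 2) ^ (2 * j)))"
      using residue_n_pole[OF \<alpha> \<nu> rn nl, of "ln (r / 2)"] unfolding e g .
  qed simp
  have s3: "(\<Sum>l\<in>I3. ?res (?a l)) = of_real (S_sum3 \<alpha> \<nu> n N r)"
    unfolding S_sum3_def I3_def[symmetric] of_real_sum Let_def
  proof (rule sum.cong)
    fix l assume "l \<in> I3"
    then obtain j where j: "?a l = ?b j" unfolding I3_def la_iff by auto
    \<comment> \<open>With this the floor in \<open>S_sum3_def\<close> is taken of a natural number
      and returns \<open>j\<close> itself.\<close>
    then have j': "(\<alpha> * (\<nu> + real l) - real n) / 2 = real j" using ab_iff by metis
    have lnsq: "ln ((r / 2)\<^sup>2) = 2 * ln (r / 2)" using r by (simp add: ln_realpow)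
    show "?res (?a l) = of_real ((-1) ^ (l + nat \<lfloor>(\<alpha> * (\<nu> + real l) - real n) / 2\<rfloor>) / (fact l * fact (nat \<lfloor>(\<alpha> * (\<nu> + real l) - real n) / 2\<rfloor>))
        * (Gamma (\<nu> + real l) / Gamma (\<alpha> * (\<nu> + real l) / 2))
        * (2 / \<alpha> * Digamma (\<nu> + real l) - 2 / \<alpha> * Digamma (real l + 1)
           - Digamma (\<alpha> * (\<nu> + real l) / 2)
           - Digamma ((\<alpha> * (\<nu> + real l) - real n) / 2 + 1)
           + ln ((r / 2)\<^sup>2))
        * (r / 2) powr (\<alpha> * \<nu> - real n + \<alpha> * real l))"
      using residue_double_pole[OF \<alpha> \<nu> rn j, of "ln (r / 2)"]
      unfolding exp_ln_half_powr[OF r] j' lnsq floor_of_nat nat_int by (simp only: ring_distribs diff_add_eq)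
  qed simp
  have "(\<Sum>w\<in>P. ?res w) = (\<Sum>w\<in>?a ` I1. ?res w) + ((\<Sum>w\<in>?b ` I2. ?res w) + (\<Sum>w\<in>?a ` I3. ?res w))"
    unfolding P using fin disj1 disj2 by (simp add: sum.union_disjoint)
  also have "\<dots> = (\<Sum>l\<in>I1. ?res (?a l)) + ((\<Sum>j\<in>I2. ?res (?b j)) + (\<Sum>l\<in>I3. ?res (?a l)))"
    unfolding sum.reindex[OF inja] sum.reindex[OF injb] o_def ..
  also have "\<dots> = - of_real (S_sum1 \<alpha> \<nu> n N r + 2 / \<alpha> * S_sum2 \<alpha> \<nu> n N r - S_sum3 \<alpha> \<nu> n N r)"
    unfolding s1 s2 s3 by simp
  finally show ?thesis .
qed

text \<open>If \<open>l\<close> is the least index that occurs, the sum for \<open>M = l + 1\<close> has a single term, and its logarithm is not constant in \<open>r\<close>.\<close>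

lemma S_sum3_zero_iff:
  assumes \<alpha>: "\<alpha> \<in> {0<..<2}" and \<nu>: "\<nu> > 0"
  shows "(\<forall>M\<ge>1. \<forall>r>0. S_sum3 \<alpha> \<nu> n M r = 0) \<longleftrightarrow> (\<alpha>, \<nu>) \<notin> Lambda_set n"
proof -
  let ?Q = "\<lambda>l::nat. \<exists>j::nat. real l = (real n + 2 * real j) / \<alpha> - \<nu>"
  have \<alpha>0: "\<alpha> > 0" using \<alpha> by simp
  have "real n + 2 * real j = \<alpha> * (\<nu> + real l) \<longleftrightarrow> real l = (real n + 2 * real j) / \<alpha> - \<nu>" for j l
    using \<alpha>0 by (auto simp: field_simps)
  then have L: "(\<alpha>, \<nu>) \<in> Lambda_set n \<longleftrightarrow> (\<exists>l. ?Q l)"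
    using \<alpha> \<nu> by (auto simp: Lambda_set_def)
  show ?thesis
  proof
    assume "(\<alpha>, \<nu>) \<notin> Lambda_set n"
    then have "{l. l \<le> M - 1 \<and> ?Q l} = {}" for M unfolding L by blast
    then show "\<forall>M\<ge>1. \<forall>r>0. S_sum3 \<alpha> \<nu> n M r = 0"
      by (simp only: S_sum3_def sum.empty simp_thms)
  next
    assume zero: "\<forall>M\<ge>1. \<forall>r>0. S_sum3 \<alpha> \<nu> n M r = 0"
    show "(\<alpha>, \<nu>) \<notin> Lambda_set n"
    proof
      assume "(\<alpha>, \<nu>) \<in> Lambda_set n"
      then have ex: "\<exists>l. ?Q l" unfolding L .
      define l where "l = (LEAST l. ?Q l)"
      have Ql: "?Q l" unfolding l_def by (rule LeastI_ex[OF ex])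
      have single: "{k. k \<le> Suc l - 1 \<and> ?Q k} = {l}"
      proof -
        have "l \<le> k" if "?Q k" for k unfolding l_def using that by (rule Least_le)
        moreover have "{k. k \<le> Suc l - 1 \<and> P k} = {l}" if "P l" "\<And>k. P k \<Longrightarrow> l \<le> k" for P
          using that by (auto intro: antisym)
        ultimately show ?thesis using Ql by blast
      qed
      define D where "D = 2 / \<alpha> * Digamma (\<nu> + real l) - 2 / \<alpha> * Digamma (real l + 1)
           - Digamma (\<alpha> * (\<nu> + real l) / 2) - Digamma ((\<alpha> * (\<nu> + real l) - real n) / 2 + 1)"
      have pos: "Gamma (\<nu> + real l) > 0" "Gamma (\<alpha> * (\<nu> + real l) / 2) > 0"
        using \<nu> \<alpha>0 by (auto intro!: Gamma_real_pos mult_pos_pos add_pos_nonneg)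
      have D0: "D + ln ((r / 2)\<^sup>2) = 0" if r: "r > 0" for r
      proof -
        \<comment> \<open>The factors in front of the bracket are nonzero by \<open>pos\<close>, so
          the bracket vanishes for every r > 0.\<close>
        have "S_sum3 \<alpha> \<nu> n (Suc l) r = 0" using zero r by simp
        then show ?thesis
          unfolding S_sum3_def single Let_def using pos r by (simp add: D_def)
      qed
      \<comment> \<open>At r = 2 the logarithm is 0, and at r = 2 e it is 2.\<close>
      have "D = 0" using D0[of 2] by simp
      moreover have "D + 2 = 0" using D0[of "2 * exp 1"] by (simp add: ln_realpow)
      ultimately show False by simp
    qed
  qed
qed

text \<open>The closing equivalence ranges over all \<open>M\<close> and \<open>r\<close>: for one
  fixed \<open>N\<close> every coincidence may have an index l \<ge> N, and for one fixed
  \<open>r\<close> the bracket may vanish by accident.\<close>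

theorem proposition3p9:
  fixes p :: "real ^ 'n \<Rightarrow> real" and q :: "real \<Rightarrow> real"
    and \<alpha> \<nu> :: real and n N :: nat
  assumes n: "n = CARD('n)"
    and \<alpha>: "\<alpha> \<in> {0<..<2}" and \<nu>: "\<nu> > 0" and N: "N \<ge> 1"
    and p: "linnik_density \<alpha> \<nu> p"
    and q: "\<And>x. x \<noteq> 0 \<Longrightarrow> q (norm x) = p x"
  shows "(\<exists>R. (\<forall>r>0. q r = S_expansion \<alpha> \<nu> n N r + R r) \<and>
              R \<in> O[at_right 0](\<lambda>r. r powr (\<alpha> * \<nu> - real n + \<alpha> * (real N - 3/4))))
       \<and> ((\<forall>M\<ge>1. \<forall>r>0. S_sum3 \<alpha> \<nu> n M r = 0) \<longleftrightarrow> (\<alpha>, \<nu>) \<notin> Lambda_set n)"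
proof (rule conjI)
  show "(\<forall>M\<ge>1. \<forall>r>0. S_sum3 \<alpha> \<nu> n M r = 0) \<longleftrightarrow> (\<alpha>, \<nu>) \<notin> Lambda_set n"
    by (rule S_sum3_zero_iff[OF \<alpha> \<nu>])
next
  have a: "0 < \<alpha>" "\<alpha> < 2" using \<alpha> by auto
  have n0: "n > 0" using n by simp
  then have rn: "real n > 0" by simp
  have dim: "real DIM(real ^ 'n) = real n" by (simp add: n)
  \<comment> \<open>The middle of the strip on which the Mellin transform converges.\<close>
  define c0 where "c0 = min \<nu> (real n / \<alpha>) / 2"
  have c0: "0 < c0" "c0 < \<nu>" "\<alpha> * c0 < real n"
  proof -
    have "0 < m / 2 \<and> m / 2 < m" if "m > 0" for m :: real using that by simp
    then have "0 < c0" "c0 < min \<nu> (real n / \<alpha>)"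
      unfolding c0_def using \<nu> a rn by (metis divide_pos_pos min_def)+
    then show "0 < c0" "c0 < \<nu>" "\<alpha> * c0 < real n" using a by (simp_all add: pos_less_divide_eq mult.commute)
  qed
  obtain c1 u where c1: "\<nu> + real N - 1/2 < c1" "c1 < u" "u \<le> \<nu> + real N"
    and gap: "\<And>j::nat. (real n + 2 * real j) / \<alpha> \<le> \<nu> + real N - 1/2 \<or> u \<le> (real n + 2 * real j) / \<alpha>"
    by (rule ex_contour_abscissa[of \<alpha> "\<nu> + real N - 1/2" "\<nu> + real N" "real n"]) (use a in auto)
  note shift = linnik_integrand_shift[OF a \<nu> rn c0 c1 N gap]
  define C where "C = 1 / (2 ^ n * pi powr (real n / 2) * Gamma \<nu>)"
  have C: "C > 0" using Gamma_real_pos[OF \<nu>] by (simp add: C_def)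
  define R where "R r = q r - S_expansion \<alpha> \<nu> n N r" for r
  let ?J = "\<lambda>r. \<integral>y. linnik_integrand \<alpha> \<nu> (real n) (ln (r / 2)) (Complex c1 y) \<partial>lborel"
  have R: "complex_of_real (R r) = of_real (C / (2 * pi)) * ?J r" if r: "r > 0" for r
  proof -
    have "complex_of_real (q r) = of_real (1 / (2 powr real n * pi powr (real n / 2) * Gamma \<nu>))
     * (of_real (1 / (2 * pi)) * (\<integral>y. linnik_integrand \<alpha> \<nu> (real n) (ln (r / 2)) (Complex c0 y) \<partial>lborel))"
      using linnik_contour_representation[OF p a(1) \<nu> q, unfolded dim, OF _ c0 shift(1) r] by blast
    also have "1 / (2 powr real n * pi powr (real n / 2) * Gamma \<nu>) = C"
      by (simp add: C_def powr_realpow)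
    also have "(\<integral>y. linnik_integrand \<alpha> \<nu> (real n) (ln (r / 2)) (Complex c0 y) \<partial>lborel)
      = ?J r + of_real (2 * pi) * of_real (S_sum1 \<alpha> \<nu> n N r + 2 / \<alpha> * S_sum2 \<alpha> \<nu> n N r - S_sum3 \<alpha> \<nu> n N r)"
      unfolding shift(3) sum_residues[OF a \<nu> n0 N r] by (simp only: mult_minus_right diff_minus_eq_add)
    also have "of_real C * (of_real (1 / (2 * pi)) * (?J r + of_real (2 * pi) * of_real (S_sum1 \<alpha> \<nu> n N r + 2 / \<alpha> * S_sum2 \<alpha> \<nu> n N r - S_sum3 \<alpha> \<nu> n N r)))
      = of_real (C * (1 / (2 * pi))) * ?J r
       + of_real C * complex_of_real (S_sum1 \<alpha> \<nu> n N r + 2 / \<alpha> * S_sum2 \<alpha> \<nu> n N r - S_sum3 \<alpha> \<nu> n N r)"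
    proof -
      have "c * (i * (J + t * S)) = (c * i) * J + c * S" if "i * t = 1" for c i J t S :: complex
      proof -
        have "i * (t * S) = S" using that by (simp flip: mult.assoc)
        then show ?thesis by (simp add: ring_distribs)
      qed
      moreover have "of_real (1 / (2 * pi)) * complex_of_real (2 * pi) = 1" by (simp flip: of_real_mult)
      ultimately show ?thesis by (simp only: of_real_mult[of C])
    qed
    finally have "complex_of_real (q r) = of_real (C / (2 * pi)) * ?J r
       + of_real (C * (S_sum1 \<alpha> \<nu> n N r + 2 / \<alpha> * S_sum2 \<alpha> \<nu> n N r - S_sum3 \<alpha> \<nu> n N r))"
      by simp
    then show ?thesis by (simp add: R_def S_expansion_def C_def)
  qed
  \<comment> \<open>On the new line the modulus of the integrand depends on r only through (r /
    2)^e, so this constant, taken at x = 0, serves for all r.\<close>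
  define B where "B = (\<integral>y. norm (linnik_integrand \<alpha> \<nu> (real n) 0 (Complex c1 y)) \<partial>lborel)"
  define e where "e = \<alpha> * c1 - real n"
  define e' where "e' = \<alpha> * \<nu> - real n + \<alpha> * (real N - 3/4)"
  \<comment> \<open>The claimed exponent belongs to the abscissa \<nu> + N - 3/4, to the left of
    \<open>c1\<close>; near 0 the smaller exponent gives the larger power.\<close>
  have ee: "e' \<le> e"
  proof -
    have "\<alpha> * (\<nu> + real N - 3/4) \<le> \<alpha> * c1" using a c1 by (intro mult_left_mono) auto
    then show ?thesis by (simp add: e_def e'_def algebra_simps)
  qed
  have Rb: "\<bar>R r\<bar> \<le> C / (2 * pi) * B * (1 / 2) powr e * r powr e" if r: "r > 0" for r
  proof -
    have "norm (?J r) \<le> (\<integral>y. norm (linnik_integrand \<alpha> \<nu> (real n) (ln (r / 2)) (Complex c1 y)) \<partial>lborel)"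
      by (rule integral_norm_bound)
    also have "\<dots> = (\<integral>y. exp (e * ln (r / 2)) * norm (linnik_integrand \<alpha> \<nu> (real n) 0 (Complex c1 y)) \<partial>lborel)"
      unfolding norm_linnik_integrand by (simp add: e_def mult.commute)
    also have "\<dots> = (r / 2) powr e * B"
      unfolding B_def exp_ln_half_powr[OF r] by simp
    also have "(r / 2) powr e = (1 / 2) powr e * r powr e"
      using r powr_mult[of "1 / 2" r e] by simp
    finally have J: "norm (?J r) \<le> (1 / 2) powr e * r powr e * B" .
    have "\<bar>R r\<bar> = C / (2 * pi) * norm (?J r)"
      using arg_cong[OF R[OF r], of norm] C by (simp add: norm_mult norm_divide)
    also have "\<dots> \<le> C / (2 * pi) * ((1 / 2) powr e * r powr e * B)"
      using C by (intro mult_left_mono J) simp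
    finally show ?thesis by (simp add: mult_ac)
  qed
  have "R \<in> O[at_right 0](\<lambda>r. r powr e')"
  proof (rule bigoI[where c = "C / (2 * pi) * B * (1 / 2) powr e"])
    have "eventually (\<lambda>r::real. r \<in> {0<..<1}) (at_right 0)"
      by (rule eventually_at_right_real) simp
    then show "\<forall>\<^sub>F r in at_right 0. norm (R r) \<le> C / (2 * pi) * B * (1 / 2) powr e * norm (r powr e')"
    proof eventually_elim
      case (elim r)
      have "B \<ge> 0" by (simp add: B_def)
      then have "C / (2 * pi) * B * (1 / 2) powr e * r powr e \<le> C / (2 * pi) * B * (1 / 2) powr e * r powr e'"
        using C elim ee by (intro mult_left_mono powr_mono') auto
      then show ?case using Rb[of r] elim by simp
    qed
  qed
  then show "\<exists>R. (\<forall>r>0. q r = S_expansion \<alpha> \<nu> n N r + R r) \<and>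
              R \<in> O[at_right 0](\<lambda>r. r powr (\<alpha> * \<nu> - real n + \<alpha> * (real N - 3/4)))"
    by (intro exI[of _ R]) (simp add: R_def e'_def)
qed

end
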